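(* Let $F$ be a field of characteristic $\neq 2$. For every integer $q\ge 2$ there exists a finitely generated simple Lie algebra $\mathfrak{g}$ over $F$ such that $\operatorname{Dim}^q(\gamma_{\mathfrak{g}}(n))=\infty$ but $\operatorname{Dim}^{q+1}(\gamma_{\mathfrak{g}}(n))=0$.
   Context: For a finitely generated Lie algebra $\mathfrak{g}$ over $F$ and a finite-dimensional subspace $V\subseteq\mathfrak{g}$ generating $\mathfrak{g}$ as a Lie algebra, the growth function is $\gamma_{\mathfrak{g}}(n)=\gamma_{\mathfrak{g},V}(n)=\dim_F\big(\sum_{i=1}^{n}V^{[i]}\big)$, where $V^{[i]}$ is the span of all length-$i$ Lie products of elements of $V$. It is independent of $V$ up to the equivalence relation $\sim$, where $f\preceq g$ means that there are $C,D>0$ with $f(n)\le Cg(Dn)$ for all $n\in\mathbb{N}$, and $f\sim g$ means $f\preceq g$ and $g\preceq f$. Put $\ln^{(1)}n=\ln n$ and $\ln^{(k+1)}n=\ln(\ln^{(k)}n)$. For real $\alpha>0$ and sufficiently large $n$ define $$\Phi^2_\alpha(n)=n^\alpha,\qquad \Phi^3_\alpha(n)=\exp\big(n^{\alpha/(\alpha+1)}\big),\qquad \Phi^q_\alpha(n)=\exp\left(\frac{n}{(\ln^{(q-3)}n)^{1/\alpha}}\right)\ \text{ for } q=4,5,\dots$$ For a function $f$ on $\mathbb{N}$ define $$\operatorname{Dim}^q f=\inf\{\alpha\in\mathbb{R}^+ : f(n)\le\Phi^q_\alpha(n)\text{ for all sufficiently large } n\},$$ with the convention $\inf\emptyset=\infty$.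 *)

theory Defs
  imports Complex_Main "HOL-Library.Poly_Mapping" "HOL-Library.Extended_Real"
begin

locale lie_algebra = vector_space scale
  for scale :: "'f::field \<Rightarrow> 'a::ab_group_add \<Rightarrow> 'a" +
  fixes bracket :: "'a \<Rightarrow> 'a \<Rightarrow> 'a"
  assumes linear_right: "Vector_Spaces.linear scale scale (\<lambda>y. bracket x y)"
    and linear_left: "Vector_Spaces.linear scale scale (\<lambda>x. bracket x y)"
    and alternating: "bracket x x = 0"
    and jacobi: "bracket x (bracket y z) + bracket y (bracket z x) + bracket z (bracket x y) = 0"
begin

definition lie_subalgebra :: "'a set \<Rightarrow> bool" where
  "lie_subalgebra H \<longleftrightarrow> subspace H \<and> (\<forall>x\<in>H. \<forall>y\<in>H. bracket x y \<in> H)"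

definition lie_ideal :: "'a set \<Rightarrow> bool" where
  "lie_ideal I \<longleftrightarrow> subspace I \<and> (\<forall>x. \<forall>y\<in>I. bracket x y \<in> I)"

definition generates :: "'a set \<Rightarrow> bool" where
  "generates S \<longleftrightarrow> lie_subalgebra hull S = UNIV"

definition finitely_generated :: bool where
  "finitely_generated \<longleftrightarrow> (\<exists>S. finite S \<and> generates S)"

definition finite_dim_generating_subspace :: "'a set \<Rightarrow> bool" where
  "finite_dim_generating_subspace V \<longleftrightarrow>
     subspace V \<and> (\<exists>B. finite B \<and> span B = V) \<and> generates V"

text \<open>\<open>lie_product V i x\<close>: \<open>x\<close> is a product, with an arbitrary arrangement of brackets,
  of \<open>i\<close> elements of \<open>V\<close>.\<close>

inductive lie_product :: "'a set \<Rightarrow> nat \<Rightarrow> 'a \<Rightarrow> bool" for V where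
  generator: "v \<in> V \<Longrightarrow> lie_product V 1 v"
| product: "lie_product V i x \<Longrightarrow> lie_product V j y \<Longrightarrow> lie_product V (i + j) (bracket x y)"

definition lie_power :: "'a set \<Rightarrow> nat \<Rightarrow> 'a set" where
  "lie_power V i = span {x. lie_product V i x}"

text \<open>The sum of subspaces is the span of their union.  For finite-dimensional \<open>V\<close> this span is
  finite-dimensional, so the convention \<open>dim = 0\<close> in infinite dimension plays no role.\<close>

definition growth :: "'a set \<Rightarrow> nat \<Rightarrow> nat" where
  "growth V n = dim (span (\<Union>i\<in>{1..n}. lie_power V i))"

end

locale simple_lie_algebra = lie_algebra +
  assumes nonabelian: "\<exists>x y. bracket x y \<noteq> 0"
    and no_proper_ideals: "lie_ideal I \<Longrightarrow> I = {0} \<or> I = UNIV"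

text \<open>Only the values for \<open>q \<ge> 2\<close>, \<open>\<alpha> > 0\<close> and sufficiently large \<open>n\<close>
  (where all iterated logarithms are positive) are meaningful.\<close>

definition Phi :: "nat \<Rightarrow> real \<Rightarrow> nat \<Rightarrow> real" where
  "Phi q \<alpha> n =
     (if q = 2 then real n powr \<alpha>
      else if q = 3 then exp (real n powr (\<alpha> / (\<alpha> + 1)))
      else exp (real n / ((ln ^^ (q - 3)) (real n) powr (1 / \<alpha>))))"

text \<open>In \<^typ>\<open>ereal\<close>, \<open>Inf {} = \<infinity>\<close>.\<close>

definition Dim :: "nat \<Rightarrow> (nat \<Rightarrow> real) \<Rightarrow> ereal" where
  "Dim q f = Inf (ereal ` {\<alpha>. 0 < \<alpha> \<and> (\<forall>\<^sub>F n in sequentially. f n \<le> Phi q \<alpha> n)})"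

text \<open>The growth function depends on the generating subspace only up to equivalence, and
  \<^const>\<open>Dim\<close> is invariant under that equivalence.  ``The'' dimension of the growth function is
  therefore rendered by requiring the value for every finite-dimensional generating subspace.\<close>

definition (in lie_algebra) growth_Dim_eq :: "nat \<Rightarrow> ereal \<Rightarrow> bool" where
  "growth_Dim_eq q d \<longleftrightarrow>
     (\<forall>V. finite_dim_generating_subspace V \<longrightarrow> Dim q (\<lambda>n. real (growth V n)) = d)"

text \<open>An existence statement in HOL has to name the type of the algebra.  A finitely generated Lie
  algebra over \<open>'f\<close> has countable dimension, and one with unbounded growth has infinite dimension,
  so its underlying vector space is isomorphic to that of the finitely supported functions
  \<^typ>\<open>nat \<Rightarrow>\<^sub>0 'f\<close>; existence on this type is the same as existence on any type.\<close>

end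

theory Submission
  imports Defs "HOL-Library.Countable_Set" "HOL-Real_Asymp.Real_Asymp"
begin

text \<open>
  The dimensions for \<open>q\<close> and \<open>q + 1\<close> leave a wide gap.  The function \<open>exp ((ln n)\<^sup>2)\<close> grows faster than
  every \<open>n\<^sup>\<alpha>\<close> but slower than every \<open>exp (n\<^sup>\<beta>)\<close>, and for \<open>q \<ge> 3\<close> the function
  \<open>exp (n / exp (sqrt (iterlog (q - 2) n)))\<close> eventually lies above every \<open>Phi q \<alpha>\<close> and below
  every \<open>Phi (q + 1) \<alpha>\<close>, even after rescaling of the argument (\<open>separating_rate_exists\<close>).  With \<open>exp (f n)\<close>
  for this function, it suffices to find a finitely generated simple Lie algebra whose growth is at most
  about \<open>exp (3 / 2 * f n)\<close> for all \<open>n\<close> and at least about \<open>exp (f n / 4)\<close> for infinitely many \<open>n\<close>: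
  an infinite dimension only says that the inequality with \<open>Phi q \<alpha>\<close> fails infinitely often.

  Growth functions of this kind come from words.  Let \<open>w\<close> be a two-sided infinite word over two letters
  and let \<open>p n\<close> be the number of its factors of length \<open>n\<close>.  The shift and the indicator functions of
  the two letters generate an algebra \<open>A\<close> of operators on functions on the integers (a subalgebra of the
  crossed product of a subshift).  A product of \<open>n\<close> generators is a local rule: it looks at \<open>w\<close> only
  up to distance \<open>n\<close>, so that these products span a space of dimension at most about \<open>n * p (2 * n + 1)\<close>
  (\<open>local_rule_finite_dim\<close>).  Conversely, every factor of length \<open>n\<close> can be read by a product of
  \<open>2 * n\<close> generators, and the resulting \<open>p n\<close> operators are independent (\<open>reader_independent\<close>).
  If \<open>w\<close> is uniformly recurrent and not periodic, then \<open>A\<close> is simple (\<open>word_algebra_simple\<close>).  Words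
  with these properties and with \<open>p\<close> as required are built from blocks (\<open>recurrent_word_exists\<close>).

  A simple algebra is turned into a simple Lie algebra by passing to matrices of size three.  Let \<open>L\<close> be
  the Lie algebra generated by the matrices with one off-diagonal entry, this entry being a generator of \<open>A\<close>.
  As \<open>[e\<^sub>i\<^sub>k a, e\<^sub>k\<^sub>j b] = e\<^sub>i\<^sub>j (a b)\<close>, it contains all off-diagonal matrices over \<open>A\<close>, at the cost in
  length that the associative products have.  The entries \<open>a\<close> with \<open>e\<^sub>1\<^sub>2 a\<close> in a given ideal of \<open>L\<close>
  form a two-sided ideal of \<open>A\<close>, which is either \<open>A\<close>, in which case the ideal is \<open>L\<close>, or \<open>0\<close>.
  So an ideal \<open>M\<close> that is maximal among those without \<open>e\<^sub>1\<^sub>2\<close> is a maximal ideal, and \<open>e\<^sub>1\<^sub>2 A\<close> embeds into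
  \<open>L / M\<close>.  The quotient is simple, whether or not \<open>L\<close> has a centre, and it inherits the upper bound on the
  growth from the local rules and the lower bound from the operators that read factors (\<open>simple_quotient\<close>).
\<close>

section \<open>Uniformly recurrent words of prescribed complexity\<close>

definition window :: "(int \<Rightarrow> 'a) \<Rightarrow> int \<Rightarrow> nat \<Rightarrow> 'a list" where
  "window w x n = map (\<lambda>j. w (x + int j)) [0..<n]"

definition complexity :: "(int \<Rightarrow> 'a) \<Rightarrow> nat \<Rightarrow> nat" where
  "complexity w n = card (range (\<lambda>x. window w x n))"

definition block_factors :: "'a list set \<Rightarrow> nat \<Rightarrow> 'a list set" where
  "block_factors W n = {u. length u = n \<and> (\<exists>vs a b. set vs \<subseteq> W \<and> concat vs = a @ u @ b)}"

lemma length_concat_const: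
  "(\<And>v. v \<in> set vs \<Longrightarrow> length v = l) \<Longrightarrow> length (concat vs) = length vs * l"
  by (induction vs) auto

lemma drop_concat_const:
  "(\<And>v. v \<in> set vs \<Longrightarrow> length v = l) \<Longrightarrow> drop (q * l) (concat vs) = concat (drop q vs)"
proof (induction vs arbitrary: q)
  case (Cons v vs)
  then show ?case by (cases q) auto
qed auto

text \<open>A factor of length \<open>n\<close> begins inside some block and is covered by \<open>n div l + 2\<close> consecutive blocks.  It
  is determined by these blocks and by its offset in the first of them.  Near the end of a
  concatenation the missing blocks are supplied by copies of an arbitrary block.\<close>

lemma block_factors_card:
  assumes "finite W" "W \<noteq> {}" and len: "\<And>v. v \<in> W \<Longrightarrow> length v = l" and "l > 0"
  shows "finite (block_factors W n)"
    and "card (block_factors W n) \<le> l * card W ^ (n div l + 2)"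
proof -
  define t where "t = n div l + 2"
  define F where "F = {..<l} \<times> {vs. set vs \<subseteq> W \<and> length vs = t}"
  have finF: "finite F"
    unfolding F_def using finite_lists_length_eq[OF \<open>finite W\<close>] by auto
  have cardF: "card F = l * card W ^ t"
    unfolding F_def by (simp add: card_cartesian_product card_lists_length_eq[OF \<open>finite W\<close>])
  obtain v0 where v0: "v0 \<in> W" using \<open>W \<noteq> {}\<close> by blast
  have tl: "t * l \<ge> n + l"
  proof -
    have "n < (n div l + 1) * l"
      using \<open>l > 0\<close> dividend_less_div_times[of l n] by (simp add: algebra_simps)
    then show ?thesis unfolding t_def by (simp add: algebra_simps)
  qed
  have sub: "block_factors W n \<subseteq> (\<lambda>(s, vs). take n (drop s (concat vs))) ` F"
  proof
    fix u assume "u \<in> block_factors W n"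
    then obtain vs a b where u: "length u = n" and vs: "set vs \<subseteq> W" and eq: "concat vs = a @ u @ b"
      unfolding block_factors_def by blast
    define q s where "q = length a div l" and "s = length a mod l"
    define xs where "xs = drop q vs"
    define ys where "ys = take t (xs @ replicate t v0)"
    have la: "length a = q * l + s" unfolding q_def s_def by simp
    have sl: "s < l" unfolding s_def using \<open>l > 0\<close> by simp
    have xsW: "set xs \<subseteq> W" unfolding xs_def using vs set_drop_subset by fast
    have "drop (length a) (concat vs) = drop s (drop (q * l) (concat vs))"
      unfolding la by (simp add: add.commute)
    also have "\<dots> = drop s (concat xs)"
      unfolding xs_def using vs len by (subst drop_concat_const) auto
    finally have ds: "drop s (concat xs) = u @ b" using eq by simp
    have ysW: "set ys \<subseteq> W" unfolding ys_def using xsW v0 set_take_subset by fastforce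
    have lys: "length ys = t" unfolding ys_def by simp
    have lcy: "length (concat ys) = t * l"
      using length_concat_const[of ys l] ysW len lys by auto
    define z where "z = concat (xs @ replicate t v0)"
    have z1: "z = concat xs @ concat (replicate t v0)" unfolding z_def by simp
    have "xs @ replicate t v0 = ys @ drop t (xs @ replicate t v0)"
      unfolding ys_def by (simp only: append_take_drop_id)
    then have z2: "z = concat ys @ concat (drop t (xs @ replicate t v0))"
      unfolding z_def by (metis concat_append)
    have lxs: "s + n \<le> length (concat xs) \<or> n = 0"
    proof -
      have "length (concat xs) - s = n + length b" using arg_cong[OF ds, of length] u by simp
      then show ?thesis by linarith
    qed
    have "take n (drop s z) = u"
    proof (cases "n = 0")
      case False
      then have "s \<le> length (concat xs)" using lxs by simp
      then show ?thesis unfolding z1 using ds u by simp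
    qed (use u in simp)
    moreover have "take n (drop s z) = take n (drop s (concat ys))"
      unfolding z2 using lcy tl sl by simp
    ultimately have "u = take n (drop s (concat ys))" by simp
    then show "u \<in> (\<lambda>(s, vs). take n (drop s (concat vs))) ` F"
      unfolding F_def using sl ysW lys by (intro image_eqI[of _ _ "(s, ys)"]) auto
  qed
  show "finite (block_factors W n)" using sub finF finite_surj by blast
  show "card (block_factors W n) \<le> l * card W ^ (n div l + 2)"
    using surj_card_le[OF finF sub] cardF t_def by simp
qed


lemma concat_blocks:
  assumes "\<And>v. v \<in> W \<Longrightarrow> \<exists>vs. set vs \<subseteq> V \<and> v = concat vs" and "set ws \<subseteq> W"
  shows "\<exists>vs. set vs \<subseteq> V \<and> concat ws = concat vs"
  using assms(2)
proof (induction ws)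
  case Nil
  show ?case by (intro exI[of _ "[]"]) simp
next
  case (Cons w ws)
  then obtain vs where "set vs \<subseteq> V" "concat ws = concat vs" by auto
  moreover obtain us where "set us \<subseteq> V" "w = concat us" using Cons.prems assms(1) by auto
  ultimately show ?case by (intro exI[of _ "us @ vs"]) auto
qed

lemma block_factors_mono:
  assumes "\<And>v. v \<in> W \<Longrightarrow> \<exists>vs. set vs \<subseteq> V \<and> v = concat vs"
  shows "block_factors W n \<subseteq> block_factors V n"
  unfolding block_factors_def using concat_blocks[OF assms] by fastforce

text \<open>The function \<open>f\<close> is the logarithm of the complexity that a word should have.  Since \<open>f n / n\<close> tends
  monotonically to \<open>0\<close>, a fixed entropy per letter is admissible up to some length and inadmissible from
  there on.  The condition at \<open>n0\<close> leaves room for two blocks of length \<open>n0\<close>.\<close>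

locale rate =
  fixes f :: "nat \<Rightarrow> real" and n0 :: nat
  assumes n0: "n0 \<ge> 1"
    and mono: "\<And>m n. n0 \<le> m \<Longrightarrow> m \<le> n \<Longrightarrow> f m \<le> f n"
    and ratio: "\<And>m n. n0 \<le> m \<Longrightarrow> m \<le> n \<Longrightarrow> f n / real n \<le> f m / real m"
    and ratio_0: "(\<lambda>n. f n / real n) \<longlonglongrightarrow> 0"
    and start: "f n0 \<ge> 2 * ln 2"
    and unbounded: "filterlim f at_top sequentially"
begin

text \<open>A stage of the construction: at least two blocks, all of the same length.  The number of blocks uses at
  most half of what \<open>f\<close> permits.\<close>

definition blocks :: "'a list set \<Rightarrow> nat \<Rightarrow> bool" where
  "blocks W l \<longleftrightarrow> finite W \<and> card W \<ge> 2 \<and> l \<ge> n0 \<and> (\<forall>v\<in>W. length v = l) \<and> ln (card W) \<le> f l / 2"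

text \<open>The relation between consecutive stages, with the purpose of its clauses: growing lengths; a lower bound for the
  complexity; every new block is built from old ones, so that factor counts carry over to all later
  stages; it contains all old ones, which yields uniform recurrence; some old block sits inside every
  new block away from both ends, so that nested blocks exhaust the integers; and an upper bound for the
  complexity at all lengths between the two stages.\<close>

definition refines :: "'a list set \<Rightarrow> nat \<Rightarrow> 'a list set \<Rightarrow> nat \<Rightarrow> bool" where
  "refines W l W1 l1 \<longleftrightarrow> l1 \<ge> 2 * l \<and> f l1 / 4 \<le> ln (card W1) \<and>
     (\<forall>v\<in>W1. \<exists>vs. set vs \<subseteq> W \<and> v = concat vs) \<and>
     (\<forall>v\<in>W1. \<forall>u\<in>W. \<exists>a b. v = a @ u @ b) \<and>
     (\<exists>u\<in>W. \<forall>v\<in>W1. \<exists>a b. a \<noteq> [] \<and> b \<noteq> [] \<and> v = a @ u @ b) \<and>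
     (\<forall>n\<in>{l..l1}. card (block_factors W1 n) \<le> 2 * real n * exp (3 / 2 * f n))"

text \<open>For large \<open>m\<close> the first inequality fails, because \<open>f n / n\<close> tends to \<open>0\<close>.  The largest \<open>m\<close> for which
  it holds is almost sharp: it fails for \<open>m + 1\<close>, and \<open>(m + 1) * b \<le> 2 * m * b\<close>.\<close>

lemma maximal_repetition:
  assumes "l \<ge> n0" and "b > 0" and "b \<le> f l / 2"
  obtains m where "m \<ge> 1" "real m * b \<le> f (m * l) / 2" "f (m * l) / 4 \<le> real m * b"
proof -
  have l: "l \<ge> 1" using assms n0 by simp
  define P where "P m \<longleftrightarrow> real m * b \<le> f (m * l) / 2" for m
  have "eventually (\<lambda>n. f n / real n < 2 * b / l) sequentially"
    using ratio_0 assms l by (intro order_tendstoD(2)[OF ratio_0]) auto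
  then obtain M where M: "\<And>n. n \<ge> M \<Longrightarrow> f n / real n < 2 * b / l"
    unfolding eventually_sequentially by blast
  have bound: "m \<le> M" if "P m" for m
  proof (rule ccontr)
    assume "\<not> m \<le> M"
    then have m: "m > M" "m \<ge> 1" by auto
    then have "m * l \<ge> M" using l by (metis less_or_eq_imp_le mult.right_neutral mult_le_mono)
    then have "f (m * l) / real (m * l) < 2 * b / l" using M by blast
    then have "f (m * l) < 2 * b * m" using m l by (simp add: field_simps)
    then show False using that unfolding P_def by (simp add: field_simps)
  qed
  have P1: "P 1" unfolding P_def using assms by simp
  define m where "m = (GREATEST m. P m)"
  have Pm: "P m" unfolding m_def using P1 bound by (rule GreatestI_nat)
  have m1: "m \<ge> 1" unfolding m_def using P1 bound by (rule Greatest_le_nat)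
  have "\<not> P (Suc m)"
  proof
    assume "P (Suc m)"
    then have "Suc m \<le> m" unfolding m_def using bound by (rule Greatest_le_nat)
    then show False by simp
  qed
  then have "f (Suc m * l) / 2 < real (Suc m) * b" unfolding P_def by simp
  moreover have "f (m * l) \<le> f (Suc m * l)"
  proof (rule mono)
    show "n0 \<le> m * l" using assms m1 by (metis le_trans mult.left_neutral mult_le_mono1)
  qed simp
  moreover have "real (Suc m) * b \<le> 2 * (real m * b)"
    using m1 assms(2) by (simp add: algebra_simps)
  ultimately show ?thesis using that[OF m1] Pm unfolding P_def by linarith
qed

lemma card_concat_blocks:
  assumes "finite V" and "\<And>v. v \<in> V \<Longrightarrow> length v = l"
  shows "card (concat ` {vs. set vs \<subseteq> V \<and> length vs = m}) = card V ^ m"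
proof -
  have "inj_on concat {vs. set vs \<subseteq> V \<and> length vs = m}"
  proof (rule inj_onI)
    fix xs ys assume *: "xs \<in> {vs. set vs \<subseteq> V \<and> length vs = m}" "ys \<in> {vs. set vs \<subseteq> V \<and> length vs = m}"
      "concat xs = concat ys"
    have "length x = length y" if xy: "(x, y) \<in> set (zip xs ys)" for x y
    proof -
      have "x \<in> V" "y \<in> V" using set_zip_leftD[OF xy] set_zip_rightD[OF xy] * by auto
      then show ?thesis using assms(2) by simp
    qed
    then have "\<forall>(x, y)\<in>set (zip xs ys). length x = length y" by blast
    then show "xs = ys" using * by (intro concat_injective) auto
  qed
  then show ?thesis
    using card_lists_length_eq[OF assms(1), of m] by (simp add: card_image)
qed

text \<open>Putting the concatenation \<open>c\<close> of all blocks in front of every block keeps the number \<open>N\<close> of blocks and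
  makes them longer by the factor \<open>N + 1\<close>, so the entropy per letter drops.
  Then all products of \<open>m\<close> such blocks are admitted.  This keeps the entropy per letter while the permitted
  one, \<open>f n / n\<close>, decreases; \<open>m\<close> is chosen such that the two meet up to a constant factor.  Factors shorter than a prefixed block
  lie in two prefixed blocks, and there are few of these; for longer factors the entropy per letter of
  the prefixed blocks is at most half of \<open>f n / n\<close>.\<close>

lemma refinement_exists:
  assumes "blocks W l"
  shows "\<exists>W1 l1. blocks W1 l1 \<and> refines W l W1 l1"
proof -
  define N where "N = card W"
  have fin: "finite W" and N2: "N \<ge> 2" and l: "l \<ge> n0" and len: "\<And>v. v \<in> W \<Longrightarrow> length v = l"
    and small: "ln N \<le> f l / 2"
    using assms unfolding blocks_def N_def by auto
  have l1: "l \<ge> 1" using l n0 by simp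
  obtain xs where xs: "set xs = W" "distinct xs" using finite_distinct_list[OF fin] by blast
  have lxs: "length xs = N" using xs distinct_card N_def by fastforce
  define c where "c = concat xs"
  have lc: "length c = N * l" unfolding c_def using length_concat_const[of xs l] xs len lxs by auto
  define V where "V = (\<lambda>v. c @ v) ` W"
  define l' where "l' = (N + 1) * l"
  have V: "finite V" "card V = N" "\<And>v. v \<in> V \<Longrightarrow> length v = l'"
    unfolding V_def N_def l'_def using fin len lc N_def by (auto intro!: card_image inj_onI)
  have Vne: "V \<noteq> {}" using V N2 by auto
  have ll': "3 * l \<le> l'" unfolding l'_def using N2 by simp
  have l'n: "l' \<ge> n0" using ll' l by simp
  have "ln N \<le> f l' / 2" using small mono[of l l'] l ll' by auto
  moreover have lnN: "ln N > 0" using N2 by simp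
  ultimately obtain m where m: "m \<ge> 1" "m * ln N \<le> f (m * l') / 2" "f (m * l') / 4 \<le> m * ln N"
    using maximal_repetition[OF l'n] by blast
  define W1 where "W1 = concat ` {vs. set vs \<subseteq> V \<and> length vs = m}"
  define l1 where "l1 = m * l'"
  have l1l': "l1 \<ge> l'" unfolding l1_def using m(1) by simp
  have cW1: "card W1 = N ^ m" unfolding W1_def using card_concat_blocks[OF V(1)] V by metis
  have lnW1: "ln (card W1) = m * ln N" unfolding cW1 using N2 by (simp add: ln_realpow)
  have fW1: "finite W1" unfolding W1_def using finite_lists_length_eq[OF V(1)] by blast
  have lenW1: "length v = l1" if "v \<in> W1" for v
    using that V(3) unfolding W1_def l1_def by (auto simp: length_concat_const subset_iff)
  have "blocks W1 l1"
    unfolding blocks_def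
  proof (intro conjI ballI)
    show "finite W1" by (fact fW1)
    have "N ^ 1 \<le> N ^ m" using m(1) N2 by (intro power_increasing) auto
    then show "card W1 \<ge> 2" unfolding cW1 using N2 by simp
    show "l1 \<ge> n0" using l1l' l'n by simp
    show "length v = l1" if "v \<in> W1" for v using lenW1 that .
    show "ln (card W1) \<le> f l1 / 2" unfolding lnW1 l1_def using m(2) .
  qed
  moreover have "refines W l W1 l1"
    unfolding refines_def
  proof (intro conjI ballI)
    show "l1 \<ge> 2 * l" using l1l' ll' by simp
    show "f l1 / 4 \<le> ln (card W1)" unfolding lnW1 l1_def using m(3) .
    have Vblocks: "\<exists>vs. set vs \<subseteq> W \<and> v = concat vs" if v: "v \<in> V" for v
    proof -
      obtain z where "z \<in> W" "v = c @ z" using v unfolding V_def by blast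
      then show ?thesis using xs unfolding c_def by (intro exI[of _ "xs @ [z]"]) auto
    qed
    show "\<exists>vs. set vs \<subseteq> W \<and> v = concat vs" if "v \<in> W1" for v
      using that concat_blocks[OF Vblocks, of V] unfolding W1_def by auto
    have shape: "\<exists>z\<in>W. \<exists>r. v = c @ z @ r" if v: "v \<in> W1" for v
    proof -
      obtain vs where vs: "set vs \<subseteq> V" "length vs = m" "v = concat vs" using v unfolding W1_def by blast
      then obtain y ys where "vs = y # ys" using m(1) by (cases vs) auto
      moreover from this obtain x where "x \<in> W" "y = c @ x" using vs unfolding V_def by auto
      ultimately have "v = c @ x @ concat ys" using vs by simp
      then show ?thesis using \<open>x \<in> W\<close> by blast
    qed
    show "\<exists>a b. v = a @ u @ b" if v: "v \<in> W1" and u: "u \<in> W" for v u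
    proof -
      obtain z r where "v = c @ z @ r" using shape[OF v] by blast
      moreover obtain pre post where "xs = pre @ u # post" using u xs by (metis in_set_conv_decomp)
      ultimately have "v = concat pre @ u @ (concat post @ z @ r)" unfolding c_def by simp
      then show ?thesis by blast
    qed
    obtain x0 x1 xs' where xs': "xs = x0 # x1 # xs'"
      using lxs N2 by (cases xs; cases "tl xs") auto
    have ne: "z \<noteq> []" if "z \<in> W" for z using len[OF that] l1 by auto
    have "\<exists>a b. a \<noteq> [] \<and> b \<noteq> [] \<and> v = a @ x1 @ b" if v: "v \<in> W1" for v
    proof -
      obtain z r where z: "z \<in> W" "v = c @ z @ r" using shape[OF v] by blast
      then have "v = x0 @ x1 @ (concat xs' @ z @ r)" unfolding c_def xs' by simp
      moreover have "x0 \<noteq> []" using ne xs xs' by auto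
      ultimately show ?thesis
        using ne[OF z(1)] by (intro exI[of _ x0] exI[of _ "concat xs' @ z @ r"]) simp
    qed
    moreover have "x1 \<in> W" using xs xs' by auto
    ultimately show "\<exists>u\<in>W. \<forall>v\<in>W1. \<exists>a b. a \<noteq> [] \<and> b \<noteq> [] \<and> v = a @ u @ b"
      by blast
    fix n assume n: "n \<in> {l..l1}"
    have "card (block_factors W1 n) \<le> card (block_factors V n)"
    proof (rule card_mono[OF block_factors_card(1)[OF V(1) Vne V(3)]])
      show "l' > 0" using ll' l1 by simp
      show "block_factors W1 n \<subseteq> block_factors V n"
        by (rule block_factors_mono) (auto simp: W1_def)
    qed
    also have "\<dots> \<le> l' * N ^ (n div l' + 2)"
      using block_factors_card(2)[OF V(1) Vne V(3)] ll' l1 V(2) by simp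
    finally have "real (card (block_factors W1 n)) \<le> real (l' * N ^ (n div l' + 2))"
      by (simp only: of_nat_le_iff)
    also have "\<dots> \<le> 2 * real n * exp (3 / 2 * f n)"
    proof (cases "n < l'")
      case True
      have "f l \<le> f n" using mono l n by auto
      then have "3 * ln N \<le> 3 / 2 * f n" using small by simp
      then have *: "exp (3 * ln N) \<le> exp (3 / 2 * f n)" by simp
      have "exp (3 * ln N) = real N ^ 3"
        using N2 exp_of_nat_mult[of 3 "ln (real N)"] by simp
      then have N3: "real N ^ 3 \<le> exp (3 / 2 * f n)" using * by simp
      have "n div l' = 0" using True by simp
      then have "real (l' * N ^ (n div l' + 2)) = real l' * real N ^ 2"
        by (simp add: power2_eq_square)
      also have "\<dots> = (real N + 1) * real l * real N ^ 2" unfolding l'_def by (simp add: algebra_simps)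
      also have "\<dots> \<le> (2 * real N) * real n * real N ^ 2"
        using N2 n by (intro mult_right_mono mult_mono) auto
      also have "\<dots> = 2 * real n * real N ^ 3" by (simp add: power3_eq_cube power2_eq_square)
      also have "\<dots> \<le> 2 * real n * exp (3 / 2 * f n)" using N3 by (intro mult_left_mono) auto
      finally show ?thesis .
    next
      case False
      then have nl': "n \<ge> l'" by simp
      have pos: "real l' > 0" "real n > 0" "real l1 > 0" using ll' l1 nl' l1l' by auto
      have "ln N / l' = m * ln N / l1" unfolding l1_def using m(1) by simp
      also have "\<dots> \<le> (f l1 / 2) / l1" using m(2) unfolding l1_def by (intro divide_right_mono) auto
      also have "\<dots> \<le> (f n / n) / 2" using ratio[of n l1] n l by (simp add: field_simps)
      finally have "ln N / l' * n \<le> f n / 2" using pos by (simp add: field_simps)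
      then have r: "n / l' * ln N \<le> f n / 2" by (simp add: mult.commute)
      have "real (n div l') \<le> n / l'" by (rule of_nat_div_le_of_nat)
      moreover have "1 \<le> n / l'" using nl' pos by simp
      ultimately have "real (n div l' + 2) \<le> 3 * (n / l')" by simp
      then have "real (n div l' + 2) * ln N \<le> 3 * (n / l') * ln N"
        using lnN by (intro mult_right_mono) auto
      also have "\<dots> \<le> 3 / 2 * f n" using r by simp
      finally have bound: "exp (real (n div l' + 2) * ln N) \<le> exp (3 / 2 * f n)" by simp
      have "exp (real (n div l' + 2) * ln N) = real N ^ (n div l' + 2)"
        using N2 exp_of_nat_mult[of "n div l' + 2" "ln (real N)"] by simp
      then have "real N ^ (n div l' + 2) \<le> exp (3 / 2 * f n)" using bound by (simp only:)
      then have "real l' * real N ^ (n div l' + 2) \<le> (2 * real n) * exp (3 / 2 * f n)"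
        using nl' by (intro mult_mono) auto
      then show ?thesis by simp
    qed
    finally show "real (card (block_factors W1 n)) \<le> 2 * real n * exp (3 / 2 * f n)" .
  qed
  ultimately show ?thesis by blast
qed


lemma refinement_sequence:
  obtains W :: "nat \<Rightarrow> bool list set" and l :: "nat \<Rightarrow> nat"
  where "\<And>k. blocks (W k) (l k)" "\<And>k. refines (W k) (l k) (W (Suc k)) (l (Suc k))" "l 0 = n0"
proof -
  define W0 :: "bool list set" where "W0 = {replicate n0 True, replicate n0 False}"
  have "replicate n0 True \<noteq> replicate n0 False" using n0 by (cases n0) auto
  then have b0: "blocks W0 n0"
    unfolding blocks_def W0_def using start by auto
  define P where "P = (\<lambda>k (s :: bool list set \<times> nat). blocks (fst s) (snd s) \<and> (k = (0::nat) \<longrightarrow> snd s = n0))"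
  define Q where "Q = (\<lambda>(k::nat) (s :: bool list set \<times> nat) (t :: bool list set \<times> nat). refines (fst s) (snd s) (fst t) (snd t))"
  have "\<exists>s :: nat \<Rightarrow> bool list set \<times> nat. \<forall>k. P k (s k) \<and> Q k (s k) (s (Suc k))"
  proof (rule dependent_nat_choice)
    show "\<exists>s. P 0 s" unfolding P_def using b0 by (intro exI[of _ "(W0, n0)"]) auto
  next
    fix s :: "bool list set \<times> nat" and k assume "P k s"
    then obtain W1 l1 where "blocks W1 l1" "refines (fst s) (snd s) W1 l1"
      unfolding P_def using refinement_exists by blast
    then show "\<exists>t. P (Suc k) t \<and> Q k s t"
      unfolding P_def Q_def by (intro exI[of _ "(W1, l1)"]) auto
  qed
  then obtain s :: "nat \<Rightarrow> bool list set \<times> nat" where "\<forall>k. P k (s k) \<and> Q k (s k) (s (Suc k))" ..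
  then show ?thesis
    using that[of "\<lambda>k. fst (s k)" "\<lambda>k. snd (s k)"] unfolding P_def Q_def by auto
qed

end

text \<open>The origin of the limit word has position \<open>off k\<close> in \<open>u k\<close>.  As every step adds letters on both sides,
  each integer eventually gets a letter, which later steps do not change.\<close>

lemma nested_limit:
  fixes u a b :: "nat \<Rightarrow> 'a list"
  assumes step: "\<And>k. u (Suc k) = a k @ u k @ b k"
    and ne: "\<And>k. a k \<noteq> []" "\<And>k. b k \<noteq> []" "u 0 \<noteq> []"
  obtains w :: "int \<Rightarrow> 'a" and off :: "nat \<Rightarrow> nat"
  where "\<And>k n x. 0 \<le> x + int (off k) \<Longrightarrow> x + int (off k) + int n \<le> int (length (u k)) \<Longrightarrow>
           window w x n = take n (drop (nat (x + int (off k))) (u k))"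
    and "\<And>k. off k \<ge> k" "\<And>k. length (u k) > off k + k"
proof -
  define off where "off k = (\<Sum>i<k. length (a i))" for k
  have off_Suc: "off (Suc k) = off k + length (a k)" for k unfolding off_def by simp
  have ge: "off k \<ge> k" for k
  proof (induction k)
    case (Suc k)
    have "length (a k) \<ge> 1" using ne(1)[of k] by (cases "a k") auto
    then show ?case using Suc off_Suc by simp
  qed simp
  have len: "length (u k) > off k + k" for k
  proof (induction k)
    case 0
    then show ?case using ne(3) unfolding off_def by simp
  next
    case (Suc k)
    have "length (b k) \<ge> 1" using ne(2)[of k] by (cases "b k") auto
    then show ?case using Suc step off_Suc by simp
  qed
  have stable: "u (k + d) ! (j + off (k + d) - off k) = u k ! j" if "j < length (u k)" for k d j
  proof (induction d)
    case (Suc d)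
    have mono: "off (k + d) \<ge> off k" unfolding off_def by (intro sum_mono2) auto
    have bound: "off (k + d) - off k + length (u k) \<le> length (u (k + d))"
    proof (induction d)
      case (Suc d)
      have "off (k + d) \<ge> off k" unfolding off_def by (intro sum_mono2) auto
      then show ?case using Suc step[of "k + d"] off_Suc[of "k + d"] by simp
    qed simp
    have "j + off (k + d) - off k < length (u (k + d))" using mono bound that by linarith
    moreover have "j + off (k + Suc d) - off k = length (a (k + d)) + (j + off (k + d) - off k)"
      using mono off_Suc[of "k + d"] by simp
    ultimately show ?case using Suc step[of "k + d"] by (simp add: nth_append)
  qed simp
  define w where "w x = u (nat \<bar>x\<bar>) ! nat (x + int (off (nat \<bar>x\<bar>)))" for x
  have w_eq: "w x = u k ! nat (x + int (off k))"
    if "0 \<le> x + int (off k)" "x + int (off k) < int (length (u k))" for x k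
  proof -
    define i where "i = nat \<bar>x\<bar>"
    have i: "0 \<le> x + int (off i)" "x + int (off i) < int (length (u i))"
      using ge[of i] len[of i] unfolding i_def by linarith+
    have shift: "u (k1 + d) ! nat (x + int (off (k1 + d))) = u k1 ! nat (x + int (off k1))"
      if "0 \<le> x + int (off k1)" "x + int (off k1) < int (length (u k1))" for k1 d
    proof -
      have "off (k1 + d) \<ge> off k1" unfolding off_def by (intro sum_mono2) auto
      then have "nat (x + int (off (k1 + d))) = nat (x + int (off k1)) + off (k1 + d) - off k1"
        using that by linarith
      then show ?thesis using stable[of "nat (x + int (off k1))" k1 d] that by simp
    qed
    show ?thesis
      using shift[OF i, of k] shift[OF that, of i] unfolding w_def i_def by (simp add: add.commute)
  qed
  have "window w x n = take n (drop (nat (x + int (off k))) (u k))"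
    if "0 \<le> x + int (off k)" "x + int (off k) + int n \<le> int (length (u k))" for k n x
  proof (rule nth_equalityI)
    show "length (window w x n) = length (take n (drop (nat (x + int (off k))) (u k)))"
      using that unfolding window_def by auto
    fix j assume "j < length (window w x n)"
    then have j: "j < n" unfolding window_def by simp
    have "nat (x + int j + int (off k)) = nat (x + int (off k)) + j" using that by linarith
    moreover have "w (x + int j) = u k ! nat (x + int j + int (off k))"
      using that j by (intro w_eq) auto
    ultimately show "window w x n ! j = take n (drop (nat (x + int (off k))) (u k)) ! j"
      using j that unfolding window_def by simp
  qed
  then show ?thesis using that[of off w] ge len by blast
qed

lemma finite_windows: "finite (range (\<lambda>x. window (w :: int \<Rightarrow> bool) x n))"
  by (rule finite_subset[OF _ finite_lists_length_eq[of UNIV n]]) (auto simp: window_def)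

lemma window_take_drop:
  "j + n \<le> m \<Longrightarrow> take n (drop j (window w x m)) = window w (x + int j) n"
  unfolding window_def by (rule nth_equalityI) (auto simp: algebra_simps)

context rate
begin

text \<open>The word is the limit of a chain of nested blocks, one from each stage.  All its stretches are factors
  of concatenations of blocks of any given stage, which bounds the complexity from above.  All blocks of a
  stage occur in every block of the next one, hence in every long stretch of the word; this gives the
  recurrence of a factor, once it lies in a block of the chain, and the lower bound.\<close>

theorem recurrent_word_exists:
  obtains w :: "int \<Rightarrow> bool"
  where "\<And>i n. \<exists>K. \<forall>x. \<exists>t\<in>{0..int K}. window w (x + t) n = window w i n"
    and "\<And>n. n \<ge> n0 \<Longrightarrow> complexity w n \<le> 2 * real n * exp (3 / 2 * f n)"
    and "\<And>M. \<exists>n\<ge>M. exp (f n / 4) \<le> complexity w n"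
proof -
  obtain W :: "nat \<Rightarrow> bool list set" and l :: "nat \<Rightarrow> nat" where
    B: "\<And>k. blocks (W k) (l k)" and R: "\<And>k. refines (W k) (l k) (W (Suc k)) (l (Suc k))"
    and l0: "l 0 = n0"
    using refinement_sequence by blast
  have len: "length v = l k" if "v \<in> W k" for v k using B[of k] that unfolding blocks_def by blast
  have finW: "finite (W k)" "W k \<noteq> {}" "card (W k) \<ge> 2" for k using B[of k] unfolding blocks_def by auto
  have ldouble: "2 * l k \<le> l (Suc k)" for k using R[of k] unfolding refines_def by blast
  have lpos: "l k \<ge> n0" for k using B[of k] unfolding blocks_def by blast
  have lpos1: "l k \<ge> 1" for k using lpos[of k] n0 by simp
  have lgt: "l k > k" for k
  proof (induction k)
    case 0 then show ?case using lpos1[of 0] by simp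
  next
    case (Suc k) then show ?case using ldouble[of k] lpos1[of k] by simp
  qed
  have "\<exists>u\<in>W k. \<forall>v\<in>W (Suc k). \<exists>a b. a \<noteq> [] \<and> b \<noteq> [] \<and> v = a @ u @ b" for k
    using R[of k] unfolding refines_def by blast
  then obtain u where u: "\<And>k. u k \<in> W k"
    and inner: "\<And>k v. v \<in> W (Suc k) \<Longrightarrow> \<exists>a b. a \<noteq> [] \<and> b \<noteq> [] \<and> v = a @ u k @ b"
    by metis
  have "\<exists>a b. a \<noteq> [] \<and> b \<noteq> [] \<and> u (Suc k) = a @ u k @ b" for k using inner u by blast
  then obtain a b where ab: "\<And>k. a k \<noteq> []" "\<And>k. b k \<noteq> []" "\<And>k. u (Suc k) = a k @ u k @ b k"
    by metis
  have "u 0 \<noteq> []" using len[OF u[of 0]] lpos1[of 0] by auto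
  then obtain w off where
    win: "\<And>k n x. 0 \<le> x + int (off k) \<Longrightarrow> x + int (off k) + int n \<le> int (length (u k)) \<Longrightarrow>
           window w x n = take n (drop (nat (x + int (off k))) (u k))"
    and off: "\<And>k. off k \<ge> k" and lenu: "\<And>k. length (u k) > off k + k"
    using nested_limit[of u a b] ab by metis
  have whole: "window w (- int (off k)) (l k) = u k" for k
    using win[of "- int (off k)" k "l k"] len[OF u[of k]] by simp
  have deep: "window w x n = take n (drop (nat (x + int (off k))) (u k))
      \<and> 0 \<le> x + int (off k) \<and> x + int (off k) + int n \<le> int (length (u k))"
    if "k \<ge> nat \<bar>x\<bar> + n" for x n k
  proof -
    have "0 \<le> x + int (off k)" "x + int (off k) + int n \<le> int (length (u k))"
      using off[of k] lenu[of k] that by linarith+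
    then show ?thesis using win by blast
  qed
  have tower: "\<exists>vs. set vs \<subseteq> W j \<and> v = concat vs" if "v \<in> W (j + d)" for v j d
    using that
  proof (induction d arbitrary: v)
    case 0 then show ?case by (intro exI[of _ "[v]"]) auto
  next
    case (Suc d)
    then obtain vs where "set vs \<subseteq> W (j + d)" "v = concat vs"
      using R[of "j + d"] unfolding refines_def by auto
    then show ?case using concat_blocks[of "W (j + d)" "W j" vs] Suc.IH by auto
  qed
  have decompose: "\<exists>k vs. k \<ge> j \<and> k \<ge> nat \<bar>x\<bar> + n \<and> set vs \<subseteq> W j \<and> u k = concat vs" for j x n
  proof -
    define k where "k = j + (nat \<bar>x\<bar> + n)"
    show ?thesis using tower[of "u k" j "nat \<bar>x\<bar> + n"] u[of k] unfolding k_def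
      by (intro exI[of _ "j + (nat \<bar>x\<bar> + n)"]) auto
  qed
  have fac: "window w x n \<in> block_factors (W j) n" for x n j
  proof -
    obtain k vs where k: "k \<ge> nat \<bar>x\<bar> + n" "set vs \<subseteq> W j" "u k = concat vs"
      using decompose by blast
    define p where "p = nat (x + int (off k))"
    have "window w x n = take n (drop p (u k))" using deep[OF k(1)] p_def by blast
    moreover have "u k = take p (u k) @ take n (drop p (u k)) @ drop n (drop p (u k))"
      by (simp only: append_take_drop_id)
    ultimately have "concat vs = take p (u k) @ window w x n @ drop n (drop p (u k))"
      using k(3) by simp
    then show ?thesis unfolding block_factors_def using k(2) by (auto simp: window_def)
  qed
  \<comment> \<open>A stretch of twice the block length contains a complete block.\<close>
  have occurs: "\<exists>t\<in>{0..int (l j)}. window w (x + t) (l j) \<in> W j" for x j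
  proof -
    obtain k vs where k: "k \<ge> nat \<bar>x\<bar> + 2 * l j" "set vs \<subseteq> W j" "u k = concat vs"
      using decompose by blast
    have vl: "length v = l j" if "v \<in> set vs" for v using k(2) len that by blast
    define p where "p = nat (x + int (off k))"
    have d: "0 \<le> x + int (off k)" "x + int (off k) + int (2 * l j) \<le> int (length (u k))"
      using deep[OF k(1)] by auto
    have lu: "length (u k) = length vs * l j"
      using k len[of _ j] length_concat_const[of vs "l j"] by auto
    \<comment> \<open>the first block that starts after position \<open>p\<close>\<close>
    define q where "q = p div l j + 1"
    have q1: "p < q * l j" "q * l j \<le> p + l j"
      unfolding q_def using lpos1[of j] dividend_less_div_times[of "l j" p] by (auto simp: algebra_simps)
    have pl: "p + 2 * l j \<le> length (u k)" using d unfolding p_def by linarith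
    have "q * l j + l j \<le> length vs * l j" using q1 pl lu by linarith
    then have "(q + 1) * l j \<le> length vs * l j" by simp
    then have qv: "q < length vs" using lpos1[of j] by (metis Suc_eq_plus1 Suc_le_eq less_le_trans mult_le_cancel2 zero_less_one)
    define t where "t = int (q * l j) - int p"
    have px: "int p = x + int (off k)" unfolding p_def using d by simp
    have xt: "x + t + int (off k) = int (q * l j)" unfolding t_def using px by simp
    have "window w (x + t) (l j) = take (l j) (drop (nat (x + t + int (off k))) (u k))"
    proof (rule win)
      show "0 \<le> x + t + int (off k)" unfolding xt by simp
      show "x + t + int (off k) + int (l j) \<le> int (length (u k))"
        unfolding xt using q1 pl by linarith
    qed
    also have "\<dots> = take (l j) (drop (q * l j) (concat vs))" unfolding xt k(3) by (simp only: nat_int)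
    also have "\<dots> = take (l j) (concat (drop q vs))"
      using drop_concat_const[OF vl] by simp
    also have "drop q vs = vs ! q # drop (Suc q) vs" using qv by (simp add: Cons_nth_drop_Suc)
    also have "take (l j) (concat (vs ! q # drop (Suc q) vs)) = vs ! q"
      using vl[OF nth_mem[OF qv]] by simp
    finally have "window w (x + t) (l j) \<in> W j" using k(2) qv nth_mem[of q vs] by auto
    moreover have "t \<in> {0..int (l j)}"
      unfolding t_def atLeastAtMost_iff using q1 by linarith
    ultimately show ?thesis by blast
  qed
  have contains: "\<exists>a b. v = a @ z @ b" if "v \<in> W (Suc k)" "z \<in> W k" for v z k
    using R[of k] that unfolding refines_def by blast
  have "\<exists>K. \<forall>x. \<exists>t\<in>{0..int K}. window w (x + t) n = window w i n" for i n
  proof -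
    define k where "k = nat \<bar>i\<bar> + n"
    have "nat \<bar>i\<bar> + n \<le> k" unfolding k_def by simp
    note dk = deep[OF this]
    have wi: "window w i n = take n (drop (nat (i + int (off k))) (u k))" using dk by (rule conjunct1)
    have d: "nat (i + int (off k)) + n \<le> length (u k)" using conjunct2[OF dk] by linarith
    have "\<exists>t\<in>{0..int (2 * l (Suc k))}. window w (x + t) n = window w i n" for x
    proof -
      define m where "m = l (Suc k)"
      obtain t where t: "t \<in> {0..int m}" "window w (x + t) m \<in> W (Suc k)"
        using occurs m_def by blast
      obtain c e where ce: "window w (x + t) m = c @ u k @ e" using contains[OF t(2) u[of k]] by blast
      define s where "s = length c + nat (i + int (off k))"
      have "length (c @ u k @ e) = m" using arg_cong[OF ce, of length] by (simp add: window_def)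
      then have sm: "s + n \<le> m" unfolding s_def using d by simp
      have "window w (x + t + int s) n = take n (drop s (c @ u k @ e))"
        using window_take_drop[OF sm, of w "x + t"] ce by simp
      also have "\<dots> = window w i n" unfolding wi s_def using d by simp
      finally have "window w (x + (t + int s)) n = window w i n" by (simp add: add.assoc)
      moreover have "t + int s \<in> {0..int (2 * l (Suc k))}" using t(1) sm m_def by auto
      ultimately show ?thesis by blast
    qed
    then show ?thesis by blast
  qed
  moreover have "complexity w n \<le> 2 * real n * exp (3 / 2 * f n)" if n: "n \<ge> n0" for n
  proof -
    define k where "k = (GREATEST k. l k \<le> n)"
    have bound: "j \<le> n" if "l j \<le> n" for j using lgt[of j] that by simp
    have k1: "l k \<le> n" unfolding k_def
      by (rule GreatestI_nat[of "\<lambda>j. l j \<le> n" 0 n]) (use n l0 bound in auto)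
    have k2: "n \<le> l (Suc k)"
    proof (rule ccontr)
      assume "\<not> n \<le> l (Suc k)"
      then have "l (Suc k) \<le> n" by simp
      then have "Suc k \<le> k"
        unfolding k_def by (rule Greatest_le_nat[of "\<lambda>j. l j \<le> n" _ n]) (use bound in auto)
      then show False by simp
    qed
    have "complexity w n \<le> card (block_factors (W (Suc k)) n)"
      unfolding complexity_def
    proof (rule card_mono)
      show "finite (block_factors (W (Suc k)) n)"
        using block_factors_card(1)[OF finW(1,2)[of "Suc k"] len] lpos1[of "Suc k"] by simp
    qed (use fac in auto)
    moreover have "card (block_factors (W (Suc k)) n) \<le> 2 * real n * exp (3 / 2 * f n)"
      using R[of k] k1 k2 unfolding refines_def by auto
    ultimately show ?thesis by linarith
  qed
  moreover have "\<exists>n\<ge>M. exp (f n / 4) \<le> complexity w n" for M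
  proof -
    define k where "k = Suc M"
    have "W k \<subseteq> range (\<lambda>x. window w x (l k))"
    proof
      fix v assume v: "v \<in> W k"
      obtain c e where ce: "u (Suc k) = c @ v @ e" using contains[OF u v] by blast
      have "length (c @ v @ e) = l (Suc k)" using len[OF u[of "Suc k"]] ce by simp
      then have "length c + l k \<le> l (Suc k)" using len[OF v] by simp
      then have "window w (- int (off (Suc k)) + int (length c)) (l k) = take (l k) (drop (length c) (u (Suc k)))"
        using window_take_drop[of "length c" "l k" "l (Suc k)" w "- int (off (Suc k))"] whole[of "Suc k"] by simp
      also have "\<dots> = v" using ce len[OF v] by simp
      finally show "v \<in> range (\<lambda>x. window w x (l k))" by (metis rangeI)
    qed
    then have "card (W k) \<le> complexity w (l k)"
      unfolding complexity_def by (intro card_mono finite_windows)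
    moreover have "exp (f (l k) / 4) \<le> card (W k)"
    proof -
      have "f (l k) / 4 \<le> ln (card (W k))" using R[of M] unfolding refines_def k_def by blast
      then have "exp (f (l k) / 4) \<le> exp (ln (card (W k)))" by simp
      also have "\<dots> = card (W k)" using finW(3)[of k] by simp
      finally show ?thesis .
    qed
    moreover have "l k \<ge> M" using lgt[of k] k_def by simp
    ultimately show ?thesis by (meson of_nat_mono order_trans of_nat_le_iff)
  qed
  ultimately show ?thesis using that by blast
qed

end

section \<open>Dimension bounds and coordinates on quotient spaces\<close>

text \<open>Finitely supported functions serve as the coordinate space: every vector space of countably infinite
  dimension is isomorphic to it, and finite-dimensional ones embed into it.\<close>

definition fscale :: "'f::field \<Rightarrow> (nat \<Rightarrow>\<^sub>0 'f) \<Rightarrow> (nat \<Rightarrow>\<^sub>0 'f)" where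
  "fscale c p = Poly_Mapping.map ((*) c) p"

lemma lookup_fscale [simp]: "Poly_Mapping.lookup (fscale c p) k = c * Poly_Mapping.lookup p k"
  unfolding fscale_def by (simp add: map.rep_eq when_def)

interpretation fs: vector_space fscale
  by unfold_locales (auto intro!: poly_mapping_eqI simp: lookup_add algebra_simps)

context vector_space
begin

lemma biorthogonal:
  assumes lin: "\<And>i. i \<in> I \<Longrightarrow> Vector_Spaces.linear scale (*) (h i)"
    and dual: "\<And>i j. i \<in> I \<Longrightarrow> j \<in> I \<Longrightarrow> h i (g j) = (if i = j then 1 else 0)"
  shows "inj_on g I" and "independent (g ` I)"
proof -
  show inj: "inj_on g I"
  proof (rule inj_onI, rule ccontr)
    fix i j assume "i \<in> I" "j \<in> I" "g i = g j" "i \<noteq> j"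
    then show False using dual[of i i] dual[of i j] by simp
  qed
  show "independent (g ` I)"
  proof
    assume "dependent (g ` I)"
    then obtain i where i: "i \<in> I" "g i \<in> span (g ` I - {g i})" unfolding dependent_def by auto
    interpret h: Vector_Spaces.linear scale "(*)" "h i" using lin[OF i(1)] .
    have "h i (g i) = 0"
    proof (rule h.eq_0_on_span[OF _ i(2)])
      fix x assume "x \<in> g ` I - {g i}"
      then show "h i x = 0" using dual[OF i(1)] by auto
    qed
    then show False using dual[OF i(1) i(1)] by simp
  qed
qed

end

lemma vector_space_scalars: "vector_space ((*) :: 'f::field \<Rightarrow> 'f \<Rightarrow> 'f)"
  by unfold_locales (auto simp: algebra_simps)

lemma linear_lookup: "Vector_Spaces.linear fscale (*) (\<lambda>p. Poly_Mapping.lookup p k)"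
  unfolding Vector_Spaces.linear_iff
  using vector_space_scalars fs.vector_space_axioms by (simp add: lookup_add)

lemma single_inj_independent:
  "inj_on (\<lambda>n. Poly_Mapping.single n (1::'f::field)) K"
  "fs.independent ((\<lambda>n. Poly_Mapping.single n (1::'f::field)) ` K)"
  by (rule fs.biorthogonal[where h = "\<lambda>k p. Poly_Mapping.lookup p k"]; auto intro: linear_lookup simp: lookup_single when_def)+

lemma span_single: "fs.span (range (\<lambda>n. Poly_Mapping.single n (1::'f::field))) = UNIV"
proof -
  have "p \<in> fs.span (range (\<lambda>n. Poly_Mapping.single n (1::'f)))" for p
  proof -
    have "p = (\<Sum>k\<in>Poly_Mapping.keys p. fscale (Poly_Mapping.lookup p k) (Poly_Mapping.single k 1))"
    proof (rule poly_mapping_eqI)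
      fix k
      have "Poly_Mapping.lookup (\<Sum>k\<in>Poly_Mapping.keys p. fscale (Poly_Mapping.lookup p k) (Poly_Mapping.single k 1)) k
         = (\<Sum>i\<in>Poly_Mapping.keys p. if i = k then Poly_Mapping.lookup p k else 0)"
        by (simp add: lookup_sum lookup_single when_def if_distrib cong: if_cong)
      then show "Poly_Mapping.lookup p k = Poly_Mapping.lookup (\<Sum>k\<in>Poly_Mapping.keys p. fscale (Poly_Mapping.lookup p k) (Poly_Mapping.single k 1)) k"
        by (simp add: in_keys_iff)
    qed
    then show ?thesis
      by (metis (no_types, lifting) fs.span_base fs.span_scale fs.span_sum rangeI)
  qed
  then show ?thesis by blast
qed

context vector_space
begin

text \<open>The functionals embed \<open>S\<close> into a coordinate space with one coordinate for each element of \<open>T\<close>.\<close>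

lemma finite_dim_by_functionals:
  assumes S: "subspace S" and fin: "finite T"
    and lin: "\<And>t. t \<in> T \<Longrightarrow> Vector_Spaces.linear scale (*) (h t)"
    and sep: "\<And>x. x \<in> S \<Longrightarrow> (\<And>t. t \<in> T \<Longrightarrow> h t x = 0) \<Longrightarrow> x = 0"
  obtains B where "finite B" "card B \<le> card T" "S \<subseteq> span B"
proof -
  obtain B where B: "B \<subseteq> S" "independent B" "S \<subseteq> span B"
    using maximal_independent_subset by blast
  obtain num :: "_ \<Rightarrow> nat" where num: "inj_on num T"
    using finite_imp_inj_to_nat_seg[OF fin] by blast
  define e where "e = (\<lambda>n::nat. Poly_Mapping.single n (1::'a))"
  define g where "g x = (\<Sum>t\<in>T. fscale (h t x) (e (num t)))" for x
  have lin_g: "Vector_Spaces.linear scale fscale g"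
    unfolding Vector_Spaces.linear_iff
  proof (intro conjI allI)
    fix x y c
    show "g (x + y) = g x + g y"
      using lin unfolding g_def Vector_Spaces.linear_iff
      by (simp add: fs.scale_left_distrib sum.distrib)
    show "g (scale c x) = fscale c (g x)"
      using lin unfolding g_def Vector_Spaces.linear_iff
      by (simp add: fs.scale_sum_right)
  qed (unfold_locales)
  interpret g: Vector_Spaces.linear scale fscale g by (fact lin_g)
  have spS: "span B \<subseteq> S" using B(1) S by (rule span_minimal)
  have ker: "x = 0" if "x \<in> S" "g x = 0" for x
  proof (rule sep[OF that(1)])
    fix t assume t: "t \<in> T"
    have "Poly_Mapping.lookup (g x) (num t) = (\<Sum>s\<in>T. if s = t then h t x else 0)"
      unfolding g_def e_def using num t
      by (auto simp: lookup_sum lookup_single when_def inj_on_def intro!: sum.cong)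
    then show "h t x = 0" using that(2) fin t by simp
  qed
  have inj: "inj_on g (span B)"
    unfolding g.inj_on_iff_eq_0[OF subspace_span] using ker spS by blast
  have indep: "fs.independent (g ` B)" by (rule g.independent_injective_image[OF B(2) inj])
  have sub: "g ` B \<subseteq> fs.span (e ` num ` T)"
    unfolding g_def by (intro image_subsetI fs.span_sum fs.span_scale) (auto intro: fs.span_base)
  have "finite (g ` B) \<and> card (g ` B) \<le> card (e ` num ` T)"
    using fin by (intro fs.independent_span_bound indep sub) auto
  moreover have "card (e ` num ` T) \<le> card T"
    by (metis card_image_le fin finite_imageI image_image)
  moreover have "inj_on g B" using inj span_superset inj_on_subset by blast
  ultimately show ?thesis
    using that[of B] B(3) by (auto simp: card_image dest: finite_imageD)
qed

text \<open>A basis of \<open>I\<close> is extended to a basis of \<open>L\<close>, and the basis vectors outside \<open>I\<close> are numbered; they give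
  coordinates on \<open>L / I\<close>.  There are countably many of them, as each space \<open>G n\<close> contains only finitely many,
  and infinitely many, as arbitrarily large independent sets stay independent modulo \<open>I\<close>.\<close>

lemma quotient_coordinates:
  fixes G :: "nat \<Rightarrow> 'b set"
  assumes I: "subspace I" "I \<subseteq> L" and L: "subspace L"
    and filtration: "L \<subseteq> (\<Union>n. G n)" and fin: "\<And>n. \<exists>W. finite W \<and> G n \<subseteq> span W"
    and big: "\<And>m. \<exists>C. independent C \<and> finite C \<and> card C \<ge> m \<and> span C \<subseteq> L \<and> span C \<inter> I \<subseteq> {0}"
  obtains \<phi> :: "'b \<Rightarrow> (nat \<Rightarrow>\<^sub>0 'a)"
  where "Vector_Spaces.linear scale fscale \<phi>" "\<phi> ` L = UNIV" "\<And>x. x \<in> L \<Longrightarrow> \<phi> x = 0 \<longleftrightarrow> x \<in> I"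
proof -
  interpret p: vector_space_pair scale fscale by unfold_locales
  obtain BI where BI: "BI \<subseteq> I" "independent BI" "I \<subseteq> span BI" using maximal_independent_subset by blast
  obtain B where B: "BI \<subseteq> B" "B \<subseteq> L" "independent B" "L \<subseteq> span B"
    using maximal_independent_subset_extend[of BI L] BI I by blast
  define K where "K = B - BI"
  have "countable B"
  proof -
    have "finite (B \<inter> G n)" for n
    proof -
      obtain W where "finite W" "G n \<subseteq> span W" using fin by blast
      then show ?thesis
        using independent_span_bound[of W "B \<inter> G n"] independent_mono[OF B(3)] by blast
    qed
    then have "countable (\<Union>n. B \<inter> G n)" by (intro countable_UN) (auto intro: countable_finite)
    moreover have "B \<subseteq> (\<Union>n. B \<inter> G n)" using B(2) filtration by blast
    ultimately show ?thesis using countable_subset by blast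
  qed
  then have cK: "countable K" unfolding K_def by (rule countable_subset[rotated]) auto
  define e where "e = (\<lambda>n::nat. Poly_Mapping.single n (1::'a))"
  define \<phi> where "\<phi> = p.construct B (\<lambda>b. if b \<in> BI then 0 else e (to_nat_on K b))"
  have lin: "Vector_Spaces.linear scale fscale \<phi>" unfolding \<phi>_def by (rule p.linear_construct[OF B(3)])
  interpret \<phi>: Vector_Spaces.linear scale fscale \<phi> by (fact lin)
  have val: "\<phi> b = (if b \<in> BI then 0 else e (to_nat_on K b))" if "b \<in> B" for b
    unfolding \<phi>_def by (rule p.construct_basis[OF B(3) that])
  have valK: "\<phi> b = e (to_nat_on K b)" if "b \<in> K" for b using val that unfolding K_def by auto
  have \<phi>K: "\<phi> ` K = e ` to_nat_on K ` K" using valK by (force simp: image_image)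
  have injK: "inj_on \<phi> K"
  proof -
    have "inj_on (e \<circ> to_nat_on K) K"
      unfolding e_def by (intro comp_inj_on inj_on_to_nat_on[OF cK] single_inj_independent(1))
    then show ?thesis using valK by (simp add: inj_on_def)
  qed
  have "fs.independent (\<phi> ` K)" unfolding \<phi>K e_def by (rule single_inj_independent(2))
  then have injsp: "inj_on \<phi> (span K)" using injK by (rule \<phi>.inj_on_span_independent_image)
  have zeroI: "\<phi> x = 0" if "x \<in> span BI" for x
    by (rule \<phi>.eq_0_on_span[OF _ that]) (use val B(1) in auto)
  have spI: "span BI = I" using BI I span_subspace by blast
  have spL: "span B = L" using B L span_subspace by blast
  have BK: "B = BI \<union> K" unfolding K_def using B(1) by blast
  have ker: "\<phi> x = 0 \<longleftrightarrow> x \<in> I" if xL: "x \<in> L" for x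
  proof
    assume "\<phi> x = 0"
    have "x \<in> {y + z |y z. y \<in> span BI \<and> z \<in> span K}"
      using xL spL span_Un[of BI K] unfolding BK by (simp only:)
    then obtain y z where yz: "x = y + z" "y \<in> span BI" "z \<in> span K" by blast
    then have "\<phi> z = 0" using zeroI \<open>\<phi> x = 0\<close> \<phi>.add by simp
    then have "z = 0" using injsp yz(3) \<phi>.inj_on_iff_eq_0[OF subspace_span] by blast
    then show "x \<in> I" using yz spI by simp
  next
    assume "x \<in> I"
    then show "\<phi> x = 0" using zeroI spI by blast
  qed
  have im: "\<phi> ` L = fs.span (\<phi> ` B)" using spL \<phi>.span_image by metis
  have sub: "\<phi> ` B \<subseteq> insert 0 (\<phi> ` K)"
  proof
    fix y assume "y \<in> \<phi> ` B"
    then obtain b where b: "b \<in> B" "y = \<phi> b" by blast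
    show "y \<in> insert 0 (\<phi> ` K)"
    proof (cases "b \<in> BI")
      case True
      then show ?thesis using val b by simp
    next
      case False
      then show ?thesis using b unfolding K_def by blast
    qed
  qed
  have spK: "fs.span (\<phi> ` B) = fs.span (\<phi> ` K)"
  proof
    show "fs.span (\<phi> ` B) \<subseteq> fs.span (\<phi> ` K)" using fs.span_mono[OF sub] by simp
    show "fs.span (\<phi> ` K) \<subseteq> fs.span (\<phi> ` B)" by (intro fs.span_mono) (auto simp: K_def)
  qed
  have "infinite K"
  proof
    assume finK: "finite K"
    obtain C where C: "independent C" "finite C" "card C \<ge> Suc (card K)" "span C \<subseteq> L" "span C \<inter> I \<subseteq> {0}"
      using big by blast
    have "inj_on \<phi> (span C)"
      unfolding \<phi>.inj_on_iff_eq_0[OF subspace_span] using ker C by blast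
    moreover from this have "inj_on \<phi> C" using span_superset inj_on_subset by blast
    ultimately have ind: "fs.independent (\<phi> ` C)" and card: "card (\<phi> ` C) = card C"
      using \<phi>.independent_injective_image[OF C(1)] card_image by auto
    have "\<phi> ` C \<subseteq> fs.span (\<phi> ` K)"
      using im spK C(4) span_superset[of C] by blast
    then have "card (\<phi> ` C) \<le> card (\<phi> ` K)"
      using fs.independent_span_bound[OF _ ind] finK by blast
    also have "\<dots> \<le> card K" using card_image_le[OF finK] .
    finally show False using card C(3) by simp
  qed
  then have "to_nat_on K ` K = UNIV"
    using to_nat_on_infinite[OF cK] bij_betw_imp_surj_on by blast
  then have "\<phi> ` L = UNIV" using im spK \<phi>K span_single unfolding e_def by metis
  then show ?thesis using that lin ker by blast
qed

end

section \<open>Lie products and simple quotients\<close>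

context lie_algebra
begin

lemma bracket_simps:
  "bracket (x + y) z = bracket x z + bracket y z" "bracket z (x + y) = bracket z x + bracket z y"
  "bracket (scale c x) z = scale c (bracket x z)" "bracket z (scale c x) = scale c (bracket z x)"
  using linear_left[of z] linear_right[of z] unfolding Vector_Spaces.linear_iff by auto

lemma bracket_zero: "bracket 0 z = 0" "bracket z 0 = 0"
  using bracket_simps(3)[of 0 0 z] bracket_simps(4)[of z 0 0] by auto

lemma bracket_anti: "bracket x y = - bracket y x"
proof -
  have "bracket (x + y) (x + y) = 0" by (rule alternating)
  then have "bracket x y + bracket y x = 0"
    using alternating[of x] alternating[of y] by (simp add: bracket_simps add.commute)
  then show ?thesis by (simp add: eq_neg_iff_add_eq_0)
qed

lemma subalgebra_hull: "lie_subalgebra (lie_subalgebra hull S)"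
proof (rule hull_in)
  fix T :: "'a set set" assume "\<forall>s\<in>T. lie_subalgebra s"
  then show "lie_subalgebra (\<Inter>T)"
    unfolding lie_subalgebra_def using subspace_Inter by auto
qed

text \<open>The growth function is the dimension of this space.  In contrast to the span of the products of exactly
  \<open>n\<close> factors it increases with \<open>n\<close>.\<close>

definition products_upto :: "'a set \<Rightarrow> nat \<Rightarrow> 'a set" where
  "products_upto V n = span (\<Union>i\<in>{1..n}. lie_power V i)"

lemma growth_products_upto: "growth V n = dim (products_upto V n)"
  unfolding growth_def products_upto_def ..

lemma subspace_products_upto: "subspace (products_upto V n)"
  unfolding products_upto_def by simp

lemma products_upto_mono: "m \<le> n \<Longrightarrow> products_upto V m \<subseteq> products_upto V n"
  unfolding products_upto_def by (intro span_mono UN_mono) auto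

lemma lie_product_pos: "lie_product V n x \<Longrightarrow> n \<ge> 1"
  by (induction rule: lie_product.induct) auto

lemma lie_product_in_products_upto: "lie_product V n x \<Longrightarrow> x \<in> products_upto V n"
proof -
  assume p: "lie_product V n x"
  then have "x \<in> lie_power V n" unfolding lie_power_def by (simp add: span_base)
  then show ?thesis unfolding products_upto_def using lie_product_pos[OF p] by (intro span_base) auto
qed

lemma products_upto_span: "products_upto V n = span {x. \<exists>i\<in>{1..n}. lie_product V i x}"
proof
  show "products_upto V n \<subseteq> span {x. \<exists>i\<in>{1..n}. lie_product V i x}"
    unfolding products_upto_def lie_power_def
    by (intro span_minimal UN_least subspace_span span_mono) auto
  show "span {x. \<exists>i\<in>{1..n}. lie_product V i x} \<subseteq> products_upto V n"
  proof (intro span_minimal subspace_products_upto subsetI)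
    fix x assume "x \<in> {x. \<exists>i\<in>{1..n}. lie_product V i x}"
    then obtain i where "i \<le> n" "lie_product V i x" by auto
    then show "x \<in> products_upto V n"
      using subsetD[OF products_upto_mono lie_product_in_products_upto] by blast
  qed
qed

lemma products_upto_bracket:
  assumes "x \<in> products_upto V m" "y \<in> products_upto V n"
  shows "bracket x y \<in> products_upto V (m + n)"
proof -
  let ?P = "products_upto V (m + n)"
  have *: "bracket a y \<in> ?P" if "i \<in> {1..m}" "lie_product V i a" for i a
    using assms(2) unfolding products_upto_span[of V n]
  proof (induction rule: span_induct)
    show "subspace {y. bracket a y \<in> ?P}"
      by (rule module.subspaceI) (auto simp: bracket_simps bracket_zero module_axioms intro: subspace_add subspace_scale subspace_0 subspace_products_upto)
  next
    fix b assume "b \<in> {x. \<exists>i\<in>{1..n}. lie_product V i x}"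
    then obtain j where "j \<le> n" "lie_product V j b" by auto
    then have "bracket a b \<in> products_upto V (i + j)"
      using lie_product.product that(2) lie_product_in_products_upto by blast
    moreover have "i + j \<le> m + n" using that(1) \<open>j \<le> n\<close> by simp
    ultimately show "bracket a b \<in> ?P" using products_upto_mono by blast
  qed
  show ?thesis
    using assms(1) unfolding products_upto_span[of V m]
  proof (induction rule: span_induct)
    show "subspace {x. bracket x y \<in> ?P}"
      by (rule module.subspaceI) (auto simp: bracket_simps bracket_zero module_axioms intro: subspace_add subspace_scale subspace_0 subspace_products_upto)
  qed (use * in blast)
qed

lemma products_upto_exhaust:
  assumes "subspace V" "generates V"
  obtains n where "x \<in> products_upto V n" "n \<ge> 1"
proof -
  let ?U = "\<Union>n. products_upto V n"
  have "lie_subalgebra ?U"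
    unfolding lie_subalgebra_def
  proof
    show "subspace ?U"
    proof (rule subspaceI)
      show "0 \<in> ?U" using subspace_0[OF subspace_products_upto] by blast
      fix x y c assume "x \<in> ?U"
      then obtain m where m: "x \<in> products_upto V m" by blast
      then show "scale c x \<in> ?U" using subspace_scale[OF subspace_products_upto] by blast
      assume "y \<in> ?U"
      then obtain n where "y \<in> products_upto V n" by blast
      then have "x \<in> products_upto V (max m n)" "y \<in> products_upto V (max m n)"
        using subsetD[OF products_upto_mono[of m "max m n" V] m]
          subsetD[OF products_upto_mono[of n "max m n" V]] by auto
      then show "x + y \<in> ?U" using subspace_add[OF subspace_products_upto] by blast
    qed
    show "\<forall>x\<in>?U. \<forall>y\<in>?U. bracket x y \<in> ?U" by (auto dest: products_upto_bracket)
  qed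
  moreover have "V \<subseteq> ?U"
  proof
    fix v assume "v \<in> V"
    then have "v \<in> products_upto V 1" by (intro lie_product_in_products_upto lie_product.generator)
    then show "v \<in> ?U" by blast
  qed
  ultimately have "lie_subalgebra hull V \<subseteq> ?U" by (rule hull_minimal[rotated])
  then obtain n where "x \<in> products_upto V n" using assms(2) unfolding generates_def by blast
  then have "x \<in> products_upto V (Suc n)" using products_upto_mono[of n "Suc n" V] by auto
  then show ?thesis using that by auto
qed

text \<open>This is how growth functions for different generating spaces are compared.  Each of the finitely many
  elements of \<open>X\<close> needs finitely many factors from \<open>V\<close>; with \<open>c\<close> as a common bound, a product of \<open>n\<close>
  elements of \<open>X\<close> needs at most \<open>c * n\<close>.\<close>

lemma products_upto_rescale:
  assumes V: "subspace V" "generates V" and X: "finite X"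
  obtains c where "c \<ge> 1" "\<And>n x. lie_product X n x \<Longrightarrow> x \<in> products_upto V (c * n)"
proof -
  have "\<exists>m. m \<ge> 1 \<and> x \<in> products_upto V m" for x
    by (rule products_upto_exhaust[OF V, of x]) blast
  then obtain m where m: "\<And>x. m x \<ge> 1" "\<And>x. x \<in> products_upto V (m x)" by metis
  define c where "c = Suc (\<Sum>x\<in>X. m x)"
  have "x \<in> products_upto V (c * n)" if "lie_product X n x" for n x
    using that
  proof induction
    case (generator v)
    then have "m v \<le> c" unfolding c_def using member_le_sum[of v X m] X by simp
    then show ?case using subsetD[OF products_upto_mono m(2)] by simp
  next
    case (product i x j y)
    then show ?case using products_upto_bracket[of x V "c * i" y "c * j"] by (simp add: algebra_simps)
  qed
  then show ?thesis using that[of c] c_def by simp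
qed

text \<open>The bracket of two vectors of the quotient is computed on arbitrary preimages in \<open>L\<close>, which is
  independent of their choice because \<open>I\<close> is an ideal.  Ideals of the quotient pull back to ideals
  between \<open>I\<close> and \<open>L\<close>.\<close>

lemma quotient_lie_algebra:
  fixes s2 :: "'f \<Rightarrow> 'c::ab_group_add \<Rightarrow> 'c"
  assumes L: "lie_subalgebra L"
    and ideal: "subspace I" "I \<subseteq> L" "\<And>x y. x \<in> L \<Longrightarrow> y \<in> I \<Longrightarrow> bracket x y \<in> I"
    and maximal: "\<And>J. subspace J \<Longrightarrow> I \<subseteq> J \<Longrightarrow> J \<subseteq> L \<Longrightarrow>
          (\<And>x y. x \<in> L \<Longrightarrow> y \<in> J \<Longrightarrow> bracket x y \<in> J) \<Longrightarrow> J = I \<or> J = L"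
    and nonabelian: "\<exists>x\<in>L. \<exists>y\<in>L. bracket x y \<notin> I"
    and lin: "Vector_Spaces.linear scale s2 \<phi>" and surj: "\<phi> ` L = UNIV"
    and ker: "\<And>x. x \<in> L \<Longrightarrow> \<phi> x = 0 \<longleftrightarrow> x \<in> I"
  obtains br where "simple_lie_algebra s2 br"
    "\<And>x y. x \<in> L \<Longrightarrow> y \<in> L \<Longrightarrow> \<phi> (bracket x y) = br (\<phi> x) (\<phi> y)"
proof -
  interpret \<phi>: Vector_Spaces.linear scale s2 \<phi> by (fact lin)
  have subL: "subspace L" and clL: "\<And>x y. x \<in> L \<Longrightarrow> y \<in> L \<Longrightarrow> bracket x y \<in> L"
    using L unfolding lie_subalgebra_def by auto
  have ex: "\<exists>x\<in>L. y = \<phi> x" for y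
  proof -
    have "y \<in> \<phi> ` L" unfolding surj by (rule UNIV_I)
    then show ?thesis by blast
  qed
  then have "\<exists>\<psi>. \<forall>y. \<psi> y \<in> L \<and> y = \<phi> (\<psi> y)" by (intro choice) blast
  then obtain \<psi> where \<psi>: "\<And>y. \<psi> y \<in> L" "\<And>y. \<phi> (\<psi> y) = y" by metis
  define br where "br x y = \<phi> (bracket (\<psi> x) (\<psi> y))" for x y
  have wd: "\<phi> (bracket x y) = br (\<phi> x) (\<phi> y)" if "x \<in> L" "y \<in> L" for x y
  proof -
    define x' y' where "x' = \<psi> (\<phi> x)" and "y' = \<psi> (\<phi> y)"
    have L': "x' \<in> L" "y' \<in> L" unfolding x'_def y'_def using \<psi> by auto
    have "\<phi> (x - x') = 0" "\<phi> (y - y') = 0" unfolding x'_def y'_def \<phi>.diff using \<psi>(2) by auto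
    then have d: "x - x' \<in> I" "y - y' \<in> I"
      using ker subspace_diff[OF subL] that L' by blast+
    have "bracket x y = bracket x (y - y') - bracket y' (x - x') + bracket x' y'"
      using bracket_simps(2)[of x "y - y'" y'] bracket_simps(2)[of y' "x - x'" x']
        bracket_anti[of x y'] bracket_anti[of x' y'] by simp
    moreover have "bracket x (y - y') - bracket y' (x - x') \<in> I"
      using ideal(3) d that L' subspace_diff[OF ideal(1)] by blast
    ultimately have "\<phi> (bracket x y) = \<phi> (bracket x' y')"
      using ker ideal(2) by (metis \<phi>.add add.left_neutral subsetD)
    then show ?thesis unfolding br_def x'_def y'_def .
  qed
  have linR: "Vector_Spaces.linear s2 s2 (\<lambda>x. br y x)"
    and linL: "Vector_Spaces.linear s2 s2 (\<lambda>x. br x y)" and alt: "br y y = 0" for y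
  proof -
    obtain b where b: "b \<in> L" "y = \<phi> b" using ex[of y] by blast
    have "br y (x + z) = br y x + br y z \<and> br y (s2 c x) = s2 c (br y x) \<and>
        br (x + z) y = br x y + br z y \<and> br (s2 c x) y = s2 c (br x y)" for x z c
    proof -
      obtain a where a: "a \<in> L" "x = \<phi> a" using ex[of x] by blast
      obtain d where d: "d \<in> L" "z = \<phi> d" using ex[of z] by blast
      have *: "a + d \<in> L" "scale c a \<in> L" using a d subL subspace_add subspace_scale by auto
      show ?thesis
        using wd[OF b(1) *(1)] wd[OF b(1) *(2)] wd[OF b(1) a(1)] wd[OF b(1) d(1)]
          wd[OF *(1) b(1)] wd[OF *(2) b(1)] wd[OF a(1) b(1)] wd[OF d(1) b(1)] a d b
        by (simp add: bracket_simps \<phi>.add \<phi>.scale)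
    qed
    then show "Vector_Spaces.linear s2 s2 (\<lambda>x. br y x)" "Vector_Spaces.linear s2 s2 (\<lambda>x. br x y)"
      unfolding Vector_Spaces.linear_iff using \<phi>.vs2.vector_space_axioms by blast+
    show "br y y = 0" using wd[OF b(1) b(1)] b alternating by simp
  qed
  have jac: "br x (br y z) + br y (br z x) + br z (br x y) = 0" for x y z
  proof -
    obtain a where a: "a \<in> L" "x = \<phi> a" using ex[of x] by blast
    obtain b where b: "b \<in> L" "y = \<phi> b" using ex[of y] by blast
    obtain d where d: "d \<in> L" "z = \<phi> d" using ex[of z] by blast
    have "br x (br y z) + br y (br z x) + br z (br x y)
      = \<phi> (bracket a (bracket b d) + bracket b (bracket d a) + bracket d (bracket a b))"
      unfolding a(2) b(2) d(2) \<phi>.add using a(1) b(1) d(1) clL by (simp flip: wd)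
    then show ?thesis using jacobi by simp
  qed
  have la: "lie_algebra s2 br"
    by (intro lie_algebra.intro lie_algebra_axioms.intro linR linL alt jac) unfold_locales
  interpret q: lie_algebra s2 br by (fact la)
  have "simple_lie_algebra s2 br"
  proof
    obtain x y where "x \<in> L" "y \<in> L" "bracket x y \<notin> I" using nonabelian by blast
    then have "br (\<phi> x) (\<phi> y) \<noteq> 0" using wd[of x y] ker[OF clL[of x y]] by simp
    then show "\<exists>x y. br x y \<noteq> 0" by blast
    fix M assume M: "q.lie_ideal M"
    then have sM: "\<phi>.vs2.subspace M" and cM: "\<And>x y. y \<in> M \<Longrightarrow> br x y \<in> M"
      unfolding q.lie_ideal_def by auto
    define J where "J = L \<inter> {x. \<phi> x \<in> M}"
    have "subspace J"
      unfolding J_def by (rule subspace_inter[OF subL \<phi>.subspace_linear_preimage[OF sM]])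
    moreover have "I \<subseteq> J"
    proof
      fix x assume "x \<in> I"
      then have "x \<in> L" "\<phi> x = 0" using ker ideal(2) by auto
      then show "x \<in> J" unfolding J_def using \<phi>.vs2.subspace_0[OF sM] by simp
    qed
    moreover have "J \<subseteq> L" unfolding J_def by blast
    moreover have "bracket x y \<in> J" if "x \<in> L" "y \<in> J" for x y
      using that clL wd cM unfolding J_def by auto
    ultimately consider "J = I" | "J = L" using maximal by blast
    then show "M = {0} \<or> M = UNIV"
    proof cases
      case 1
      have "y = 0" if "y \<in> M" for y
      proof -
        obtain x where "x \<in> L" "y = \<phi> x" using ex by blast
        then show ?thesis using that 1 ker unfolding J_def by blast
      qed
      then show ?thesis using \<phi>.vs2.subspace_0[OF sM] by blast
    next
      case 2
      have "y \<in> M" for y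
      proof -
        obtain x where "x \<in> L" "y = \<phi> x" using ex by blast
        then show ?thesis using 2 unfolding J_def by blast
      qed
      then show ?thesis by blast
    qed
  qed
  then show ?thesis using that wd by blast
qed

lemma lie_product_image:
  assumes L: "lie_subalgebra L" and "X \<subseteq> L"
    and hom: "\<And>x y. x \<in> L \<Longrightarrow> y \<in> L \<Longrightarrow> \<phi> (bracket x y) = br (\<phi> x) (\<phi> y)"
    and la: "lie_algebra s2 br"
  shows "lie_product X n x \<Longrightarrow> x \<in> L \<and> lie_algebra.lie_product br (\<phi> ` X) n (\<phi> x)"
proof (induction rule: lie_product.induct)
  case (generator v)
  then show ?case using assms(2) lie_algebra.lie_product.generator[OF la, of "\<phi> v" "\<phi> ` X"] by auto
next
  case (product i x j y)
  then have xy: "x \<in> L" "y \<in> L" by auto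
  have "lie_algebra.lie_product br (\<phi> ` X) (i + j) (br (\<phi> x) (\<phi> y))"
    using product by (intro lie_algebra.lie_product.product[OF la]) auto
  then show ?case using L xy hom[OF xy] unfolding lie_subalgebra_def by auto
qed

end

section \<open>The Lie algebra generated by off-diagonal matrices\<close>

lemma (in vector_space) card_le_dim_finite_span:
  assumes "independent C" "C \<subseteq> T" "T \<subseteq> span W" "finite W"
  shows "card C \<le> dim T"
proof -
  obtain B where B: "B \<subseteq> T" "independent B" "T \<subseteq> span B" "card B = dim T" using basis_exists by blast
  have "finite B" using independent_span_bound[OF assms(4) B(2)] B(1) assms(3) by blast
  then show ?thesis using independent_span_bound[of B C] assms B by auto
qed

definition commutator :: "'r::ring_1 \<Rightarrow> 'r \<Rightarrow> 'r" where
  "commutator x y = x * y - y * x"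

locale assoc_algebra = vector_space scale
  for scale :: "'f::field \<Rightarrow> 'r::ring_1 \<Rightarrow> 'r" +
  assumes mult_scale_left: "scale c x * y = scale c (x * y)"
    and mult_scale_right: "x * scale c y = scale c (x * y)"
begin

lemma lie_algebra_commutator: "lie_algebra scale commutator"
proof (intro lie_algebra.intro lie_algebra_axioms.intro vector_space_axioms)
  fix x y z :: 'r
  show "Vector_Spaces.linear scale scale (\<lambda>y. commutator x y)"
    "Vector_Spaces.linear scale scale (\<lambda>x. commutator x y)"
    unfolding Vector_Spaces.linear_iff commutator_def
    by (auto simp: algebra_simps mult_scale_left mult_scale_right vector_space_axioms)
  show "commutator x x = 0" unfolding commutator_def by simp
  show "commutator x (commutator y z) + commutator y (commutator z x) + commutator z (commutator x y) = 0"
    unfolding commutator_def by (simp add: algebra_simps)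
qed

sublocale lie: lie_algebra scale commutator by (rule lie_algebra_commutator)

inductive_set generated :: "'r set \<Rightarrow> 'r set" for S where
  gen: "s \<in> S \<Longrightarrow> s \<in> generated S"
| add: "a \<in> generated S \<Longrightarrow> b \<in> generated S \<Longrightarrow> a + b \<in> generated S"
| scale: "a \<in> generated S \<Longrightarrow> scale c a \<in> generated S"
| mult: "a \<in> generated S \<Longrightarrow> b \<in> generated S \<Longrightarrow> a * b \<in> generated S"

end

text \<open>The row and column indices of matrices of size three.\<close>

datatype corner = C1 | C2 | C3

lemma corner_UNIV: "(UNIV :: corner set) = {C1, C2, C3}" "finite (UNIV :: corner set)" "card (UNIV :: corner set) = 3"
proof -
  show *: "(UNIV :: corner set) = {C1, C2, C3}" using corner.exhaust by auto
  show "finite (UNIV :: corner set)" "card (UNIV :: corner set) = 3" unfolding * by auto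
qed

lemma third_corner: "\<exists>k :: corner. k \<noteq> i \<and> k \<noteq> j"
  by (cases i; cases j) auto

text \<open>With matrix units \<open>e i j\<close> that commute with the subalgebra generated by \<open>S\<close>, the element \<open>e i j * a\<close> is
  the matrix whose only entry is \<open>a\<close> at position \<open>(i, j)\<close>.  The last assumption says that the subalgebra
  generated by \<open>S\<close> is simple.\<close>

locale matrix_algebra = assoc_algebra scale
  for scale :: "'f::field \<Rightarrow> 'r::ring_1 \<Rightarrow> 'r" +
  fixes e :: "corner \<Rightarrow> corner \<Rightarrow> 'r" and S :: "'r set"
  assumes e_mult: "e i j * e k l = (if j = k then e i l else 0)"
    and e_comm: "s \<in> S \<Longrightarrow> e i j * s = s * e i j"
    and one_S: "1 \<in> S" and finite_S: "finite S"
    and e_nonzero: "e C1 C2 \<noteq> 0"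
    and simple: "J \<subseteq> generated S \<Longrightarrow> subspace J \<Longrightarrow>
       (\<And>x y. x \<in> J \<Longrightarrow> y \<in> generated S \<Longrightarrow> x * y \<in> J \<and> y * x \<in> J) \<Longrightarrow> a \<in> J \<Longrightarrow> a \<noteq> 0 \<Longrightarrow> 1 \<in> J"
begin

abbreviation "A \<equiv> generated S"

definition "gens = {e i j * s | i j s. i \<noteq> j \<and> s \<in> S}"

definition "L = lie.lie_subalgebra hull gens"

lemma one_A: "1 \<in> A" using one_S gen by blast

lemma prod_list_A: "set ss \<subseteq> S \<Longrightarrow> prod_list ss \<in> A"
proof (induction ss)
  case Nil then show ?case using one_A by simp
next
  case (Cons t ts) then show ?case using gen generated.mult by auto
qed

lemma subspace_A: "subspace A"
  using generated.scale[OF one_A, of 0] by (intro subspaceI generated.add generated.scale) auto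

lemma comm_A: "a \<in> A \<Longrightarrow> e i j * a = a * e i j"
proof (induction rule: generated.induct)
  case (mult a b)
  then show ?case by (metis mult.assoc)
qed (auto simp: e_comm algebra_simps mult_scale_left mult_scale_right)

lemma e_prod: "a \<in> A \<Longrightarrow> (e i j * a) * (e k l * b) = (if j = k then e i l * (a * b) else 0)"
proof -
  assume a: "a \<in> A"
  have "(e i j * a) * (e k l * b) = e i j * (a * e k l) * b" by (simp add: mult.assoc)
  also have "\<dots> = (e i j * e k l) * (a * b)" using comm_A[OF a] by (metis mult.assoc)
  finally show ?thesis by (simp add: e_mult)
qed

lemma commutator_e:
  assumes "a \<in> A" "b \<in> A"
  shows "commutator (e i j * a) (e k l * b) =
    (if j = k then e i l * (a * b) else 0) - (if l = i then e k j * (b * a) else 0)"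
  unfolding commutator_def by (simp add: e_prod assms)

lemma finite_gens: "finite gens"
proof -
  have "gens \<subseteq> (\<lambda>(i, j, s). e i j * s) ` (UNIV \<times> UNIV \<times> S)" unfolding gens_def by force
  then show ?thesis using corner_UNIV(2) finite_S by (meson finite_SigmaI finite_imageI finite_subset)
qed

lemma L_subalgebra: "lie.lie_subalgebra L" unfolding L_def by (rule lie.subalgebra_hull)

lemma subspace_L: "subspace L" and L_closed: "x \<in> L \<Longrightarrow> y \<in> L \<Longrightarrow> commutator x y \<in> L"
  using L_subalgebra unfolding lie.lie_subalgebra_def by auto

lemma gens_L: "gens \<subseteq> L" unfolding L_def by (rule hull_subset)

text \<open>A product of two entries is obtained from a commutator through a third index.\<close>

lemma e_in_L: "a \<in> A \<Longrightarrow> i \<noteq> j \<Longrightarrow> e i j * a \<in> L"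
proof (induction arbitrary: i j rule: generated.induct)
  case (gen s)
  then have "e i j * s \<in> gens" unfolding gens_def by blast
  then show ?case using gens_L by blast
next
  case (add a b)
  then show ?case using subspace_add[OF subspace_L] by (simp add: distrib_left)
next
  case (scale a c)
  then show ?case using subspace_scale[OF subspace_L] by (simp add: mult_scale_right)
next
  case (mult a b)
  obtain k where k: "k \<noteq> i" "k \<noteq> j" using third_corner by blast
  have "commutator (e i k * a) (e k j * b) \<in> L" using mult k by (intro L_closed) auto
  then show ?case using commutator_e[OF mult(1,2)] mult(5) by simp
qed

lemma L_induct:
  assumes "subspace P" "gens \<subseteq> P" "\<And>x y. x \<in> P \<Longrightarrow> y \<in> P \<Longrightarrow> commutator x y \<in> P"
  shows "L \<subseteq> P"
  unfolding L_def by (rule hull_minimal) (use assms in \<open>auto simp: lie.lie_subalgebra_def\<close>)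

text \<open>A commutator through a third index lengthens the entry by one factor, so a product of \<open>n\<close> generators
  in \<open>A\<close> costs no more than \<open>n\<close> factors in the Lie algebra.\<close>

lemma product_of_generators:
  "ss \<noteq> [] \<Longrightarrow> set ss \<subseteq> S \<Longrightarrow> i \<noteq> j \<Longrightarrow> lie.lie_product gens (length ss) (e i j * prod_list ss)"
proof (induction ss arbitrary: i j)
  case (Cons s ss)
  have s: "s \<in> S" using Cons by simp
  show ?case
  proof (cases "ss = []")
    case True
    have "e i j * s \<in> gens" unfolding gens_def using s Cons by blast
    then show ?thesis using True lie.lie_product.generator by fastforce
  next
    case False
    obtain k where k: "k \<noteq> i" "k \<noteq> j" using third_corner by blast
    have "e i k * s \<in> gens" unfolding gens_def using s k by blast
    then have "lie.lie_product gens (1 + length ss) (commutator (e i k * s) (e k j * prod_list ss))"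
      using Cons False k by (intro lie.lie_product.product lie.lie_product.generator) auto
    moreover have "prod_list ss \<in> A" using Cons(3) by (intro prod_list_A) auto
    ultimately show ?thesis using commutator_e[OF gen[OF s]] Cons(4) by simp
  qed
qed simp

definition "ideal I \<longleftrightarrow> subspace I \<and> I \<subseteq> L \<and> (\<forall>x\<in>L. \<forall>y\<in>I. commutator x y \<in> I)"

text \<open>Commutators with elements of \<open>L\<close> move an entry of an ideal to another position in its row or in its
  column, and multiply it by an arbitrary element of \<open>A\<close> from the right or from the left.\<close>

lemma ideal_step:
  assumes I: "ideal I" and m: "e i j * a \<in> I" and a: "a \<in> A" and b: "b \<in> A"
    and k: "k \<noteq> i" "k \<noteq> j" and ij: "i \<noteq> j"
  shows "e i k * (a * b) \<in> I" "e k j * (b * a) \<in> I"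
proof -
  have cl: "commutator x (e i j * a) \<in> I" if "x \<in> L" for x
    using I m that unfolding ideal_def by blast
  have "commutator (e j k * b) (e i j * a) \<in> I" using k b by (intro cl e_in_L) auto
  then have "- (e i k * (a * b)) \<in> I" using commutator_e[OF b a] k by simp
  then show "e i k * (a * b) \<in> I"
    using I subspace_neg[of I] unfolding ideal_def by fastforce
  have "commutator (e k i * b) (e i j * a) \<in> I" using k b by (intro cl e_in_L) auto
  then show "e k j * (b * a) \<in> I" using commutator_e[OF b a] k by simp
qed

text \<open>The elements \<open>x\<close> of \<open>A\<close> with \<open>e C1 C2 * x\<close> in \<open>I\<close> form a two-sided ideal of \<open>A\<close>: an entry is moved
  away from its position, and back, with a multiplication on the way.\<close>

lemma ideal_proper_trivial:
  assumes I: "ideal I" and proper: "e C1 C2 \<notin> I" and a: "a \<in> A" "e C1 C2 * a \<in> I"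
  shows "a = 0"
proof (rule ccontr)
  assume "a \<noteq> 0"
  define J where "J = {x \<in> A. e C1 C2 * x \<in> I}"
  have sI: "subspace I" using I unfolding ideal_def by blast
  have "1 \<in> J"
  proof (rule simple[of J a])
    show "J \<subseteq> A" "a \<in> J" unfolding J_def using a by auto
    have "0 \<in> A" using generated.scale[OF one_A, of 0] by simp
    then show "subspace J"
      unfolding J_def using sI
      by (intro subspaceI)
         (auto simp: distrib_left mult_scale_right subspace_0 intro: generated.add generated.scale subspace_add subspace_scale)
    fix x y assume "x \<in> J" and y: "y \<in> A"
    then have x: "x \<in> A" "e C1 C2 * x \<in> I" unfolding J_def by auto
    have xy: "x * y \<in> A" "y * x \<in> A" using x(1) y generated.mult by auto
    have "e C1 C3 * (x * y) \<in> I" using ideal_step(1)[OF I x(2,1) y, of C3] by simp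
    then have 1: "e C1 C2 * (x * y) \<in> I" using ideal_step(1)[OF I _ xy(1) one_A, of C1 C3 C2] by simp
    have "e C3 C2 * (y * x) \<in> I" using ideal_step(2)[OF I x(2,1) y, of C3] by simp
    then have "e C1 C2 * (y * x) \<in> I" using ideal_step(2)[OF I _ xy(2) one_A, of C3 C2 C1] by simp
    then show "x * y \<in> J \<and> y * x \<in> J" unfolding J_def using 1 xy by blast
  qed (rule \<open>a \<noteq> 0\<close>)
  then show False using proper unfolding J_def by simp
qed

text \<open>Starting from \<open>e C1 C2\<close>, all six off-diagonal positions are reached, with arbitrary entries.\<close>

lemma ideal_everything:
  assumes I: "ideal I" and m: "e C1 C2 \<in> I"
  shows "I = L"
proof
  show "I \<subseteq> L" using I unfolding ideal_def by blast
  have e12: "e C1 C2 * 1 \<in> I" using m by simp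
  have step: "(\<forall>a\<in>A. e i k * a \<in> I) \<and> (\<forall>a\<in>A. e k j * a \<in> I)"
    if "\<forall>a\<in>A. e i j * a \<in> I" "k \<noteq> i" "k \<noteq> j" "i \<noteq> j" for i j k
    using ideal_step[OF I _ _ one_A that(2-4)] that(1) by simp
  have 13: "\<forall>a\<in>A. e C1 C3 * a \<in> I" using ideal_step(1)[OF I e12 one_A, of _ C3] by simp
  have 12: "\<forall>a\<in>A. e C1 C2 * a \<in> I" and 23: "\<forall>a\<in>A. e C2 C3 * a \<in> I"
    using step[OF 13, of C2] by auto
  have 32: "\<forall>a\<in>A. e C3 C2 * a \<in> I" using step[OF 12, of C3] by auto
  have 31: "\<forall>a\<in>A. e C3 C1 * a \<in> I" using step[OF 32, of C1] by auto
  have 21: "\<forall>a\<in>A. e C2 C1 * a \<in> I" using step[OF 31, of C2] by auto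
  have all: "e i j * a \<in> I" if "a \<in> A" "i \<noteq> j" for a i j
    using that 12 13 21 23 31 32 by (cases i; cases j) auto
  show "L \<subseteq> I"
  proof (rule L_induct)
    show "subspace I" using I unfolding ideal_def by blast
    show "gens \<subseteq> I" unfolding gens_def using all gen by blast
    show "commutator x y \<in> I" if "x \<in> I" "y \<in> I" for x y using that I unfolding ideal_def by blast
  qed
qed

text \<open>An ideal is proper if and only if it does not contain \<open>e C1 C2\<close>, a property that unions of chains
  preserve.\<close>

lemma maximal_ideal:
  obtains M where "ideal M" "e C1 C2 \<notin> M" "\<And>J. ideal J \<Longrightarrow> M \<subseteq> J \<Longrightarrow> J = M \<or> J = L"
proof -
  define \<A> where "\<A> = {I. ideal I \<and> e C1 C2 \<notin> I}"
  have "{0} \<in> \<A>"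
    unfolding \<A>_def ideal_def using e_nonzero subspace_0[OF subspace_L]
    by (auto simp: commutator_def)
  then have ne: "\<A> \<noteq> {}" by blast
  have "\<exists>M\<in>\<A>. \<forall>X\<in>\<A>. M \<subseteq> X \<longrightarrow> X = M"
  proof (rule subset_Zorn_nonempty[OF ne])
    fix \<C> assume ne: "\<C> \<noteq> {}" and chain: "subset.chain \<A> \<C>"
    have mem: "\<And>I. I \<in> \<C> \<Longrightarrow> ideal I \<and> e C1 C2 \<notin> I"
      using chain unfolding subset.chain_def \<A>_def by blast
    have sub: "subspace I" if "I \<in> \<C>" for I using mem[OF that] unfolding ideal_def by blast
    have "subspace (\<Union>\<C>)"
    proof (rule subspaceI)
      show "0 \<in> \<Union>\<C>" using ne sub subspace_0 by blast
      fix x y c assume "x \<in> \<Union>\<C>"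
      then obtain I where I: "I \<in> \<C>" "x \<in> I" by blast
      then show "scale c x \<in> \<Union>\<C>" using sub subspace_scale by blast
      assume "y \<in> \<Union>\<C>"
      then obtain J where J: "J \<in> \<C>" "y \<in> J" by blast
      have "I \<subseteq> J \<or> J \<subseteq> I" using chain I(1) J(1) unfolding subset.chain_def by blast
      then obtain K where "K \<in> \<C>" "x \<in> K" "y \<in> K" using I J by blast
      then show "x + y \<in> \<Union>\<C>" using sub subspace_add by blast
    qed
    then show "\<Union>\<C> \<in> \<A>" unfolding \<A>_def ideal_def using mem unfolding ideal_def by auto
  qed
  then obtain M where M: "M \<in> \<A>" "\<And>X. X \<in> \<A> \<Longrightarrow> M \<subseteq> X \<Longrightarrow> X = M" by blast
  have "J = M \<or> J = L" if "ideal J" "M \<subseteq> J" for J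
    using M(2)[of J] that ideal_everything[of J] unfolding \<A>_def by blast
  then show ?thesis using that[of M] M(1) unfolding \<A>_def by blast
qed

end

text \<open>The data for the growth estimates: a filtration by spaces of dimension at most \<open>d n\<close>, which contains the
  generators in degree one, and \<open>p n\<close> independent products of \<open>2 * n\<close> generators.\<close>

locale filtered_matrix_algebra = matrix_algebra scale e S
  for scale :: "'f::field \<Rightarrow> 'r::ring_1 \<Rightarrow> 'r" and e S +
  fixes G :: "nat \<Rightarrow> 'r set" and d p :: "nat \<Rightarrow> nat"
  assumes G_subspace: "subspace (G n)"
    and G_mono: "m \<le> n \<Longrightarrow> G m \<subseteq> G n"
    and G_mult: "x \<in> G m \<Longrightarrow> y \<in> G n \<Longrightarrow> x * y \<in> G (m + n)"
    and G_S: "S \<subseteq> G 1" and G_e: "e i j \<in> G 0"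
    and G_dim: "\<exists>B. finite B \<and> card B \<le> d n \<and> G n \<subseteq> span B"
    and monomials: "n \<ge> 1 \<Longrightarrow> \<exists>C. independent C \<and> finite C \<and> card C = p n \<and>
        (\<forall>c\<in>C. \<exists>ss. set ss \<subseteq> S \<and> length ss = 2 * n \<and> c = prod_list ss)"
    and p_unbounded: "\<exists>n\<ge>1. p n \<ge> m"
begin

lemma G_commutator: "x \<in> G m \<Longrightarrow> y \<in> G n \<Longrightarrow> commutator x y \<in> G (m + n)"
  unfolding commutator_def using G_mult[of x m y n] G_mult[of y n x m]
  by (intro subspace_diff[OF G_subspace]) (simp_all add: add.commute)

lemma L_filtration: "L \<subseteq> (\<Union>n. G n)"
proof (rule L_induct)
  show "subspace (\<Union>n. G n)"
  proof (rule subspaceI)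
    show "0 \<in> (\<Union>n. G n)" using subspace_0[OF G_subspace] by blast
    fix x y c assume "x \<in> (\<Union>n. G n)"
    then obtain m where m: "x \<in> G m" by blast
    then show "scale c x \<in> (\<Union>n. G n)" using subspace_scale[OF G_subspace] by blast
    assume "y \<in> (\<Union>n. G n)"
    then obtain n where n: "y \<in> G n" by blast
    have "x + y \<in> G (max m n)"
      using subsetD[OF G_mono m, of "max m n"] subsetD[OF G_mono n, of "max m n"]
      by (intro subspace_add[OF G_subspace]) auto
    then show "x + y \<in> (\<Union>n. G n)" by blast
  qed
  show "gens \<subseteq> (\<Union>n. G n)"
  proof
    fix x assume "x \<in> gens"
    then obtain i j s where "x = e i j * s" "s \<in> S" unfolding gens_def by blast
    then have "x \<in> G (0 + 1)" using G_mult[OF G_e, of s 1] G_S by auto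
    then show "x \<in> (\<Union>n. G n)" by blast
  qed
  show "commutator x y \<in> (\<Union>n. G n)" if "x \<in> (\<Union>n. G n)" "y \<in> (\<Union>n. G n)" for x y
    using that by (auto dest: G_commutator)
qed

text \<open>Write \<open>\<phi>\<close> for the map from \<open>L\<close> to its quotient by a maximal ideal.  A finite-dimensional space \<open>V\<close> in the
  quotient lies in \<open>\<phi> ` (G r)\<close> for some \<open>r\<close>, so products of \<open>n\<close> of its elements lie in
  \<open>\<phi> ` (G (r * n))\<close>.  For the lower bound, the independent products of generators of \<open>A\<close> are placed at
  the position \<open>(C1, C2)\<close>.  They stay independent in the quotient, because \<open>A\<close> at this position meets the
  maximal ideal only in \<open>0\<close>.\<close>

theorem simple_quotient:
  obtains br :: "(nat \<Rightarrow>\<^sub>0 'f) \<Rightarrow> (nat \<Rightarrow>\<^sub>0 'f) \<Rightarrow> (nat \<Rightarrow>\<^sub>0 'f)"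
  where "simple_lie_algebra fscale br" "lie_algebra.finitely_generated fscale br"
    "\<And>V. lie_algebra.finite_dim_generating_subspace fscale br V \<Longrightarrow>
       \<exists>c\<ge>1. \<forall>n\<ge>1. p n \<le> lie_algebra.growth fscale br V (c * n)"
    "\<And>V. lie_algebra.finite_dim_generating_subspace fscale br V \<Longrightarrow>
       \<exists>r\<ge>1. \<forall>n. lie_algebra.growth fscale br V n \<le> d (r * n)"
proof -
  obtain M where M: "ideal M" "e C1 C2 \<notin> M" "\<And>J. ideal J \<Longrightarrow> M \<subseteq> J \<Longrightarrow> J = M \<or> J = L"
    using maximal_ideal by metis
  have M': "subspace M" "M \<subseteq> L" "\<And>x y. x \<in> L \<Longrightarrow> y \<in> M \<Longrightarrow> commutator x y \<in> M"
    using M(1) unfolding ideal_def by auto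
  interpret e12: Vector_Spaces.linear scale scale "\<lambda>a. e C1 C2 * a"
    unfolding Vector_Spaces.linear_iff using vector_space_axioms
    by (simp add: distrib_left mult_scale_right)
  have e12_0: "a = 0" if "a \<in> A" "e C1 C2 * a \<in> M" for a using ideal_proper_trivial[OF M(1,2) that] .
  have words: "\<exists>C. independent C \<and> finite C \<and> card C = p n \<and> span C \<subseteq> A \<and>
        (\<forall>c\<in>C. \<exists>ss. set ss \<subseteq> S \<and> length ss = 2 * n \<and> c = prod_list ss)" if n: "n \<ge> 1" for n
  proof -
    obtain C where C: "independent C" "finite C" "card C = p n"
        "\<forall>c\<in>C. \<exists>ss. set ss \<subseteq> S \<and> length ss = 2 * n \<and> c = prod_list ss"
      using monomials[OF n] by blast
    moreover have "span C \<subseteq> A" by (rule span_minimal[OF _ subspace_A]) (use C(4) prod_list_A in auto)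
    ultimately show ?thesis by blast
  qed
  have big: "\<exists>C. independent C \<and> finite C \<and> card C \<ge> m \<and> span C \<subseteq> L \<and> span C \<inter> M \<subseteq> {0}" for m
  proof -
    obtain n where n: "n \<ge> 1" "p n \<ge> m" using p_unbounded by blast
    obtain C where C: "independent C" "finite C" "card C = p n" "span C \<subseteq> A" using words[OF n(1)] by blast
    let ?D = "(\<lambda>a. e C1 C2 * a) ` C"
    have spD: "span ?D = (\<lambda>a. e C1 C2 * a) ` span C" by (rule e12.span_image)
    have inj: "inj_on (\<lambda>a. e C1 C2 * a) (span C)"
      unfolding e12.inj_on_iff_eq_0[OF subspace_span]
      using e12_0 C(4) subspace_0[OF M'(1)] by auto
    then have "inj_on (\<lambda>a. e C1 C2 * a) C" using span_superset inj_on_subset by blast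
    then have "card ?D = p n" using C(3) by (simp add: card_image)
    moreover have "independent ?D" by (rule e12.independent_injective_image[OF C(1) inj])
    moreover have "span ?D \<subseteq> L" unfolding spD using C(4) e_in_L by auto
    moreover have "span ?D \<inter> M \<subseteq> {0}"
    proof
      fix x assume "x \<in> span ?D \<inter> M"
      then obtain a where a: "a \<in> span C" "x = e C1 C2 * a" "x \<in> M" unfolding spD by blast
      then have "a = 0" using e12_0[of a] C(4) by blast
      then show "x \<in> {0}" using a(2) by simp
    qed
    ultimately show ?thesis using C(2) n(2) by (intro exI[of _ ?D]) auto
  qed
  have fin: "\<exists>W. finite W \<and> G n \<subseteq> span W" for n using G_dim by blast
  obtain \<phi> where \<phi>: "Vector_Spaces.linear scale fscale \<phi>" "\<phi> ` L = UNIV" "\<And>x. x \<in> L \<Longrightarrow> \<phi> x = 0 \<longleftrightarrow> x \<in> M"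
    using quotient_coordinates[OF M'(1,2) subspace_L L_filtration fin big] by blast
  interpret \<phi>: Vector_Spaces.linear scale fscale \<phi> by (fact \<phi>(1))
  have nonab: "\<exists>x\<in>L. \<exists>y\<in>L. commutator x y \<notin> M"
  proof (intro bexI)
    show "commutator (e C1 C3 * 1) (e C3 C2 * 1) \<notin> M"
      using M(2) commutator_e[OF one_A one_A, of C1 C3 C3 C2] by simp
    show "e C1 C3 * 1 \<in> L" "e C3 C2 * 1 \<in> L" using e_in_L[OF one_A] by auto
  qed
  have max: "J = M \<or> J = L" if "subspace J" "M \<subseteq> J" "J \<subseteq> L"
      "\<And>x y. x \<in> L \<Longrightarrow> y \<in> J \<Longrightarrow> commutator x y \<in> J" for J
    using M(3)[of J] that unfolding ideal_def by blast
  obtain br where br: "simple_lie_algebra fscale br"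
    "\<And>x y. x \<in> L \<Longrightarrow> y \<in> L \<Longrightarrow> \<phi> (commutator x y) = br (\<phi> x) (\<phi> y)"
    using lie.quotient_lie_algebra[OF L_subalgebra M' max nonab \<phi>] by blast
  interpret q: simple_lie_algebra fscale br by (fact br(1))
  have la: "lie_algebra fscale br" ..
  define X where "X = \<phi> ` gens"
  have finX: "finite X" unfolding X_def using finite_gens by simp
  have genX: "q.generates X"
  proof -
    let ?H = "q.lie_subalgebra hull X"
    have H: "q.lie_subalgebra ?H" by (rule q.subalgebra_hull)
    have "L \<subseteq> L \<inter> {x. \<phi> x \<in> ?H}"
    proof (rule L_induct)
      show "subspace (L \<inter> {x. \<phi> x \<in> ?H})"
        using H unfolding q.lie_subalgebra_def
        by (intro subspace_inter subspace_L \<phi>.subspace_linear_preimage) blast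
      show "gens \<subseteq> L \<inter> {x. \<phi> x \<in> ?H}"
        using gens_L hull_subset[of X q.lie_subalgebra] unfolding X_def by blast
      show "commutator x y \<in> L \<inter> {x. \<phi> x \<in> ?H}"
        if "x \<in> L \<inter> {x. \<phi> x \<in> ?H}" "y \<in> L \<inter> {x. \<phi> x \<in> ?H}" for x y
        using that L_closed br(2) H unfolding q.lie_subalgebra_def by auto
    qed
    then have "\<phi> ` L \<subseteq> ?H" by blast
    then show ?thesis unfolding q.generates_def \<phi>(2) by blast
  qed
  have fg: "q.finitely_generated" unfolding q.finitely_generated_def using finX genX by blast
  have upper: "\<exists>r\<ge>1. \<forall>n. q.products_upto V n \<subseteq> \<phi> ` (G (r * n))"
    if V: "q.finite_dim_generating_subspace V" for V
  proof -
    \<comment> \<open>The intersection with \<open>L\<close> matters: \<open>\<phi>\<close> is known to respect the bracket only on \<open>L\<close>.\<close>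
    define H where "H n = \<phi> ` (L \<inter> G n)" for n
    have subH: "fs.subspace (H n)" for n
      unfolding H_def by (intro \<phi>.subspace_image subspace_inter subspace_L G_subspace)
    have monoH: "H m \<subseteq> H n" if "m \<le> n" for m n unfolding H_def using G_mono[OF that] by blast
    obtain B where B: "finite B" "fs.span B = V"
      using V unfolding q.finite_dim_generating_subspace_def by blast
    have "\<exists>n. y \<in> H n" for y
    proof -
      have "y \<in> \<phi> ` L" unfolding \<phi>(2) by simp
      then show ?thesis unfolding H_def using L_filtration by blast
    qed
    then obtain k where k: "\<And>y. y \<in> H (k y)" by metis
    define r where "r = Suc (\<Sum>b\<in>B. k b)"
    have "B \<subseteq> H r"
    proof
      fix b assume b: "b \<in> B"
      then have "k b \<le> r" unfolding r_def using member_le_sum[of b B k] B(1) by simp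
      then show "b \<in> H r" using monoH k by blast
    qed
    then have VH: "V \<subseteq> H r" using fs.span_minimal[OF _ subH] B(2) by blast
    have prod: "x \<in> H (r * n)" if "q.lie_product V n x" for n x
      using that
    proof (induction rule: q.lie_product.induct)
      case (generator v)
      then show ?case using VH by auto
    next
      case (product i x j y)
      then obtain x' y' where xy: "x = \<phi> x'" "x' \<in> L" "x' \<in> G (r * i)" "y = \<phi> y'" "y' \<in> L" "y' \<in> G (r * j)"
        unfolding H_def by blast
      have "commutator x' y' \<in> L \<inter> G (r * i + r * j)" using xy L_closed G_commutator by blast
      then show ?case unfolding H_def using br(2) xy by (metis add_mult_distrib2 imageI)
    qed
    have "q.products_upto V n \<subseteq> H (r * n)" for n
      unfolding q.products_upto_span
    proof (rule fs.span_minimal[OF _ subH], rule subsetI)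
      fix x assume "x \<in> {x. \<exists>i\<in>{1..n}. q.lie_product V i x}"
      then obtain i where i: "i \<le> n" "q.lie_product V i x" by auto
      then show "x \<in> H (r * n)" using prod[OF i(2)] monoH[of "r * i" "r * n"] by auto
    qed
    then have "q.products_upto V n \<subseteq> \<phi> ` (G (r * n))" for n unfolding H_def by blast
    then show ?thesis using r_def by (intro exI[of _ r]) auto
  qed
  have span\<phi>: "\<exists>W. finite W \<and> card W \<le> d n \<and> \<phi> ` (G n) \<subseteq> fs.span W" for n
  proof -
    obtain B where B: "finite B" "card B \<le> d n" "G n \<subseteq> span B" using G_dim by blast
    have "\<phi> ` (G n) \<subseteq> fs.span (\<phi> ` B)" using \<phi>.spans_image[OF B(3)] .
    then show ?thesis using B card_image_le[OF B(1), of \<phi>] by (intro exI[of _ "\<phi> ` B"]) auto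
  qed
  have U: "\<exists>r\<ge>1. \<forall>n. q.growth V n \<le> d (r * n)" if V: "q.finite_dim_generating_subspace V" for V
  proof -
    obtain r where r: "r \<ge> 1" "\<And>n. q.products_upto V n \<subseteq> \<phi> ` (G (r * n))" using upper[OF V] by blast
    have "q.growth V n \<le> d (r * n)" for n
    proof -
      obtain W where "finite W" "card W \<le> d (r * n)" "\<phi> ` (G (r * n)) \<subseteq> fs.span W"
        using span\<phi> by blast
      then show ?thesis
        unfolding q.growth_products_upto using fs.dim_le_card r(2)[of n] by (meson order_trans)
    qed
    then show ?thesis using r(1) by blast
  qed
  have Lo: "\<exists>c\<ge>1. \<forall>n\<ge>1. p n \<le> q.growth V (c * n)" if V: "q.finite_dim_generating_subspace V" for V
  proof -
    have V': "fs.subspace V" "q.generates V" using V unfolding q.finite_dim_generating_subspace_def by auto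
    obtain c where c: "c \<ge> 1" "\<And>n x. q.lie_product X n x \<Longrightarrow> x \<in> q.products_upto V (c * n)"
      using q.products_upto_rescale[OF V' finX] by blast
    obtain r where r: "\<And>n. q.products_upto V n \<subseteq> \<phi> ` (G (r * n))" using upper[OF V] by blast
    have "p n \<le> q.growth V (2 * c * n)" if n: "n \<ge> 1" for n
    proof -
      obtain C where C: "independent C" "finite C" "card C = p n" "span C \<subseteq> A"
        "\<forall>x\<in>C. \<exists>ss. set ss \<subseteq> S \<and> length ss = 2 * n \<and> x = prod_list ss"
        using words[OF n] by blast
      let ?g = "\<lambda>a. \<phi> (e C1 C2 * a)"
      have lin: "Vector_Spaces.linear scale fscale ?g"
        unfolding Vector_Spaces.linear_iff
        using vector_space_axioms fs.vector_space_axioms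
        by (simp add: distrib_left mult_scale_right \<phi>.add \<phi>.scale)
      interpret g: Vector_Spaces.linear scale fscale ?g by (fact lin)
      have inj: "inj_on ?g (span C)"
        unfolding g.inj_on_iff_eq_0[OF subspace_span]
        using e12_0 C(4) \<phi>(3) e_in_L by blast
      then have "inj_on ?g C" using span_superset inj_on_subset by blast
      then have card: "card (?g ` C) = p n" using C(3) by (simp add: card_image)
      have ind: "fs.independent (?g ` C)" by (rule g.independent_injective_image[OF C(1) inj])
      have sub: "?g ` C \<subseteq> q.products_upto V (2 * c * n)"
      proof
        fix y assume "y \<in> ?g ` C"
        then obtain x where x: "x \<in> C" "y = \<phi> (e C1 C2 * x)" by blast
        then obtain ss where ss: "set ss \<subseteq> S" "length ss = 2 * n" "y = \<phi> (e C1 C2 * prod_list ss)"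
          using C(5) by auto
        then have "lie.lie_product gens (length ss) (e C1 C2 * prod_list ss)"
          using n by (intro product_of_generators) auto
        then have "q.lie_product X (length ss) y"
          using lie.lie_product_image[OF L_subalgebra gens_L br(2) la] ss(3) unfolding X_def by blast
        then have "y \<in> q.products_upto V (c * length ss)" using c(2) by blast
        then show "y \<in> q.products_upto V (2 * c * n)" unfolding ss(2) by (simp add: ac_simps)
      qed
      obtain W where W: "finite W" "\<phi> ` (G (r * (2 * c * n))) \<subseteq> fs.span W" using span\<phi> by blast
      then have "q.products_upto V (2 * c * n) \<subseteq> fs.span W" using r by blast
      then have "card (?g ` C) \<le> fs.dim (q.products_upto V (2 * c * n))"
        using fs.card_le_dim_finite_span[OF ind sub _ W(1)] by blast
      then show ?thesis unfolding q.growth_products_upto card .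
    qed
    then show ?thesis using c(1) by (intro exI[of _ "2 * c"]) auto
  qed
  show ?thesis by (rule that[OF br(1) fg Lo U])
qed

end

section \<open>The operator algebra of a word\<close>

text \<open>Linear operators on triples of scalar functions on the integers.  The matrix units act on the three
  components, the algebra of a word acts on each component in the same way.  For operators, in contrast to
  infinite matrices, the ring laws are those of composition.\<close>

typedef (overloaded) ('f::field) operator =
  "{a :: (int \<Rightarrow> corner \<Rightarrow> 'f) \<Rightarrow> (int \<Rightarrow> corner \<Rightarrow> 'f).
     (\<forall>u v. a (\<lambda>x k. u x k + v x k) = (\<lambda>x k. a u x k + a v x k)) \<and>
     (\<forall>c v. a (\<lambda>x k. c * v x k) = (\<lambda>x k. c * a v x k))}"
  morphisms app Operator
  by (intro exI[of _ "\<lambda>v. v"]) simp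

setup_lifting type_definition_operator

instantiation operator :: (field) ring_1
begin
lift_definition zero_operator :: "'a operator" is "\<lambda>v x k. 0" by simp
lift_definition one_operator :: "'a operator" is "\<lambda>v. v" by simp
lift_definition plus_operator :: "'a operator \<Rightarrow> 'a operator \<Rightarrow> 'a operator"
  is "\<lambda>a b v x k. a v x k + b v x k" by (auto simp: algebra_simps)
lift_definition minus_operator :: "'a operator \<Rightarrow> 'a operator \<Rightarrow> 'a operator"
  is "\<lambda>a b v x k. a v x k - b v x k" by (auto simp: algebra_simps)
lift_definition uminus_operator :: "'a operator \<Rightarrow> 'a operator"
  is "\<lambda>a v x k. - a v x k" by (auto simp: algebra_simps)
lift_definition times_operator :: "'a operator \<Rightarrow> 'a operator \<Rightarrow> 'a operator"
  is "\<lambda>a b v. a (b v)" by simp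
instance
proof
  show "(0 :: 'a operator) \<noteq> 1"
    by transfer (auto simp: fun_eq_iff intro!: exI[of _ "\<lambda>_ _. 1"])
qed (transfer; auto simp: fun_eq_iff algebra_simps)+
end

lift_definition opscale :: "'f::field \<Rightarrow> 'f operator \<Rightarrow> 'f operator"
  is "\<lambda>c a v x k. c * a v x k" by (auto simp: algebra_simps)

lemma operator_eqI: "(\<And>v x k. app a v x k = app b v x k) \<Longrightarrow> a = b"
  by transfer (auto simp: fun_eq_iff)

lemma app_simps [simp]:
  "app 0 v x k = 0" "app 1 v = v" "app (a + b) v x k = app a v x k + app b v x k"
  "app (a - b) v x k = app a v x k - app b v x k" "app (- a) v x k = - app a v x k"
  "app (a * b) v = app a (app b v)" "app (opscale c a) v x k = c * app a v x k"
  by (transfer; simp)+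

lemma app_add: "app a (\<lambda>x k. u x k + v x k) = (\<lambda>x k. app a u x k + app a v x k)"
  by transfer blast

lemma app_mult: "app a (\<lambda>x k. c * v x k) = (\<lambda>x k. c * app a v x k)"
  by transfer blast

lemma app_zero [simp]: "app a (\<lambda>x k. 0) = (\<lambda>x k. 0)"
  using app_mult[of a 0 "\<lambda>_ _. 0"] by simp

lemma app_sum:
  assumes "finite I"
  shows "app a (\<lambda>x k. \<Sum>i\<in>I. c i * g i x k) = (\<lambda>x k. \<Sum>i\<in>I. c i * app a (g i) x k)"
  using assms
proof (induction I)
  case (insert i I)
  have "app a (\<lambda>x k. \<Sum>i\<in>insert i I. c i * g i x k) = app a (\<lambda>x k. c i * g i x k + (\<Sum>i\<in>I. c i * g i x k))"
    using insert by simp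
  then show ?case using insert by (simp add: app_add app_mult)
qed simp

lift_definition unit :: "corner \<Rightarrow> corner \<Rightarrow> 'f::field operator"
  is "\<lambda>i j v x k. if k = i then v x j else 0" by (auto simp: fun_eq_iff)

lift_definition shift :: "int \<Rightarrow> 'f::field operator"
  is "\<lambda>s v x. v (x + s)" by auto

lift_definition ind :: "int set \<Rightarrow> 'f::field operator"
  is "\<lambda>Q v x k. if x \<in> Q then v x k else 0" by (auto simp: fun_eq_iff)

lemma app_basic [simp]:
  "app (unit i j) v x k = (if k = i then v x j else 0)"
  "app (shift s) v x = v (x + s)"
  "app (ind Q) v x k = (if x \<in> Q then v x k else 0)"
  by (transfer; simp)+

lemma unit_mult: "(unit i j :: 'f::field operator) * unit k l = (if j = k then unit i l else 0)"
  by (intro operator_eqI) auto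

lemma shift_add: "(shift s :: 'f::field operator) * shift t = shift (s + t)"
  by (intro operator_eqI) (simp add: algebra_simps)

lemma shift_0: "(shift 0 :: 'f::field operator) = 1"
  by (intro operator_eqI) simp

lemma ind_UNIV: "(ind UNIV :: 'f::field operator) = 1"
  by (intro operator_eqI) simp

lemma ind_mult: "(ind P :: 'f::field operator) * ind Q = ind (P \<inter> Q)"
  by (intro operator_eqI) simp

lemma ind_Un: "(ind (P \<union> Q) :: 'f::field operator) = ind P + ind Q - ind P * ind Q"
  by (intro operator_eqI) simp

lemma ind_shift: "(shift s :: 'f::field operator) * ind Q * shift (- s) = ind {x. x + s \<in> Q}"
  by (intro operator_eqI) simp

lemma unit_commutes:
  "unit i j * shift s = (shift s :: 'f::field operator) * unit i j"
  "unit i j * ind Q = (ind Q :: 'f::field operator) * unit i j"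
  by (intro operator_eqI; simp)+

definition delta :: "int \<Rightarrow> corner \<Rightarrow> int \<Rightarrow> corner \<Rightarrow> 'f::field" where
  "delta y l = (\<lambda>x k. if x = y \<and> k = l then 1 else 0)"

definition agree :: "(int \<Rightarrow> bool) \<Rightarrow> nat \<Rightarrow> int \<Rightarrow> int \<Rightarrow> bool" where
  "agree w r x y \<longleftrightarrow> (\<forall>d. \<bar>d\<bar> \<le> int r \<longrightarrow> w (x + d) = w (y + d))"

text \<open>The operators that act by the same formula wherever the word looks the same: the value at \<open>x\<close> depends
  only on the letters and on the values of the argument at distance at most \<open>r\<close> from \<open>x\<close>, read relative
  to \<open>x\<close>.  In this form the radius of a product is visibly at most the sum of the radii.\<close>

definition local_rule :: "(int \<Rightarrow> bool) \<Rightarrow> nat \<Rightarrow> 'f::field operator set" where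
  "local_rule w r = {a. \<forall>x y u v k. agree w r x y \<longrightarrow>
     (\<forall>d. \<bar>d\<bar> \<le> int r \<longrightarrow> u (x + d) = v (y + d)) \<longrightarrow> app a u x k = app a v y k}"

lemma local_ruleD:
  "a \<in> local_rule w r \<Longrightarrow> agree w r x y \<Longrightarrow> (\<And>d. \<bar>d\<bar> \<le> int r \<Longrightarrow> u (x + d) = v (y + d)) \<Longrightarrow>
   app a u x k = app a v y k"
  unfolding local_rule_def by blast

lemma agree_refl: "agree w r x x" by (simp add: agree_def)

lemma agree_sym: "agree w r x y \<Longrightarrow> agree w r y x" by (simp add: agree_def)

lemma agree_shift: "agree w (r + s) x y \<Longrightarrow> \<bar>d\<bar> \<le> int s \<Longrightarrow> agree w r (x + d) (y + d)"
  unfolding agree_def by (auto simp: add.assoc)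

lemma agree_mono: "agree w s x y \<Longrightarrow> r \<le> s \<Longrightarrow> agree w r x y"
  unfolding agree_def by auto

lemma local_rule_mono: "r \<le> s \<Longrightarrow> local_rule w r \<subseteq> local_rule w s"
  unfolding local_rule_def by (fastforce intro: agree_mono)

lemma local_ruleI:
  assumes "\<And>x y u v k. agree w r x y \<Longrightarrow> (\<And>d. \<bar>d\<bar> \<le> int r \<Longrightarrow> u (x + d) = v (y + d)) \<Longrightarrow>
    app a u x k = app a v y k"
  shows "a \<in> local_rule w r"
  unfolding local_rule_def using assms by blast

lemma local_rule_mult:
  assumes "a \<in> local_rule w r" "b \<in> local_rule w s"
  shows "a * b \<in> local_rule w (r + s)"
proof (rule local_ruleI)
  fix x y k and u v :: "int \<Rightarrow> corner \<Rightarrow> 'a"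
  assume ag: "agree w (r + s) x y" and uv: "\<And>d. \<bar>d\<bar> \<le> int (r + s) \<Longrightarrow> u (x + d) = v (y + d)"
  show "app (a * b) u x k = app (a * b) v y k"
    unfolding app_simps
  proof (rule local_ruleD[OF assms(1)])
    show "agree w r x y" by (rule agree_mono[OF ag]) simp
    fix d :: int assume d: "\<bar>d\<bar> \<le> int r"
    show "app b u (x + d) = app b v (y + d)"
    proof
      fix l
      show "app b u (x + d) l = app b v (y + d) l"
      proof (rule local_ruleD[OF assms(2)])
        show "agree w s (x + d) (y + d)"
          by (rule agree_shift[of w s r, OF _ d]) (use ag in \<open>simp add: add.commute\<close>)
        fix d' :: int assume "\<bar>d'\<bar> \<le> int s"
        then have "\<bar>d + d'\<bar> \<le> int (r + s)" using d by simp
        from uv[OF this] show "u (x + d + d') = v (y + d + d')" by (simp add: add.assoc)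
      qed
    qed
  qed
qed

lemma local_rule_0: "0 \<in> local_rule w r"
  by (rule local_ruleI) simp

lemma local_rule_add:
  assumes "a \<in> local_rule w r" "b \<in> local_rule w r"
  shows "a + b \<in> local_rule w r"
proof (rule local_ruleI)
  fix x y k and u v :: "int \<Rightarrow> corner \<Rightarrow> 'a"
  assume *: "agree w r x y" "\<And>d. \<bar>d\<bar> \<le> int r \<Longrightarrow> u (x + d) = v (y + d)"
  have "app a u x k = app a v y k" "app b u x k = app b v y k"
    by (rule local_ruleD[OF assms(1) *(1)] local_ruleD[OF assms(2) *(1)]; use *(2) in blast)+
  then show "app (a + b) u x k = app (a + b) v y k" by simp
qed

lemma local_rule_scale:
  assumes "a \<in> local_rule w r"
  shows "opscale c a \<in> local_rule w r"
proof (rule local_ruleI)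
  fix x y k and u v :: "int \<Rightarrow> corner \<Rightarrow> 'a"
  assume *: "agree w r x y" "\<And>d. \<bar>d\<bar> \<le> int r \<Longrightarrow> u (x + d) = v (y + d)"
  have "app a u x k = app a v y k"
    by (rule local_ruleD[OF assms(1) *(1)]; use *(2) in blast)
  then show "app (opscale c a) u x k = app (opscale c a) v y k" by simp
qed

lemma local_rule_basic:
  "(1 :: 'd::field operator) \<in> local_rule w r"
  "(unit i j :: 'd operator) \<in> local_rule w r"
  "(ind {x. w x = b} :: 'd operator) \<in> local_rule w r"
proof -
  have centre: "u x = v y" if "\<And>d. \<bar>d\<bar> \<le> int r \<Longrightarrow> u (x + d) = v (y + d)"
    for x y :: int and u v :: "int \<Rightarrow> corner \<Rightarrow> 'd"
    using that[of 0] by simp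
  have letter: "w x = w y" if "agree w r x y" for x y
    using that unfolding agree_def by (auto dest: spec[of _ 0])
  show "(1 :: 'd operator) \<in> local_rule w r"
  proof (rule local_ruleI)
    fix x y k and u v :: "int \<Rightarrow> corner \<Rightarrow> 'd"
    assume "\<And>d. \<bar>d\<bar> \<le> int r \<Longrightarrow> u (x + d) = v (y + d)"
    then have "u x = v y" by (rule centre)
    then show "app 1 u x k = app 1 v y k" by simp
  qed
  show "(unit i j :: 'd operator) \<in> local_rule w r"
  proof (rule local_ruleI)
    fix x y k and u v :: "int \<Rightarrow> corner \<Rightarrow> 'd"
    assume "\<And>d. \<bar>d\<bar> \<le> int r \<Longrightarrow> u (x + d) = v (y + d)"
    then have "u x = v y" by (rule centre)
    then show "app (unit i j) u x k = app (unit i j) v y k" by simp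
  qed
  show "(ind {x. w x = b} :: 'd operator) \<in> local_rule w r"
  proof (rule local_ruleI)
    fix x y k and u v :: "int \<Rightarrow> corner \<Rightarrow> 'd"
    assume ag: "agree w r x y" and "\<And>d. \<bar>d\<bar> \<le> int r \<Longrightarrow> u (x + d) = v (y + d)"
    from this(2) have "u x = v y" by (rule centre)
    moreover have "w x = w y" using ag by (rule letter)
    ultimately show "app (ind {x. w x = b}) u x k = app (ind {x. w x = b}) v y k" by simp
  qed
qed

lemma local_rule_shift: "\<bar>s\<bar> \<le> int r \<Longrightarrow> shift s \<in> local_rule w r"
  by (rule local_ruleI) simp

text \<open>Near \<open>x\<close> the argument agrees with a finite combination of point functions.\<close>

lemma local_rule_expand:
  assumes a: "a \<in> local_rule w r"
  shows "app a v x k = (\<Sum>(d, l)\<in>{- int r..int r} \<times> UNIV. v (x + d) l * app a (delta (x + d) l) x k)"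
proof -
  let ?I = "{- int r..int r} \<times> (UNIV :: corner set)"
  have fin: "finite ?I" using corner_UNIV by auto
  have "app a v x k = app a (\<lambda>z m. \<Sum>i\<in>?I. v (x + fst i) (snd i) * delta (x + fst i) (snd i) z m) x k"
  proof (rule local_ruleD[OF a agree_refl])
    fix d :: int assume d: "\<bar>d\<bar> \<le> int r"
    show "v (x + d) = (\<lambda>m. \<Sum>i\<in>?I. v (x + fst i) (snd i) * delta (x + fst i) (snd i) (x + d) m)"
    proof
      fix m
      have "(\<Sum>i\<in>?I. v (x + fst i) (snd i) * delta (x + fst i) (snd i) (x + d) m)
        = (\<Sum>i\<in>?I. if i = (d, m) then v (x + d) m else 0)"
        by (intro sum.cong) (auto simp: delta_def)
      also have "\<dots> = v (x + d) m" using fin d by auto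
      finally show "v (x + d) m = (\<Sum>i\<in>?I. v (x + fst i) (snd i) * delta (x + fst i) (snd i) (x + d) m)" by simp
    qed
  qed
  then show ?thesis
    using app_sum[OF fin, of a "\<lambda>i. v (x + fst i) (snd i)" "\<lambda>i. delta (x + fst i) (snd i)"]
    by (simp add: case_prod_unfold)
qed


definition commutes_units :: "'f::field operator \<Rightarrow> bool" where
  "commutes_units a \<longleftrightarrow> (\<forall>i j. unit i j * a = a * unit i j)"

text \<open>An operator that commutes with the matrix units has the same matrix coefficients in all three
  components, and coefficient \<open>0\<close> between different ones; these are its entries as an infinite matrix
  over the integers.\<close>

definition coeff :: "'f::field operator \<Rightarrow> int \<Rightarrow> int \<Rightarrow> 'f" where
  "coeff a x y = app a (delta y C1) x C1"

lemma app_delta: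
  assumes "commutes_units a"
  shows "app a (delta y i) x k = (if k = i then coeff a x y else 0)"
proof -
  have "app (unit i C1 * a) (delta y C1) x k = app (a * unit i C1) (delta y C1) x k"
    using assms unfolding commutes_units_def by simp
  moreover have "app (unit i C1) (delta y C1) = (delta y i :: int \<Rightarrow> corner \<Rightarrow> 'a)"
    by (auto simp: fun_eq_iff delta_def)
  ultimately show ?thesis unfolding coeff_def by simp
qed

lemma local_rule_coeff:
  assumes a: "a \<in> local_rule w r" and c: "commutes_units a"
  shows "app a v x k = (\<Sum>d\<in>{- int r..int r}. v (x + d) k * coeff a x (x + d))"
proof -
  have "app a v x k = (\<Sum>(d, l)\<in>{- int r..int r} \<times> UNIV. v (x + d) l * app a (delta (x + d) l) x k)"
    by (rule local_rule_expand[OF a])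
  also have "\<dots> = (\<Sum>d\<in>{- int r..int r}. \<Sum>l\<in>UNIV. v (x + d) l * app a (delta (x + d) l) x k)"
    by (simp add: sum.cartesian_product)
  also have "\<dots> = (\<Sum>d\<in>{- int r..int r}. v (x + d) k * coeff a x (x + d))"
  proof (intro sum.cong refl)
    fix d
    have "(\<Sum>l\<in>UNIV. v (x + d) l * app a (delta (x + d) l) x k)
       = (\<Sum>l\<in>UNIV. if l = k then v (x + d) k * coeff a x (x + d) else 0)"
      by (intro sum.cong) (auto simp: app_delta[OF c])
    then show "(\<Sum>l\<in>UNIV. v (x + d) l * app a (delta (x + d) l) x k) = v (x + d) k * coeff a x (x + d)"
      using corner_UNIV(2) by simp
  qed
  finally show ?thesis .
qed

lemma coeff_agree:
  assumes "a \<in> local_rule w r" "agree w r x y"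
  shows "coeff a x (x + d) = coeff a y (y + d)"
  unfolding coeff_def by (rule local_ruleD[OF assms]) (auto simp: delta_def fun_eq_iff)

lemma opscale_vector_space: "vector_space (opscale :: 'f::field \<Rightarrow> _)"
  by unfold_locales (auto intro!: operator_eqI simp: algebra_simps)

interpretation ops: assoc_algebra "opscale :: 'f::field \<Rightarrow> _"
proof (intro assoc_algebra.intro assoc_algebra_axioms.intro opscale_vector_space)
  fix c :: 'f and x y :: "'f operator"
  show "opscale c x * y = opscale c (x * y)" by (rule operator_eqI) simp
  show "x * opscale c y = opscale c (x * y)"
    by (rule operator_eqI) (simp add: app_mult flip: fun_eq_iff, transfer, auto)
qed

definition word_gens :: "(int \<Rightarrow> bool) \<Rightarrow> 'f::field operator set" where
  "word_gens w = {1, shift 1, shift (- 1), ind {x. w x = True}, ind {x. w x = False}}"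

abbreviation word_algebra :: "(int \<Rightarrow> bool) \<Rightarrow> 'f::field operator set" where
  "word_algebra w \<equiv> ops.generated (word_gens w)"

lemma word_gens_local: "s \<in> word_gens w \<Longrightarrow> s \<in> local_rule w 1"
proof -
  assume "s \<in> word_gens w"
  then have "s = 1 \<or> s = shift 1 \<or> s = shift (- 1) \<or> s = ind {x. w x = True} \<or> s = ind {x. w x = False}"
    unfolding word_gens_def by (simp only: insert_iff empty_iff) blast
  then show ?thesis
    by (elim disjE; simp only:; intro local_rule_basic local_rule_shift; simp)
qed

lemma word_algebra_local:
  "a \<in> word_algebra w \<Longrightarrow> \<exists>r. a \<in> local_rule w r"
proof (induction rule: ops.generated.induct)
  case (gen s)
  then have "s \<in> local_rule w 1" by (rule word_gens_local)
  then show ?case by blast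
next
  case (add a b)
  then obtain r s where "a \<in> local_rule w r" "b \<in> local_rule w s" by blast
  then have "a \<in> local_rule w (max r s)" "b \<in> local_rule w (max r s)"
    using local_rule_mono[of r "max r s" w] local_rule_mono[of s "max r s" w] by auto
  then show ?case using local_rule_add by blast
next
  case (scale a c)
  then show ?case using local_rule_scale by blast
next
  case (mult a b)
  then show ?case using local_rule_mult by blast
qed

lemma word_gens_commute: "s \<in> word_gens w \<Longrightarrow> unit i j * s = s * unit i j"
  unfolding word_gens_def using unit_commutes by auto

lemma word_algebra_commute:
  "a \<in> word_algebra w \<Longrightarrow> commutes_units a"
  unfolding commutes_units_def
proof (induction rule: ops.generated.induct)
  case (gen s)
  then show ?case using word_gens_commute by blast
next
  case (mult a b)
  then show ?case by (metis mult.assoc)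
qed (auto simp: algebra_simps ops.mult_scale_left ops.mult_scale_right)

lemma one_word_algebra: "1 \<in> word_algebra w"
  by (rule ops.generated.gen) (simp add: word_gens_def)


lemma shift_word_algebra: "(shift s :: 'f::field operator) \<in> word_algebra w"
proof -
  let ?A = "word_algebra w :: 'f operator set"
  have pos: "shift (int n) \<in> ?A \<and> shift (- int n) \<in> ?A" for n
  proof (induction n)
    case 0 then show ?case using one_word_algebra by (simp add: shift_0)
  next
    case (Suc n)
    have g: "shift 1 \<in> ?A" "shift (- 1) \<in> ?A"
      by (auto intro!: ops.generated.gen simp: word_gens_def)
    have "shift 1 * shift (int n) \<in> ?A" "shift (- 1) * shift (- int n) \<in> ?A"
      using g Suc by (auto intro: ops.generated.mult)
    then show ?case by (simp add: shift_add algebra_simps)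
  qed
  show ?thesis using pos[of "nat s"] pos[of "nat (- s)"] by (cases "s \<ge> 0") auto
qed

lemma ind_shift_word_algebra:
  "(ind Q :: 'f::field operator) \<in> word_algebra w \<Longrightarrow> (ind {x. x + s \<in> Q} :: 'f operator) \<in> word_algebra w"
  unfolding ind_shift[symmetric] by (intro ops.generated.mult shift_word_algebra)

text \<open>The indicator of a neighbourhood is a product of shifted indicators of single letters.\<close>

lemma ind_agree_word_algebra: "(ind {x. agree w r x y} :: 'f::field operator) \<in> word_algebra w"
proof -
  let ?A = "word_algebra w :: 'f operator set"
  have one: "ind {x. w (x + d) = w (y + d)} \<in> ?A" for d
  proof -
    have "ind {x. w x = w (y + d)} \<in> ?A"
      by (rule ops.generated.gen) (cases "w (y + d)"; simp add: word_gens_def)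
    from ind_shift_word_algebra[OF this, of d] show ?thesis by simp
  qed
  have "ind {x. \<forall>d\<in>D. w (x + d) = w (y + d)} \<in> ?A" if "finite D" for D
    using that
  proof (induction D)
    case empty
    then show ?case using one_word_algebra by (simp add: ind_UNIV)
  next
    case (insert d D)
    have "ind {x. w (x + d) = w (y + d)} * ind {x. \<forall>d\<in>D. w (x + d) = w (y + d)} \<in> ?A"
      using insert one by (intro ops.generated.mult)
    then show ?case by (simp add: ind_mult Collect_conj_eq)
  qed
  from this[of "{- int r..int r}"] show ?thesis
    by (simp add: agree_def abs_le_iff Ball_def conj_commute minus_le_iff cong: conj_cong)
qed

text \<open>Let \<open>c\<close> be a coefficient of \<open>a\<close> different from \<open>0\<close>, between \<open>x0\<close> and \<open>y0\<close>.  Multiplication with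
  indicators of large neighbourhoods of \<open>x0\<close> and of \<open>y0\<close> from the two sides removes all coefficients
  other than the copies of \<open>c\<close>: since the word is not periodic, at a place that looks like \<open>x0\<close> only one
  nearby place looks like \<open>y0\<close>.  What remains is a multiple of a shift on the places that look like \<open>x0\<close>.
  After undoing the shift, the ideal contains the indicator of these places, and hence the indicators of
  their translates and of finite unions of them.  By uniform recurrence one such union is everything.\<close>

lemma word_algebra_simple:
  assumes rec: "\<And>r y. \<exists>K. \<forall>x. \<exists>t\<in>{0..int K}. agree w r (x + t) y"
    and aper: "\<And>e. e \<noteq> 0 \<Longrightarrow> \<exists>z. w (z + e) \<noteq> w z"
    and J: "J \<subseteq> word_algebra w" "ops.subspace J"
      "\<And>x y. x \<in> J \<Longrightarrow> y \<in> word_algebra w \<Longrightarrow> x * y \<in> J \<and> y * x \<in> J"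
    and a: "a \<in> J" "a \<noteq> 0"
  shows "1 \<in> J"
proof -
  obtain r where ar: "a \<in> local_rule w r" using word_algebra_local a(1) J(1) by blast
  have ac: "commutes_units a" using word_algebra_commute a(1) J(1) by blast
  have "\<exists>x0. \<exists>\<delta>\<in>{- int r..int r}. coeff a x0 (x0 + \<delta>) \<noteq> 0"
  proof (rule ccontr)
    assume no: "\<not> ?thesis"
    have "app a v x k = 0" for v x k
      unfolding local_rule_coeff[OF ar ac] using no by (intro sum.neutral) auto
    then have "a = 0" by (intro operator_eqI) simp
    then show False using a(2) by blast
  qed
  then obtain x0 \<delta> where \<delta>: "\<delta> \<in> {- int r..int r}" "coeff a x0 (x0 + \<delta>) \<noteq> 0" by blast
  define c where "c = coeff a x0 (x0 + \<delta>)"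
  define y0 where "y0 = x0 + \<delta>"
  \<comment> \<open>\<open>R\<close> is so large that the neighbourhood of \<open>y0\<close> with this radius determines its place up to distance \<open>2 * r\<close>.\<close>
  have "\<exists>R. \<forall>e\<in>{- 2 * int r..2 * int r} - {0}. \<exists>z. \<bar>z - y0\<bar> \<le> int R \<and> w (z + e) \<noteq> w z"
  proof -
    obtain z where z: "\<And>e. e \<noteq> 0 \<Longrightarrow> w (z e + e) \<noteq> w (z e)" using aper by metis
    define E where "E = {- 2 * int r..2 * int r} - {0}"
    have "\<forall>e\<in>E. nat \<bar>z e - y0\<bar> \<le> (\<Sum>e\<in>E. nat \<bar>z e - y0\<bar>)"
      unfolding E_def by (intro ballI member_le_sum) auto
    then have "\<forall>e\<in>E. \<bar>z e - y0\<bar> \<le> int (\<Sum>e\<in>E. nat \<bar>z e - y0\<bar>) \<and> w (z e + e) \<noteq> w (z e)"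
      using z E_def by (auto simp: nat_le_iff simp del: of_nat_sum)
    then show ?thesis unfolding E_def[symmetric] by blast
  qed
  then obtain R where R: "\<And>e. e \<in> {- 2 * int r..2 * int r} \<Longrightarrow> e \<noteq> 0 \<Longrightarrow>
      \<exists>z. \<bar>z - y0\<bar> \<le> int R \<and> w (z + e) \<noteq> w z" by blast
  have distinguish: "\<not> agree w R (y0 + e) y0" if e: "e \<in> {- 2 * int r..2 * int r}" "e \<noteq> 0" for e
  proof
    assume ag: "agree w R (y0 + e) y0"
    obtain z where z: "\<bar>z - y0\<bar> \<le> int R" "w (z + e) \<noteq> w z" using R[OF e] by blast
    have "w (y0 + e + (z - y0)) = w (y0 + (z - y0))" using ag z(1) unfolding agree_def by blast
    then show False using z(2) by (simp add: algebra_simps)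
  qed
  \<comment> \<open>The radius \<open>R + 3 * r\<close> leaves radius \<open>R\<close> at all places within distance \<open>r\<close>, and radius \<open>r\<close> at \<open>x\<close> itself.\<close>
  define Q1 where "Q1 = {x. agree w (R + 3 * r) x x0}"
  define Q2 where "Q2 = {x. agree w R x y0}"
  have Q: "ind Q1 \<in> word_algebra w" "ind Q2 \<in> word_algebra w"
    unfolding Q1_def Q2_def by (rule ind_agree_word_algebra)+
  have locate: "x + d \<in> Q2 \<longleftrightarrow> d = \<delta>" if x: "x \<in> Q1" and d: "d \<in> {- int r..int r}" for x d
  proof -
    have ag: "agree w R (x + d) (x0 + d)"
      by (rule agree_shift[of w R "3 * r"]) (use x d in \<open>auto simp: Q1_def\<close>)
    show ?thesis
    proof
      assume "d = \<delta>"
      then show "x + d \<in> Q2" using ag unfolding Q2_def y0_def by simp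
    next
      assume "x + d \<in> Q2"
      then have "agree w R (x + d) y0" unfolding Q2_def by simp
      then have "agree w R (y0 + (d - \<delta>)) y0"
        using ag unfolding y0_def agree_def by (simp add: algebra_simps)
      then show "d = \<delta>" using distinguish[of "d - \<delta>"] d \<delta>(1) by fastforce
    qed
  qed
  have coeffQ: "coeff a x (x + \<delta>) = c" if "x \<in> Q1" for x
    unfolding c_def using that unfolding Q1_def
    by (intro coeff_agree[OF ar]) (auto intro: agree_mono)
  have N: "ind Q1 * a * ind Q2 = opscale c (ind Q1 * shift \<delta>)"
  proof (rule operator_eqI)
    fix v x k
    show "app (ind Q1 * a * ind Q2) v x k = app (opscale c (ind Q1 * shift \<delta>)) v x k"
    proof (cases "x \<in> Q1")
      case True
      have "app a (app (ind Q2) v) x k = (\<Sum>d\<in>{- int r..int r}. app (ind Q2) v (x + d) k * coeff a x (x + d))"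
        by (rule local_rule_coeff[OF ar ac])
      also have "\<dots> = (\<Sum>d\<in>{- int r..int r}. if d = \<delta> then v (x + \<delta>) k * c else 0)"
        using locate[OF True] coeffQ[OF True] by (intro sum.cong) auto
      also have "\<dots> = v (x + \<delta>) k * c" using \<delta>(1) by simp
      finally show ?thesis using True by (simp add: mult.commute)
    qed simp
  qed
  have "ind Q1 * a * ind Q2 \<in> J" using J(3) a(1) Q by blast
  then have "opscale (inverse c) (opscale c (ind Q1 * shift \<delta>)) \<in> J"
    unfolding N using ops.subspace_scale[OF J(2)] by blast
  moreover have "c \<noteq> 0" unfolding c_def by (rule \<delta>(2))
  ultimately have "ind Q1 * shift \<delta> \<in> J" by simp
  then have "ind Q1 * shift \<delta> * shift (- \<delta>) \<in> J" using J(3) shift_word_algebra by blast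
  then have base: "ind Q1 \<in> J" by (simp add: mult.assoc shift_add shift_0)
  have sh: "ind {x. x + t \<in> Q1} \<in> J" for t
    unfolding ind_shift[symmetric] using J(3) shift_word_algebra base by blast
  have un: "ind (P \<union> P') \<in> J" if "ind P \<in> J" "ind P' \<in> J" for P P'
  proof -
    have "ind P * ind P' \<in> J" using J(1,3) that by blast
    then show ?thesis unfolding ind_Un using that
      by (intro ops.subspace_diff[OF J(2)] ops.subspace_add[OF J(2)])
  qed
  have cover: "ind {x. \<exists>t\<in>{0..int n}. x + t \<in> Q1} \<in> J" for n
  proof (induction n)
    case 0
    then show ?case using base by simp
  next
    case (Suc n)
    have "{x. \<exists>t\<in>{0..int (Suc n)}. x + t \<in> Q1} = {x. \<exists>t\<in>{0..int n}. x + t \<in> Q1} \<union> {x. x + int (Suc n) \<in> Q1}"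
    proof -
      have "{0..int (Suc n)} = insert (int (Suc n)) {0..int n}" by auto
      then show ?thesis by auto
    qed
    then show ?case using un[OF Suc sh[of "int (Suc n)"]] by simp
  qed
  obtain K where K: "\<And>x. \<exists>t\<in>{0..int K}. agree w (R + 3 * r) (x + t) x0" using rec by blast
  have "{x. \<exists>t\<in>{0..int K}. x + t \<in> Q1} = UNIV" unfolding Q1_def using K by auto
  then show ?thesis using cover[of K] by (simp add: ind_UNIV)
qed

section \<open>Growth rates between consecutive dimensions\<close>

text \<open>The form in which the growth bounds of the Lie algebras are compared with \<open>Phi\<close>.  Changing the generating
  space rescales the argument, hence the constants \<open>c\<close> and \<open>r\<close>.  The growth is at most
  \<open>9 * N * p N\<close> with \<open>p N \<le> 2 * N * exp (3 / 2 * f N)\<close> for \<open>N = 2 * (r * n) + 1\<close>.\<close>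

definition separating_rate :: "nat \<Rightarrow> (nat \<Rightarrow> real) \<Rightarrow> bool" where
  "separating_rate q f \<longleftrightarrow>
     (\<forall>\<alpha>>0. \<forall>c\<ge>1. \<forall>\<^sub>F n in sequentially. Phi q \<alpha> (c * n) < exp (f n / 4)) \<and>
     (\<forall>\<alpha>>0. \<forall>r\<ge>1. \<forall>\<^sub>F n in sequentially.
        18 * real (2 * (r * n) + 1) ^ 2 * exp (3 / 2 * f (2 * (r * n) + 1)) \<le> Phi (q + 1) \<alpha> n)"

text \<open>The monotonicity of \<open>(ln n)\<^sup>2 / n\<close> is that of \<open>ln x / x\<close> for \<open>x = sqrt n\<close>; it begins at \<open>exp 2\<close>, and
  \<open>9\<close> is the smallest square above.\<close>

lemma rate_log_square: "rate (\<lambda>n. ln (real n) ^ 2) 9"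
proof
  show "ln (real m) ^ 2 \<le> ln (real n) ^ 2" if "9 \<le> m" "m \<le> n" for m n
    using that by (intro power_mono) auto
  show "ln (real n) ^ 2 / real n \<le> ln (real m) ^ 2 / real m" if "9 \<le> m" "m \<le> n" for m n
  proof -
    have sq: "ln (real k) ^ 2 / real k = 4 * (ln (sqrt k) / sqrt k) ^ 2" if "k \<ge> 1" for k :: nat
    proof -
      have "ln (real k) = 2 * ln (sqrt k)" using that ln_sqrt[of "real k"] by simp
      then show ?thesis by (simp add: power_divide power_mult_distrib)
    qed
    have "exp 1 \<le> (3 :: real)" by (rule exp_le)
    also have "3 = sqrt (real 9)" by (rule real_sqrt_unique[symmetric]) auto
    also have "\<dots> \<le> sqrt (real m)" by (rule real_sqrt_le_mono) (use that in simp)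
    finally have "ln (sqrt n) / sqrt n \<le> ln (sqrt m) / sqrt m"
      using that by (intro ln_x_over_x_mono) auto
    moreover have "0 \<le> ln (sqrt n) / sqrt n" using that by simp
    ultimately have "(ln (sqrt n) / sqrt n) ^ 2 \<le> (ln (sqrt m) / sqrt m) ^ 2"
      by (intro power_mono)
    then show ?thesis using sq[of m] sq[of n] that by simp
  qed
  show "(\<lambda>n. ln (real n) ^ 2 / real n) \<longlonglongrightarrow> 0" by real_asymp
  show "filterlim (\<lambda>n. ln (real n) ^ 2) at_top sequentially" by real_asymp
  have "exp (1 / 2 :: real) ^ 2 \<le> 2 ^ 2"
    using exp_le by (simp flip: exp_of_nat_mult)
  then have "exp (1 / 2 :: real) \<le> 2" by (rule power2_le_imp_le) simp
  then have half: "1 / 2 \<le> ln (2 :: real)" by (subst ln_ge_iff) auto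
  have "2 * ln 2 = ln (2 ^ 2 :: real)" by (subst ln_realpow) auto
  also have "\<dots> \<le> ln (real 9)" by (subst ln_le_cancel_iff) auto
  finally have "2 * ln 2 \<le> ln (real 9)" .
  moreover from this have "1 \<le> ln (real 9)" using half by simp
  ultimately have "2 * ln 2 * 1 \<le> ln (real 9) * ln (real 9)" using half by (intro mult_mono) auto
  then show "2 * ln 2 \<le> ln (real 9) ^ 2" by (simp add: power2_eq_square)
qed simp

lemma separating_log_square: "separating_rate 2 (\<lambda>n. ln (real n) ^ 2)"
  unfolding separating_rate_def
proof (intro conjI allI impI)
  fix \<alpha> :: real and c :: nat assume "\<alpha> > 0" "c \<ge> 1"
  then have c: "real c > 0" by simp
  have "\<forall>\<^sub>F n in sequentially. (real c * real n) powr \<alpha> < exp (ln (real n) ^ 2 / 4)"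
    using c \<open>\<alpha> > 0\<close> by real_asymp
  then show "\<forall>\<^sub>F n in sequentially. Phi 2 \<alpha> (c * n) < exp (ln (real n) ^ 2 / 4)"
    unfolding Phi_def by simp
next
  fix \<alpha> :: real and r :: nat assume "\<alpha> > 0" "r \<ge> 1"
  then have r: "real r > 0" by simp
  define \<beta> where "\<beta> = \<alpha> / (\<alpha> + 1)"
  have \<beta>: "\<beta> > 0" unfolding \<beta>_def using \<open>\<alpha> > 0\<close> by simp
  have "\<forall>\<^sub>F n in sequentially. 18 * (2 * (real r * real n) + 1) ^ 2 * exp (3 / 2 * ln (2 * (real r * real n) + 1) ^ 2)
     \<le> exp (real n powr \<beta>)"
    using r \<beta> by real_asymp
  then show "\<forall>\<^sub>F n in sequentially. 18 * real (2 * (r * n) + 1) ^ 2 *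
      exp (3 / 2 * ln (real (2 * (r * n) + 1)) ^ 2) \<le> Phi (2 + 1) \<alpha> n"
    unfolding Phi_def \<beta>_def by (simp add: add.commute)
qed

definition iterlog :: "nat \<Rightarrow> real \<Rightarrow> real" where "iterlog j = ln ^^ j"

lemma iterlog_simps: "iterlog 0 x = x" "iterlog (Suc j) x = ln (iterlog j x)" "iterlog (Suc j) x = iterlog j (ln x)"
  unfolding iterlog_def by (auto simp: funpow_swap1)

lemma filterlim_iterlog: "filterlim (iterlog j) at_top at_top"
proof (induction j)
  case 0
  then show ?case by (simp add: iterlog_def filterlim_ident id_def)
next
  case (Suc j)
  then show ?case unfolding iterlog_simps(2)[abs_def]
    by (rule filterlim_compose[OF ln_at_top])
qed

text \<open>From the point on where all iterated logarithms are at least \<open>1\<close>, they are increasing and do not increase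
  distances.\<close>

definition logs_ge1 :: "nat \<Rightarrow> real \<Rightarrow> bool" where
  "logs_ge1 j x \<longleftrightarrow> (\<forall>i\<le>j. 1 \<le> iterlog i x)"

lemma logs_ge1_Suc: "logs_ge1 (Suc j) x \<longleftrightarrow> 1 \<le> x \<and> logs_ge1 j (ln x)"
proof -
  have "(\<forall>i\<le>Suc j. 1 \<le> iterlog i x) \<longleftrightarrow> 1 \<le> iterlog 0 x \<and> (\<forall>i\<le>j. 1 \<le> iterlog (Suc i) x)"
    by (simp only: less_Suc_eq_le[symmetric] All_less_Suc2)
  then show ?thesis unfolding logs_ge1_def by (simp add: iterlog_simps(1,3))
qed

lemma eventually_logs_ge1: "eventually (logs_ge1 j) at_top"
proof -
  have "\<forall>\<^sub>F x in at_top. \<forall>i\<in>{..j}. 1 \<le> iterlog i x"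
    using filterlim_iterlog by (intro eventually_ball_finite) (auto simp: filterlim_at_top)
  then show ?thesis unfolding logs_ge1_def by (auto elim: eventually_mono)
qed

lemma ln_diff_le: "1 \<le> x \<Longrightarrow> x \<le> y \<Longrightarrow> ln y - ln x \<le> y - (x::real)"
proof -
  assume *: "1 \<le> x" "x \<le> y"
  then have "ln y - ln x = ln (y / x)" by (simp add: ln_div)
  also have "\<dots> \<le> y / x - 1" using * by (intro ln_le_minus_one) auto
  also have "\<dots> = (y - x) / x" using * by (simp add: field_simps)
  also have "\<dots> \<le> (y - x) / 1" using * by (intro divide_left_mono) auto
  finally show ?thesis by simp
qed

lemma sqrt_diff_le: "1 \<le> x \<Longrightarrow> x \<le> y \<Longrightarrow> sqrt y - sqrt x \<le> y - (x::real)"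
proof -
  assume *: "1 \<le> x" "x \<le> y"
  then have s: "1 \<le> sqrt x" "sqrt x \<le> sqrt y" by auto
  have "1 \<le> sqrt y + sqrt x" by (rule order_trans[OF s(1)]) (use * in simp)
  from mult_left_mono[OF this, of "sqrt y - sqrt x"]
  have "(sqrt y - sqrt x) * 1 \<le> (sqrt y - sqrt x) * (sqrt y + sqrt x)" using s(2) by simp
  also have "\<dots> = y - x" using * by (simp add: algebra_simps)
  finally show ?thesis by simp
qed

lemma iterlog_lipschitz:
  "logs_ge1 j x \<Longrightarrow> x \<le> y \<Longrightarrow> logs_ge1 j y \<and> iterlog j x \<le> iterlog j y \<and> iterlog j y - iterlog j x \<le> y - x"
proof (induction j arbitrary: x y)
  case 0
  then show ?case by (auto simp: logs_ge1_def iterlog_simps)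
next
  case (Suc j)
  then have x: "1 \<le> x" "logs_ge1 j (ln x)" by (auto simp: logs_ge1_Suc)
  then have "ln x \<le> ln y" using Suc.prems by simp
  from Suc.IH[OF x(2) this] show ?case
    using x Suc.prems ln_diff_le[of x y] by (auto simp: logs_ge1_Suc iterlog_simps(3))
qed

lemma iterlog_le: "logs_ge1 j x \<Longrightarrow> iterlog j x \<le> x"
proof (induction j arbitrary: x)
  case 0
  then show ?case by (simp add: iterlog_simps)
next
  case (Suc j)
  then have "1 \<le> x" "iterlog j (ln x) \<le> ln x" by (auto simp: logs_ge1_Suc)
  moreover have "ln x \<le> x" using ln_le_minus_one[of x] \<open>1 \<le> x\<close> by simp
  ultimately show ?case by (simp add: iterlog_simps(3))
qed

text \<open>For \<open>q \<ge> 3\<close> and \<open>L = iterlog (q - 2)\<close>, the logarithm of \<open>Phi q\<close> is \<open>n / exp (\<beta> * L n)\<close> for some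
  constant \<open>\<beta> > 0\<close>, and that of \<open>Phi (q + 1)\<close> is \<open>n / exp (\<beta> * ln (L n))\<close>.  The square root of \<open>L n\<close>
  separates \<open>\<beta> * L n\<close> from \<open>\<beta> * ln (L n)\<close> for all values of \<open>\<beta>\<close>.\<close>

definition log_rate :: "nat \<Rightarrow> nat \<Rightarrow> real" where
  "log_rate j n = real n / exp (sqrt (iterlog j (real n)))"

lemma eventually_logs_ge1_nat: "\<forall>\<^sub>F n in sequentially. logs_ge1 j (real n)"
  using eventually_compose_filterlim[OF eventually_logs_ge1 filterlim_real_sequentially] .

lemma filterlim_iterlog_nat: "filterlim (\<lambda>n. iterlog j (real n)) at_top sequentially"
  using filterlim_compose[OF filterlim_iterlog filterlim_real_sequentially] .

lemma log_rate_exp: "n \<ge> 1 \<Longrightarrow> log_rate j n = exp (ln (real n) - sqrt (iterlog j (real n)))"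
  unfolding log_rate_def by (simp add: exp_diff)

lemma log_rate_unbounded:
  assumes "j \<ge> 1"
  shows "filterlim (log_rate j) at_top sequentially"
proof (rule filterlim_at_top_mono)
  show "filterlim (\<lambda>n. exp (ln (real n) - sqrt (ln (real n)))) at_top sequentially" by real_asymp
  show "\<forall>\<^sub>F n in sequentially. exp (ln (real n) - sqrt (ln (real n))) \<le> log_rate j n"
    using eventually_logs_ge1_nat[of j] eventually_ge_at_top[of 1]
  proof eventually_elim
    case (elim n)
    obtain i where j: "j = Suc i" using assms by (cases j) auto
    have "iterlog j (real n) \<le> ln (real n)"
      using elim iterlog_le[of i "ln (real n)"] unfolding j by (simp add: iterlog_simps(3) logs_ge1_Suc)
    then show ?case using elim(2) by (simp add: log_rate_exp)
  qed
qed

text \<open>The function increases because, in terms of \<open>t = ln n\<close>, its logarithm is \<open>t\<close> minus a function of \<open>t\<close>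
  that does not increase distances.\<close>

lemma rate_log_rate:
  assumes "j \<ge> 1"
  obtains n0 where "rate (log_rate j) n0"
proof -
  obtain i where j: "j = Suc i" using assms by (cases j) auto
  have "\<forall>\<^sub>F n in sequentially. n \<ge> 1 \<and> logs_ge1 j (real n) \<and> log_rate j n \<ge> 2 * ln 2"
    using eventually_logs_ge1_nat[of j] eventually_ge_at_top[of 1] log_rate_unbounded[OF assms]
    by (auto simp: filterlim_at_top eventually_conj_iff)
  from eventually_happens'[OF sequentially_bot this]
  obtain n0 where n0: "n0 \<ge> 1" "logs_ge1 j (real n0)" "log_rate j n0 \<ge> 2 * ln 2" by blast
  have good: "logs_ge1 j (real n)" if "n0 \<le> n" for n using iterlog_lipschitz[OF n0(2)] that by simp
  have "rate (log_rate j) n0"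
  proof
    fix m n assume mn: "n0 \<le> m" "m \<le> n"
    have m: "1 \<le> real m" "logs_ge1 i (ln (real m))"
      using good[OF mn(1)] unfolding j logs_ge1_Suc by auto
    have "ln (real m) \<le> ln (real n)" using mn m by simp
    from iterlog_lipschitz[OF m(2) this]
    have L: "iterlog j m \<le> iterlog j n" "iterlog j n - iterlog j m \<le> ln (real n) - ln (real m)"
      unfolding j iterlog_simps(3) by auto
    have "1 \<le> iterlog j m" using good[OF mn(1)] unfolding logs_ge1_def by blast
    from sqrt_diff_le[OF this L(1)]
    have "sqrt (iterlog j n) - sqrt (iterlog j m) \<le> ln (real n) - ln (real m)" using L(2) by simp
    then show "log_rate j m \<le> log_rate j n" using mn n0(1) by (simp add: log_rate_exp)
    show "log_rate j n / real n \<le> log_rate j m / real m"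
      using mn n0(1) L(1) unfolding log_rate_def by (simp add: divide_simps)
  next
    have "(\<lambda>n. exp (- sqrt (iterlog j (real n)))) \<longlonglongrightarrow> 0"
    proof (rule filterlim_compose[OF _ filterlim_iterlog_nat])
      show "((\<lambda>t. exp (- sqrt t)) \<longlongrightarrow> (0::real)) at_top" by real_asymp
    qed
    moreover have "\<forall>\<^sub>F n in sequentially. log_rate j n / real n = exp (- sqrt (iterlog j (real n)))"
      using eventually_ge_at_top[of 1]
      by eventually_elim (simp add: log_rate_def exp_minus field_simps)
    ultimately show "(\<lambda>n. log_rate j n / real n) \<longlonglongrightarrow> 0" using filterlim_cong by force
  qed (use n0 log_rate_unbounded[OF assms] in auto)
  then show ?thesis using that by blast
qed

text \<open>This describes the cases \<open>q = 3\<close> and \<open>q \<ge> 4\<close> of \<open>Phi\<close> uniformly: with \<open>\<beta> = 1 / (\<alpha> + 1)\<close> in the first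
  case, as \<open>\<alpha> / (\<alpha> + 1) = 1 - \<beta>\<close>, and with \<open>\<beta> = 1 / \<alpha>\<close> in the second.\<close>

lemma Phi_iterlog:
  assumes "q \<ge> 3" "\<alpha> > 0"
  obtains \<beta> where "\<beta> > 0" "\<And>n. n \<ge> 1 \<Longrightarrow> logs_ge1 (q - 2) (real n) \<Longrightarrow>
    Phi q \<alpha> n = exp (real n / exp (\<beta> * iterlog (q - 2) (real n)))"
proof (cases "q = 3")
  case True
  have "Phi q \<alpha> n = exp (real n / exp (1 / (\<alpha> + 1) * iterlog (q - 2) (real n)))" if n: "n \<ge> 1" for n
  proof -
    have "\<alpha> / (\<alpha> + 1) = 1 - 1 / (\<alpha> + 1)" using assms by (simp add: field_simps)
    then have "real n powr (\<alpha> / (\<alpha> + 1)) = real n / real n powr (1 / (\<alpha> + 1))"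
      using n by (simp add: powr_diff)
    also have "real n powr (1 / (\<alpha> + 1)) = exp (1 / (\<alpha> + 1) * iterlog (q - 2) (real n))"
      using n True by (simp add: powr_def iterlog_def)
    finally show ?thesis using True by (simp add: Phi_def)
  qed
  then show ?thesis using that[of "1 / (\<alpha> + 1)"] assms by simp
next
  case False
  have "Phi q \<alpha> n = exp (real n / exp (1 / \<alpha> * iterlog (q - 2) (real n)))"
    if n: "n \<ge> 1" "logs_ge1 (q - 2) (real n)" for n
  proof -
    have q: "q - 2 = Suc (q - 3)" using assms False by simp
    have "1 \<le> iterlog (q - 3) (real n)" using n(2) unfolding logs_ge1_def by simp
    then have "iterlog (q - 3) (real n) powr (1 / \<alpha>) = exp (1 / \<alpha> * iterlog (q - 2) (real n))"
      unfolding q iterlog_simps(2) by (simp add: powr_def)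
    then show ?thesis using assms False by (simp add: Phi_def iterlog_def)
  qed
  then show ?thesis using that[of "1 / \<alpha>"] assms by simp
qed

lemma separating_log_rate:
  assumes q: "q \<ge> 3"
  shows "separating_rate q (log_rate (q - 2))"
  unfolding separating_rate_def
proof (intro conjI allI impI)
  let ?L = "iterlog (q - 2)"
  fix \<alpha> :: real and c :: nat assume \<alpha>: "\<alpha> > 0" and c: "c \<ge> 1"
  obtain \<beta> where \<beta>: "\<beta> > 0" "\<And>n. n \<ge> 1 \<Longrightarrow> logs_ge1 (q - 2) (real n) \<Longrightarrow>
      Phi q \<alpha> n = exp (real n / exp (\<beta> * ?L (real n)))"
    using Phi_iterlog[OF q \<alpha>] by blast
  have "\<forall>\<^sub>F t in at_top. 4 * real c * exp (sqrt t) < exp (\<beta> * t)"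
    using \<beta>(1) c by real_asymp
  then have "\<forall>\<^sub>F n in sequentially. 4 * real c * exp (sqrt (?L (real n))) < exp (\<beta> * ?L (real n))"
    by (rule eventually_compose_filterlim[OF _ filterlim_iterlog_nat])
  then show "\<forall>\<^sub>F n in sequentially. Phi q \<alpha> (c * n) < exp (log_rate (q - 2) n / 4)"
    using eventually_logs_ge1_nat[of "q - 2"] eventually_ge_at_top[of 1]
  proof eventually_elim
    case (elim n)
    have "1 * n \<le> c * n" using c by (intro mult_right_mono) auto
    then have le: "real n \<le> real (c * n)" by (simp only: of_nat_le_iff mult_1)
    note lip = iterlog_lipschitz[OF elim(2) le]
    have cn: "c * n \<ge> 1" using c elim(3) by simp
    have "4 * real c * exp (sqrt (?L (real n))) < exp (\<beta> * ?L (real (c * n)))"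
      using elim(1) lip \<beta>(1) by (smt (verit) exp_le_cancel_iff mult_left_mono)
    then have "real (c * n) / exp (\<beta> * ?L (real (c * n))) < log_rate (q - 2) n / 4"
      using elim(3) unfolding log_rate_def by (simp add: field_simps)
    then show ?case using \<beta>(2)[OF cn] lip by simp
  qed
next
  let ?L = "iterlog (q - 2)"
  fix \<alpha> :: real and r :: nat assume \<alpha>: "\<alpha> > 0" and r: "r \<ge> 1"
  define K where "K = 1 / \<alpha>"
  have K: "K > 0" unfolding K_def using \<alpha> by simp
  have r0: "real r > 0" using r by simp
  have "\<forall>\<^sub>F t in at_top. 9 * real r * t powr K \<le> exp (sqrt t)"
    using K r0 by real_asymp
  then have e1: "\<forall>\<^sub>F n in sequentially. 9 * real r * ?L (real n) powr K \<le> exp (sqrt (?L (real n)))"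
    by (rule eventually_compose_filterlim[OF _ filterlim_iterlog_nat])
  have e2: "\<forall>\<^sub>F n in sequentially. 2 * (ln (real n) powr K * ln (18 * (3 * real r * real n) ^ 2)) \<le> real n"
    using K r0 by real_asymp
  show "\<forall>\<^sub>F n in sequentially. 18 * real (2 * (r * n) + 1) ^ 2 *
      exp (3 / 2 * log_rate (q - 2) (2 * (r * n) + 1)) \<le> Phi (q + 1) \<alpha> n"
    using e1 e2 eventually_logs_ge1_nat[of "q - 2"] eventually_ge_at_top[of 1]
  proof eventually_elim
    case (elim n)
    define N where "N = 2 * (r * n) + 1"
    define l where "l = ?L (real n)"
    have "r * n \<ge> 1" "r * n \<ge> n" using r elim(4) by auto
    then have N: "n \<le> N" "N \<le> 3 * (r * n)" "N \<ge> 1" unfolding N_def by linarith+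
    have N': "real N \<le> 3 * real r * real n" using N(2) by (metis of_nat_le_iff of_nat_mult of_nat_numeral mult.assoc)
    have n0: "real n > 0" using elim(4) by simp
    have l1: "l \<ge> 1" using elim(3) unfolding l_def logs_ge1_def by blast
    then have lK: "l powr K > 0" by simp
    have lN: "l \<le> ?L (real N)" using iterlog_lipschitz[OF elim(3), of "real N"] N(1) unfolding l_def by simp
    obtain i where i: "q - 2 = Suc i" using q by (cases "q - 2") auto
    have "l \<le> ln (real n)"
      using elim(3) iterlog_le[of i "ln (real n)"] unfolding l_def i by (simp add: iterlog_simps(3) logs_ge1_Suc)
    then have lnK: "l powr K \<le> ln (real n) powr K" using l1 K by (intro powr_mono2) auto
    have pos18: "0 \<le> ln (18 * real N ^ 2)" using N(3) by (intro ln_ge_zero) (simp add: power2_eq_square mult_ge1_I)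
    have "ln (18 * real N ^ 2) \<le> ln (18 * (3 * real r * real n) ^ 2)"
      using N(3) N' by (intro ln_mono mult_left_mono power_mono) auto
    then have "2 * (l powr K * ln (18 * real N ^ 2)) \<le> 2 * (ln (real n) powr K * ln (18 * (3 * real r * real n) ^ 2))"
      using lnK pos18 by (intro mult_left_mono mult_mono) auto
    also have "\<dots> \<le> real n" using elim(2) .
    finally have a: "ln (18 * real N ^ 2) \<le> real n / l powr K / 2" using lK by (simp add: field_simps)
    have "log_rate (q - 2) N \<le> (3 * real r * real n) / exp (sqrt l)"
      unfolding log_rate_def using N' lN by (intro frac_le) auto
    also have "\<dots> \<le> (3 * real r * real n) / (9 * real r * l powr K)"
      using elim(1) r0 lK n0 unfolding l_def by (intro divide_left_mono) (auto intro!: mult_pos_pos)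
    also have "\<dots> = real n / l powr K / 3" using r0 lK by (simp add: field_simps)
    finally have b: "3 / 2 * log_rate (q - 2) N \<le> real n / l powr K / 2" by simp
    have "18 * real N ^ 2 * exp (3 / 2 * log_rate (q - 2) N) = exp (ln (18 * real N ^ 2) + 3 / 2 * log_rate (q - 2) N)"
      using N(3) by (simp add: exp_add)
    also have "\<dots> \<le> exp (real n / l powr K)" using a b by simp
    also have "\<dots> = Phi (q + 1) \<alpha> n"
    proof -
      have "q + 1 - 3 = q - 2" using q by simp
      then show ?thesis using q unfolding Phi_def l_def K_def iterlog_def by simp
    qed
    finally show ?case unfolding N_def .
  qed
qed

theorem separating_rate_exists:
  assumes "q \<ge> 2"
  obtains f n0 where "rate f n0" "separating_rate q f"
proof (cases "q = 2")
  case True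
  then show ?thesis using that rate_log_square separating_log_square by blast
next
  case False
  then have q: "q \<ge> 3" using assms by simp
  have "1 \<le> q - 2" using q by simp
  then obtain n0 where "rate (log_rate (q - 2)) n0" by (rule rate_log_rate)
  then show ?thesis using that separating_log_rate[OF q] by blast
qed

section \<open>The Lie algebra of a word\<close>

lemma agree_window: "agree w r x y \<longleftrightarrow> window w (x - int r) (2 * r + 1) = window w (y - int r) (2 * r + 1)"
proof
  assume ag: "agree w r x y"
  have "w (x - int r + int j) = w (y - int r + int j)" if "j < 2 * r + 1" for j
  proof -
    have "\<bar>int j - int r\<bar> \<le> int r" using that by linarith
    then have "w (x + (int j - int r)) = w (y + (int j - int r))" using ag unfolding agree_def by blast
    then show ?thesis by (simp add: algebra_simps)
  qed
  then show "window w (x - int r) (2 * r + 1) = window w (y - int r) (2 * r + 1)"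
    unfolding window_def map_eq_conv set_upt by (simp only: atLeastLessThan_iff Ball_def) blast
next
  assume eq: "window w (x - int r) (2 * r + 1) = window w (y - int r) (2 * r + 1)"
  show "agree w r x y"
    unfolding agree_def
  proof (intro allI impI)
    fix d :: int assume d: "\<bar>d\<bar> \<le> int r"
    define j where "j = nat (d + int r)"
    have j: "int j = d + int r" "j < 2 * r + 1" unfolding j_def using d by linarith+
    have "window w (x - int r) (2 * r + 1) ! j = window w (y - int r) (2 * r + 1) ! j" using eq by simp
    then show "w (x + d) = w (y + d)" using j unfolding window_def by (simp del: upt_Suc)
  qed
qed


text \<open>A local rule is known once its coefficients are known in one representative of each of the
  \<open>complexity w (2 * r + 1)\<close> neighbourhoods: there are \<open>2 * r + 1\<close> places within reach and nine pairs of
  components.\<close>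

lemma local_rule_finite_dim:
  obtains B :: "'f::field operator set"
  where "finite B" "card B \<le> 9 * (2 * r + 1) * complexity w (2 * r + 1)"
    "local_rule w r \<subseteq> ops.span B"
proof -
  define U where "U = (\<lambda>u. SOME x. window w (x - int r) (2 * r + 1) = u) ` range (\<lambda>x. window w x (2 * r + 1))"
  have finU: "finite U" unfolding U_def using finite_windows[of w] by simp
  have cardU: "card U \<le> complexity w (2 * r + 1)"
    unfolding U_def complexity_def using finite_windows[of w] by (rule card_image_le)
  have rep: "\<exists>x\<in>U. agree w r x y" for y
  proof -
    define x where "x = (SOME x. window w (x - int r) (2 * r + 1) = window w (y - int r) (2 * r + 1))"
    have "window w (x - int r) (2 * r + 1) = window w (y - int r) (2 * r + 1)"
      unfolding x_def by (rule someI[of _ y]) simp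
    moreover have "x \<in> U" unfolding U_def x_def by blast
    ultimately show ?thesis unfolding agree_window by blast
  qed
  define T where "T = U \<times> {- int r..int r} \<times> (UNIV :: corner set) \<times> (UNIV :: corner set)"
  have finT: "finite T" 
    unfolding T_def by (intro finite_cartesian_product finU corner_UNIV(2)) simp
  have cardT: "card T \<le> 9 * (2 * r + 1) * complexity w (2 * r + 1)"
  proof -
    have "card {- int r..int r} = 2 * r + 1" unfolding card_atLeastAtMost_int by linarith
    then have "card T = card U * ((2 * r + 1) * (3 * 3))"
      unfolding T_def by (simp only: card_cartesian_product corner_UNIV(3))
    also have "\<dots> \<le> complexity w (2 * r + 1) * ((2 * r + 1) * (3 * 3))"
      using cardU by (rule mult_right_mono) simp
    finally show ?thesis by (simp add: ac_simps)
  qed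
  define h where "h = (\<lambda>(x, d, l, k) (a :: 'f operator). app a (delta (x + d) l) x k)"
  have sub: "ops.subspace (local_rule w r :: 'f operator set)"
    by (intro ops.subspaceI local_rule_0 local_rule_add local_rule_scale)
  have lin: "Vector_Spaces.linear opscale (*) (h t)" for t
  proof -
    show ?thesis unfolding Vector_Spaces.linear_iff h_def
      using vector_space_scalars opscale_vector_space by (auto simp: case_prod_unfold)
  qed
  have sep: "a = 0" if a: "a \<in> local_rule w r" and z: "\<And>t. t \<in> T \<Longrightarrow> h t a = 0" for a
  proof (rule operator_eqI)
    fix y k and v :: "int \<Rightarrow> corner \<Rightarrow> 'f"
    obtain x where x: "x \<in> U" "agree w r x y" using rep by blast
    define v' where "v' z = v (z - x + y)" for z
    have "app a v y k = app a v' x k"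
      by (rule local_ruleD[OF a agree_sym[OF x(2)]]) (simp add: v'_def algebra_simps)
    also have "\<dots> = 0"
      unfolding local_rule_expand[OF a, of v' x k]
    proof (rule sum.neutral, rule ballI)
      fix t assume "t \<in> {- int r..int r} \<times> (UNIV :: corner set)"
      then have "(x, fst t, snd t, k) \<in> T" unfolding T_def using x(1) by auto
      from z[OF this] show "(case t of (d, l) \<Rightarrow> v' (x + d) l * app a (delta (x + d) l) x k) = 0"
        unfolding h_def by (simp add: case_prod_unfold)
    qed
    finally show "app a v y k = app 0 v y k" by simp
  qed
  obtain B :: "'f operator set" where "finite B" "card B \<le> card T" "local_rule w r \<subseteq> ops.span B"
    using ops.finite_dim_by_functionals[where h = h, OF sub finT lin sep] .
  then show ?thesis using that[of B] cardT by simp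
qed

lemma window_Suc: "window w x (Suc n) = w x # window w (x + 1) n"
proof (rule nth_equalityI)
  fix i assume "i < length (window w x (Suc n))"
  then have "i < Suc n" by (simp add: window_def)
  then show "window w x (Suc n) ! i = (w x # window w (x + 1) n) ! i"
    by (cases i) (auto simp: window_def algebra_simps simp del: upt_Suc)
qed (simp add: window_def)

text \<open>The product of this list checks that the word \<open>u\<close> begins at the current place, and moves to its end.\<close>

definition reader :: "(int \<Rightarrow> bool) \<Rightarrow> bool list \<Rightarrow> 'f::field operator list" where
  "reader w u = concat (map (\<lambda>b. [ind {x. w x = b}, shift 1]) u)"

lemma reader_props:
  "set (reader w u) \<subseteq> word_gens w" "length (reader w u) = 2 * length u"
  unfolding reader_def
proof (induction u)
  case (Cons b u)
  case 1
  show ?case using Cons by (cases b) (auto simp: word_gens_def)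
  case 2
  show ?case using Cons by simp
qed auto

lemma app_reader:
  fixes v :: "int \<Rightarrow> corner \<Rightarrow> 'f::field"
  shows "app (prod_list (reader w u)) v x k = (if window w x (length u) = u then v (x + int (length u)) k else 0)"
proof (induction u arbitrary: x)
  case Nil
  then show ?case by (simp add: reader_def window_def)
next
  case (Cons b u)
  have "(prod_list (reader w (b # u)) :: 'f operator) = ind {x. w x = b} * (shift 1 * prod_list (reader w u))"
    by (simp add: reader_def)
  then show ?case using Cons by (simp add: window_Suc algebra_simps)
qed

text \<open>Applied to the constant function \<open>1\<close>, the operator that reads \<open>u\<close> has value \<open>1\<close> where \<open>u\<close> occurs and
  value \<open>0\<close> elsewhere.  Evaluation at occurrences of the different factors is therefore a dual family.\<close>

lemma reader_independent:
  fixes w :: "int \<Rightarrow> bool"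
  defines "g \<equiv> \<lambda>u. prod_list (reader w u) :: 'f::field operator"
  shows "inj_on g (range (\<lambda>x. window w x n))" "ops.independent (g ` range (\<lambda>x. window w x n))"
proof -
  define pos where "pos u = (SOME x. window w x n = u)" for u
  have pos: "window w (pos u) n = u" if u: "u \<in> range (\<lambda>x. window w x n)" for u
  proof -
    obtain x where "window w x n = u" using u by blast
    then show ?thesis unfolding pos_def by (rule someI)
  qed
  define h where "h u a = app a (\<lambda>_ _. 1) (pos u) C1" for u and a :: "'f operator"
  have lin: "Vector_Spaces.linear opscale (*) (h u)" for u
  proof -
    show ?thesis unfolding Vector_Spaces.linear_iff h_def
      using vector_space_scalars opscale_vector_space by auto
  qed
  have dual: "h u (g v) = (if u = v then 1 else 0)"
    if u: "u \<in> range (\<lambda>x. window w x n)" and v: "v \<in> range (\<lambda>x. window w x n)" for u v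
  proof -
    have "length v = n" using v by (auto simp: window_def)
    then show ?thesis unfolding h_def g_def app_reader using pos[OF u] by simp
  qed
  show "inj_on g (range (\<lambda>x. window w x n))" "ops.independent (g ` range (\<lambda>x. window w x n))"
    using ops.biorthogonal[where h = h and g = g and I = "range (\<lambda>x. window w x n)"] lin dual by auto
qed

text \<open>A periodic word has no more factors of any length than its period.\<close>

lemma aperiodic:
  fixes w :: "int \<Rightarrow> bool"
  assumes unb: "\<And>m. \<exists>n\<ge>1. complexity w n \<ge> m" and e: "e \<noteq> 0"
  shows "\<exists>z. w (z + e) \<noteq> w z"
proof (rule ccontr)
  assume no: "\<not> ?thesis"
  have fwd: "w (z + int m * e) = w z" for z m
  proof (induction m)
    case (Suc m)
    have "w (z + int (Suc m) * e) = w ((z + int m * e) + e)" by (simp add: algebra_simps)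
    also have "\<dots> = w (z + int m * e)" using no by blast
    finally show ?case using Suc by simp
  qed simp
  have per: "w (z + k * e) = w z" for z k
  proof (cases "k \<ge> 0")
    case True
    then show ?thesis using fwd[of z "nat k"] by simp
  next
    case False
    then show ?thesis using fwd[of "z + k * e" "nat (- k)"] by (simp add: algebra_simps)
  qed
  define E where "E = \<bar>e\<bar>"
  have E: "E > 0" unfolding E_def using e by simp
  have perE: "w (z + k * E) = w z" for z k
    using per[of z "if e > 0 then k else - k"] unfolding E_def by (simp split: if_splits)
  have "complexity w n \<le> nat E" for n
  proof -
    have "window w x n = window w (x mod E) n" for x
      unfolding window_def
    proof (rule map_cong[OF refl])
      fix j
      have "x + int j = x mod E + int j + (x div E) * E" by (simp add: algebra_simps)
      then show "w (x + int j) = w (x mod E + int j)" using perE by metis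
    qed
    then have "range (\<lambda>x. window w x n) \<subseteq> (\<lambda>x. window w x n) ` {0..<E}"
      using E by (metis (no_types, lifting) atLeastLessThan_iff image_eqI image_subsetI pos_mod_bound pos_mod_sign)
    then have "complexity w n \<le> card {0..<E}"
      unfolding complexity_def by (intro surj_card_le) auto
    then show ?thesis by simp
  qed
  moreover obtain n where "complexity w n \<ge> Suc (nat E)" using unb by blast
  ultimately show False by (metis not_less_eq_eq)
qed

theorem simple_lie_algebra_of_word:
  fixes w :: "int \<Rightarrow> bool"
  assumes rec: "\<And>i n. \<exists>K. \<forall>x. \<exists>t\<in>{0..int K}. window w (x + t) n = window w i n"
    and unb: "\<And>m. \<exists>n\<ge>1. complexity w n \<ge> m"
  obtains br :: "(nat \<Rightarrow>\<^sub>0 'f::field) \<Rightarrow> (nat \<Rightarrow>\<^sub>0 'f) \<Rightarrow> (nat \<Rightarrow>\<^sub>0 'f)"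
  where "simple_lie_algebra fscale br" "lie_algebra.finitely_generated fscale br"
    "\<And>V. lie_algebra.finite_dim_generating_subspace fscale br V \<Longrightarrow>
       \<exists>c\<ge>1. \<forall>n\<ge>1. complexity w n \<le> lie_algebra.growth fscale br V (c * n)"
    "\<And>V. lie_algebra.finite_dim_generating_subspace fscale br V \<Longrightarrow>
       \<exists>r\<ge>1. \<forall>n. lie_algebra.growth fscale br V n \<le>
         9 * (2 * (r * n) + 1) * complexity w (2 * (r * n) + 1)"
proof -
  have rec': "\<exists>K. \<forall>x. \<exists>t\<in>{0..int K}. agree w r (x + t) y" for r y
  proof -
    obtain K where K: "\<forall>x. \<exists>t\<in>{0..int K}. window w (x + t) (2 * r + 1) = window w (y - int r) (2 * r + 1)"
      using rec by blast
    have "\<exists>t\<in>{0..int K}. agree w r (x + t) y" for x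
    proof -
      obtain t where "t \<in> {0..int K}" "window w (x - int r + t) (2 * r + 1) = window w (y - int r) (2 * r + 1)"
        using K by blast
      then show ?thesis unfolding agree_window by (intro bexI[of _ t]) (simp_all add: algebra_simps)
    qed
    then show ?thesis by blast
  qed
  interpret filtered_matrix_algebra "opscale :: 'f \<Rightarrow> _" unit "word_gens w" "local_rule w"
    "\<lambda>r. 9 * (2 * r + 1) * complexity w (2 * r + 1)" "complexity w"
  proof unfold_locales
    fix i j k l :: corner
    show "unit i j * unit k l = (if j = k then unit i l else 0 :: 'f operator)" by (rule unit_mult)
    show "unit i j \<in> (local_rule w 0 :: 'f operator set)" by (rule local_rule_basic)
  next
    fix s :: "'f operator" and i j assume "s \<in> word_gens w"
    then show "unit i j * s = s * unit i j" by (rule word_gens_commute)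
  next
    show "1 \<in> (word_gens w :: 'f operator set)" "finite (word_gens w :: 'f operator set)"
      by (auto simp: word_gens_def)
    have "app (unit C1 C2 :: 'f operator) (\<lambda>_ _. 1) 0 C1 = 1" by simp
    then show "(unit C1 C2 :: 'f operator) \<noteq> 0" by (metis app_simps(1) zero_neq_one)
  next
    fix J and a :: "'f operator"
    assume "J \<subseteq> word_algebra w" "ops.subspace J" "a \<in> J" "a \<noteq> 0"
      "\<And>x y. x \<in> J \<Longrightarrow> y \<in> word_algebra w \<Longrightarrow> x * y \<in> J \<and> y * x \<in> J"
    then show "1 \<in> J" using word_algebra_simple[OF rec' aperiodic[OF unb]] by blast
  next
    fix n :: nat
    show "ops.subspace (local_rule w n :: 'f operator set)"
      by (intro ops.subspaceI local_rule_0 local_rule_add local_rule_scale)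
    show "\<exists>B. finite B \<and> card B \<le> 9 * (2 * n + 1) * complexity w (2 * n + 1) \<and>
        (local_rule w n :: 'f operator set) \<subseteq> ops.span B"
      using local_rule_finite_dim by metis
    show "local_rule w m \<subseteq> (local_rule w n :: 'f operator set)" if "m \<le> n" for m
      using that by (rule local_rule_mono)
    show "x * y \<in> local_rule w (m + n)" if "x \<in> local_rule w m" "y \<in> local_rule w n"
      for m and x y :: "'f operator"
      using that by (rule local_rule_mult)
    show "\<exists>C :: 'f operator set. ops.independent C \<and> finite C \<and> card C = complexity w n \<and>
        (\<forall>c\<in>C. \<exists>ss. set ss \<subseteq> word_gens w \<and> length ss = 2 * n \<and> c = prod_list ss)"
    proof -
      let ?R = "range (\<lambda>x. window w x n)"
      let ?C = "(\<lambda>u. prod_list (reader w u) :: 'f operator) ` ?R"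
      have "card ?C = complexity w n"
        unfolding complexity_def by (rule card_image[OF reader_independent(1)])
      moreover have "finite ?C" using finite_windows by blast
      moreover have "\<exists>ss. set ss \<subseteq> word_gens w \<and> length ss = 2 * n \<and> c = prod_list ss" if c: "c \<in> ?C" for c
      proof -
        obtain u where u: "u \<in> ?R" "c = prod_list (reader w u)" using c by blast
        have "length u = n" using u(1) by (auto simp: window_def)
        then show ?thesis using reader_props[of w u] u(2) by (intro exI[of _ "reader w u"]) simp
      qed
      ultimately show ?thesis using reader_independent(2) by (intro exI[of _ ?C]) blast
    qed
  next
    show "word_gens w \<subseteq> (local_rule w 1 :: 'f operator set)"
    proof
      fix s :: "'f operator" assume "s \<in> word_gens w"
      then show "s \<in> local_rule w 1" by (rule word_gens_local)
    qed
    show "\<exists>n\<ge>1. m \<le> complexity w n" for m by (rule unb)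
  qed
  show ?thesis using simple_quotient that by blast
qed

lemma Dim_infinity:
  assumes "\<And>\<alpha>. \<alpha> > 0 \<Longrightarrow> \<exists>\<^sub>F n in sequentially. Phi q \<alpha> n < g n"
  shows "Dim q g = \<infinity>"
proof -
  have "{\<alpha>. 0 < \<alpha> \<and> (\<forall>\<^sub>F n in sequentially. g n \<le> Phi q \<alpha> n)} = {}"
    using assms unfolding frequently_def by (auto simp: not_less)
  then show ?thesis unfolding Dim_def by (simp only: image_empty Inf_empty top_ereal_def)
qed

lemma Dim_zero:
  assumes "\<And>\<alpha>. \<alpha> > 0 \<Longrightarrow> \<forall>\<^sub>F n in sequentially. g n \<le> Phi q \<alpha> n"
  shows "Dim q g = 0"
proof -
  have eq: "{\<alpha>. 0 < \<alpha> \<and> (\<forall>\<^sub>F n in sequentially. g n \<le> Phi q \<alpha> n)} = {0<..}"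
    using assms by auto
  have "(INF \<alpha>\<in>{0<..}. ereal \<alpha>) = 0"
  proof (rule antisym)
    show "0 \<le> (INF \<alpha>\<in>{0<..}. ereal \<alpha>)" by (rule INF_greatest) simp
    show "(INF \<alpha>\<in>{0<..}. ereal \<alpha>) \<le> 0"
    proof (rule ereal_le_epsilon2)
      fix \<epsilon> :: real assume "\<epsilon> > 0"
      then have "(INF \<alpha>\<in>{0<..}. ereal \<alpha>) \<le> ereal \<epsilon>" by (intro INF_lower) simp
      then show "(INF \<alpha>\<in>{0<..}. ereal \<alpha>) \<le> 0 + ereal \<epsilon>" by simp
    qed
  qed
  then show ?thesis unfolding Dim_def eq .
qed

theorem corollary6p2:
  fixes q :: nat
  assumes "CHAR('f::field) \<noteq> 2" and "q \<ge> 2"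
  shows "\<exists>(scale :: 'f \<Rightarrow> (nat \<Rightarrow>\<^sub>0 'f) \<Rightarrow> (nat \<Rightarrow>\<^sub>0 'f)) bracket.
           simple_lie_algebra scale bracket \<and>
           lie_algebra.finitely_generated scale bracket \<and>
           lie_algebra.growth_Dim_eq scale bracket q \<infinity> \<and>
           lie_algebra.growth_Dim_eq scale bracket (q + 1) 0"
proof -
  obtain f n0 where f: "rate f n0" "separating_rate q f" using separating_rate_exists[OF assms(2)] by blast
  interpret rate f n0 by (fact f(1))
  obtain w :: "int \<Rightarrow> bool" where
    rec: "\<And>i n. \<exists>K. \<forall>x. \<exists>t\<in>{0..int K}. window w (x + t) n = window w i n"
    and upper: "\<And>n. n \<ge> n0 \<Longrightarrow> complexity w n \<le> 2 * real n * exp (3 / 2 * f n)"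
    and lower: "\<And>M. \<exists>n\<ge>M. exp (f n / 4) \<le> complexity w n"
    using recurrent_word_exists by blast
  have unb: "\<exists>n\<ge>1. complexity w n \<ge> m" for m
  proof -
    have "\<forall>\<^sub>F n in sequentially. 4 * real m \<le> f n" using unbounded by (auto simp: filterlim_at_top)
    then obtain M where M: "\<And>n. n \<ge> M \<Longrightarrow> 4 * real m \<le> f n" unfolding eventually_sequentially by blast
    obtain n where n: "n \<ge> max M 1" "exp (f n / 4) \<le> complexity w n" using lower by blast
    have "real m \<le> f n / 4" using M[of n] n(1) by simp
    also have "\<dots> \<le> exp (f n / 4)" using exp_ge_add_one_self[of "f n / 4"] by linarith
    also have "\<dots> \<le> complexity w n" by (rule n(2))
    finally show ?thesis using n(1) by auto
  qed
  obtain br :: "(nat \<Rightarrow>\<^sub>0 'f) \<Rightarrow> (nat \<Rightarrow>\<^sub>0 'f) \<Rightarrow> (nat \<Rightarrow>\<^sub>0 'f)" where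
    br: "simple_lie_algebra fscale br" "lie_algebra.finitely_generated fscale br"
    and lo: "\<And>V. lie_algebra.finite_dim_generating_subspace fscale br V \<Longrightarrow>
       \<exists>c\<ge>1. \<forall>n\<ge>1. complexity w n \<le> lie_algebra.growth fscale br V (c * n)"
    and up: "\<And>V. lie_algebra.finite_dim_generating_subspace fscale br V \<Longrightarrow>
       \<exists>r\<ge>1. \<forall>n. lie_algebra.growth fscale br V n \<le>
         9 * (2 * (r * n) + 1) * complexity w (2 * (r * n) + 1)"
    using simple_lie_algebra_of_word[OF rec unb] by blast
  interpret L: simple_lie_algebra fscale br by (fact br(1))
  have "L.growth_Dim_eq q \<infinity>"
    unfolding L.growth_Dim_eq_def
  proof (intro allI impI Dim_infinity)
    fix V and \<alpha> :: real assume V: "L.finite_dim_generating_subspace V" and \<alpha>: "\<alpha> > 0"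
    obtain c where c: "c \<ge> 1" "\<And>n. n \<ge> 1 \<Longrightarrow> complexity w n \<le> L.growth V (c * n)" using lo[OF V] by blast
    have "\<forall>\<^sub>F n in sequentially. Phi q \<alpha> (c * n) < exp (f n / 4)"
      using f(2) \<alpha> c(1) unfolding separating_rate_def by blast
    then obtain M where M: "\<And>n. n \<ge> M \<Longrightarrow> Phi q \<alpha> (c * n) < exp (f n / 4)"
      unfolding eventually_sequentially by blast
    show "\<exists>\<^sub>F n in sequentially. Phi q \<alpha> n < real (L.growth V n)"
      unfolding frequently_sequentially
    proof
      fix m
      obtain n where n: "n \<ge> max (max M m) 1" "exp (f n / 4) \<le> complexity w n" using lower by blast
      have "Phi q \<alpha> (c * n) < exp (f n / 4)" using M n(1) by simp
      also have "\<dots> \<le> real (L.growth V (c * n))" using n c(2)[of n] by linarith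
      finally have "Phi q \<alpha> (c * n) < real (L.growth V (c * n))" .
      moreover have "c * n \<ge> m"
      proof -
        have "1 * n \<le> c * n" using c(1) by (rule mult_right_mono) simp
        then show ?thesis using n(1) by linarith
      qed
      ultimately show "\<exists>n\<ge>m. Phi q \<alpha> n < real (L.growth V n)" by blast
    qed
  qed
  moreover have "L.growth_Dim_eq (q + 1) 0"
    unfolding L.growth_Dim_eq_def
  proof (intro allI impI Dim_zero)
    fix V and \<alpha> :: real assume V: "L.finite_dim_generating_subspace V" and \<alpha>: "\<alpha> > 0"
    obtain r where r: "r \<ge> 1" "\<And>n. L.growth V n \<le> 9 * (2 * (r * n) + 1) * complexity w (2 * (r * n) + 1)"
      using up[OF V] by blast
    have "\<forall>\<^sub>F n in sequentially. 18 * real (2 * (r * n) + 1) ^ 2 * exp (3 / 2 * f (2 * (r * n) + 1)) \<le> Phi (q + 1) \<alpha> n"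
      using f(2) \<alpha> r(1) unfolding separating_rate_def by blast
    then show "\<forall>\<^sub>F n in sequentially. real (L.growth V n) \<le> Phi (q + 1) \<alpha> n"
      using eventually_ge_at_top[of n0]
    proof eventually_elim
      case (elim n)
      define N where "N = 2 * (r * n) + 1"
      have "1 * n \<le> r * n" using r(1) by (rule mult_right_mono) simp
      then have "N \<ge> n0" unfolding N_def using elim(2) by linarith
      then have "real (complexity w N) \<le> 2 * real N * exp (3 / 2 * f N)" by (rule upper)
      then have "9 * real N * real (complexity w N) \<le> 9 * real N * (2 * real N * exp (3 / 2 * f N))"
        by (intro mult_left_mono) auto
      also have "\<dots> = 18 * real N ^ 2 * exp (3 / 2 * f N)" by (simp add: power2_eq_square)
      also have "\<dots> \<le> Phi (q + 1) \<alpha> n" using elim(1) unfolding N_def .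
      finally have "9 * real N * real (complexity w N) \<le> Phi (q + 1) \<alpha> n" .
      moreover have "real (L.growth V n) \<le> real (9 * N * complexity w N)"
        using r(2)[of n] unfolding N_def by (simp only: of_nat_le_iff)
      ultimately show ?case by simp
    qed
  qed
  ultimately show ?thesis using br by blast
qed

end
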